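(* Let $n\ge 2$, $V\ge 1$ and let $\eta>0$ be a small constant ($0<\eta<1$). Consider the $2^n\times 2^n$ Benes network $\mathbb{B}_n$ with input servers $\mathcal{S}$ and output servers $\mathcal{D}$, operated (together with its fictitious reference system) under the Grouped-Backpressure algorithm $\mathsf{G\text{-}BP}$ with parameters $V,\eta$, as described in the context. Suppose both the fictitious network and the physical network are empty at time $t=0$, i.e., all the queues are zero. Then: (i) Both the fictitious network and the physical network are stable under $\mathsf{G\text{-}BP}$. (ii) Denote by $\boldsymbol{r}^{\mathsf{G\text{-}BP}}=(r_{sd}^{\mathsf{G\text{-}BP}})_{s,d}$ the time average rate vector of admitted traffic achieved by $\mathsf{G\text{-}BP}$. Then $$U(\boldsymbol{r}^{\mathsf{G\text{-}BP}})\ \ge\ U(\boldsymbol{r}^{\mathsf{opt}})-\frac{B}{V}-2^{n}\beta\eta,$$ where $$B=\frac12\Big[2^{n}(10n-2)+A_{\max}^2\big(2^{3n-1}+2^{2n+1}+2^{3n}\big)\Big].$$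
   Context: **Benes network.** A switch module has two input links and two output links (each pair has an upper and a lower one; the upper output link is called $a$, the lower one $b$); every link has capacity 1 packet/slot. $\mathbb{B}_1$ is a single module. $\mathbb{B}_n$ ($n\ge2$) is built from two copies of $\mathbb{B}_{n-1}$ stacked vertically (upper and lower subnetworks), with one column of $2^{n-1}$ modules (input modules) on the left and one column of $2^{n-1}$ modules (output modules) on the right. The upper (resp. lower) output link of the input module in row $k$ is connected to the $k$-th input link of the upper (resp. lower) subnetwork; the $k$-th output link of the upper (resp. lower) subnetwork is connected to the upper (resp. lower) input link of the output module in row $k$. Thus $\mathbb{B}_n$ has rows $1,\dots,2^{n-1}$ and columns $\mathcal{C}_1,\dots,\mathcal{C}_{2n-1}$; links $2i-1,2i$ on either side of a (sub)network belong to the module in its row $i$. Input servers $\mathcal{S}=\{1,\dots,2^n\}$: servers $2i-1,2i$ are connected to the module of row $i$ in $\mathcal{C}_1$; $m(s)$ is the module to which $s$ is connected. Output servers $\mathcal{D}=\{1,\dots,2^n\}$: servers $2i-1,2i$ are connected to the module of row $i$ in $\mathcal{C}_{2n-1}$. For a node $m$, $j_m$ is its column (input servers are regarded as being in column 0); $m_u$ and $m_l$ are its two next-hop nodes (in the next column, or in $\mathcal{D}$ if $m\in\mathcal{C}_{2n-1}$) with the smaller, respectively larger, row number. $\mathcal{M}_m$ is the set of the two nodes of the preceding column (or servers, if $m\in\mathcal{C}_1$) connected to $m$; $\mathcal{M}_m^u=\{m'\in\mathcal{C}_{j_m-1}: m'_u=m\}$, $\mathcal{M}_m^l=\{m'\in\mathcal{C}_{j_m-1}:m'_l=m\}$.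 Nodes of $\mathcal{C}_n$ are the partition nodes; from each of them there is a unique path to each output server. For $m$ in columns $n,\dots,2n-1$, $\mathcal{O}_m^a$ and $\mathcal{O}_m^b$ are the sets of output servers reachable through link $a$, respectively $b$, of $m$. **Traffic.** Time is slotted, $t=0,1,2,\dots$. $A_{sd}(t)$ is the number of packets of flow $(s,d)$ ($s\in\mathcal{S},d\in\mathcal{D}$) generated at time $t$; for each $(s,d)$ these are i.i.d. over $t$, with $0\le A_{sd}(t)\le A_{\max}<\infty$. The number admitted is $R_{sd}(t)$ with $0\le R_{sd}(t)\le A_{sd}(t)$, and $r_{sd}=\lim_{T\to\infty}\frac1T\sum_{t=0}^{T-1}\mathbb{E}[R_{sd}(t)]$. Throughout, all limits are assumed to exist. A flow is upper division if $d\le2^{n-1}$ and lower division if $d>2^{n-1}$. **Utility and stability.** Each flow has a concave increasing utility $U_{sd}(r_{sd})$ with finite first derivative; $\beta=\max_{sd}U_{sd}'(0)$; $U(\boldsymbol r)=\sum_{s,d}U_{sd}(r_{sd})$. A queue process $Q(t)\ge0$ is stable if $\limsup_{T\to\infty}\frac1T\sum_{t=0}^{T-1}\mathbb{E}[Q(t)]<\infty$; a network is stable if all its queues are. $\Lambda_n$ is the capacity region of the Benes network: the set of arrival rate vectors for which there exist stabilizing routing and scheduling policies; it is known that $\Lambda_n=\{\boldsymbol r: \sum_s r_{sd}\le1\ \forall d,\ \sum_d r_{sd}\le1\ \forall s,\ r_{sd}\ge0\}$. $\boldsymbol r^{\mathsf{opt}}\in\Lambda_n$ is the admitted average rate vector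 that maximizes $U(\boldsymbol r)$ over all stabilizing policies (with admission decisions satisfying $0\le R_{sd}(t)\le A_{sd}(t)$). **Fictitious system.** Delete columns $n+1,\dots,2n-1$, add two destination nodes $D_1$ (upper division flows) and $D_2$ (lower division flows), and connect each $m\in\mathcal{C}_n$ to each of $D_1,D_2$ with a link of capacity 1. **Queues.** Let $[x]^+=\max(x,0)$. - Input servers (both systems): $Q_s^{\mathsf U},Q_s^{\mathsf L}$ with $Q_s^{\mathcal T}(t+1)=[Q_s^{\mathcal T}(t)-\mu^{\mathcal T}_{s,m(s)}(t)]^++R_s^{\mathcal T}(t)$ for $\mathcal T\in\{\mathsf U,\mathsf L\}$, $R_s^{\mathsf U}=\sum_{d\le2^{n-1}}R_{sd}$, $R_s^{\mathsf L}=\sum_{d>2^{n-1}}R_{sd}$. - Nodes in columns $1,\dots,n-1$ (both systems): $Q_m^{\mathsf{UU}},Q_m^{\mathsf{UL}}$ (upper division packets to be sent to $m_u$, resp. $m_l$) and $Q_m^{\mathsf{LU}},Q_m^{\mathsf{LL}}$ (lower division packets to be sent to $m_u$, resp. $m_l$), with $Q_m^{\mathcal T}(t+1)\le[Q_m^{\mathcal T}(t)-\mu^{\mathcal T}_{m,m(\mathcal T)}(t)]^++R_m^{\mathcal T}(t)$, where $m(\mathcal T)=m_u$ for $\mathcal T\in\{\mathsf{UU},\mathsf{LU}\}$ and $m_l$ otherwise; inequality is used because upstream nodes may have fewer packets than the allocated rates. Here $R_m^{\mathsf{UU}}=X_mR_m^{\mathsf U}$, $R_m^{\mathsf{UL}}=(1-X_m)R_m^{\mathsf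 U}$, $R_m^{\mathsf{LU}}=Y_mR_m^{\mathsf L}$, $R_m^{\mathsf{LL}}=(1-Y_m)R_m^{\mathsf L}$, with $X_m(t),Y_m(t)$ i.i.d. Bernoulli, equal to 0 or 1 with probability $1/2$ each (independent of queue states and control decisions), and $R_m^{\mathsf U}=\sum_{m'\in\mathcal M_m^u}\mu^{\mathsf{UU}}_{m',m}+\sum_{m'\in\mathcal M_m^l}\mu^{\mathsf{UL}}_{m',m}$, $R_m^{\mathsf L}=\sum_{m'\in\mathcal M_m^u}\mu^{\mathsf{LU}}_{m',m}+\sum_{m'\in\mathcal M_m^l}\mu^{\mathsf{LL}}_{m',m}$ (for $m\in\mathcal C_1$: $R_m^{\mathsf U}=\sum_{s\in\mathcal M_m}\mu^{\mathsf U}_{s,m}$, $R_m^{\mathsf L}=\sum_{s\in\mathcal M_m}\mu^{\mathsf L}_{s,m}$). - Partition nodes in the fictitious system: $Q_m^{D_i}(t+1)\le[Q_m^{D_i}(t)-\mu_{m,D_i}(t)]^++R_m^{D_i}(t)$, $i=1,2$, with $R_m^{D_1}=R_m^{\mathsf U}$, $R_m^{D_2}=R_m^{\mathsf L}$. - Nodes in columns $n,\dots,2n-1$ of the physical system: two FIFO queues with $Q_m^a(t+1)=[Q_m^a(t)-\mu_{m,m_u}(t)]^++\sum_{m'\in\mathcal M_m}\mu^a_{m',m}(t)$ and $Q_m^b(t+1)=[Q_m^b(t)-\mu_{m,m_l}(t)]^++\sum_{m'\in\mathcal M_m}\mu^b_{m',m}(t)$, where $\mu^a_{m',m}(t)$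 (resp. $\mu^b_{m',m}(t)$) is the actual number of packets with destination in $\mathcal O_m^a$ (resp. $\mathcal O_m^b$) sent from $m'$ to $m$ at time $t$. - Virtual queues: admission queues $H_{sd}(t+1)=[H_{sd}(t)-R_{sd}(t)]^++\gamma_{sd}(t)$, and regulation queues $q_d(t+1)=[q_d(t)-(1-\eta)]^++\sum_sR_{sd}(t)$. The queues of the fictitious network are all $Q_s^{\mathcal T}$, all $Q_m^{\mathcal T}$ ($m$ in columns $1,\dots,n-1$), all $Q_m^{D_i}$ ($m\in\mathcal C_n$), all $H_{sd}$ and all $q_d$; they form the vector $\boldsymbol Z(t)$. **Algorithm $\mathsf{G\text{-}BP}$.** At every slot $t$, observe the arrivals $\boldsymbol A(t)$ and $\boldsymbol Z(t)$, and: 1. For every $(s,d)$ choose $\gamma_{sd}(t)$ maximizing $VU_{sd}(\gamma)-H_{sd}(t)\gamma$ over $0\le\gamma\le A_{\max}$. 2. For $d\le2^{n-1}$ set $R_{sd}(t)=A_{sd}(t)$ if $H_{sd}(t)-q_d(t)-Q_s^{\mathsf U}(t)>0$ and $R_{sd}(t)=0$ otherwise; for $d>2^{n-1}$ the same with $Q_s^{\mathsf L}(t)$ in place of $Q_s^{\mathsf U}(t)$. 3. For a node $k$ in column $j_k\le n-1$ let $\tilde Q_k^{\mathsf U}=\frac12Q_k^{\mathsf{UU}}+\frac12Q_k^{\mathsf{UL}}$ and $\tilde Q_k^{\mathsf L}=\frac12Q_k^{\mathsf{LU}}+\frac12Q_k^{\mathsf{LL}}$; for $k\in\mathcal C_n$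 let $\tilde Q_k^{\mathsf U}=Q_k^{D_1}$, $\tilde Q_k^{\mathsf L}=Q_k^{D_2}$. For $m$ in columns $1,\dots,n-1$ and link $[m,m_u]$ set $W^{\mathsf U}=\max[Q_m^{\mathsf{UU}}-\tilde Q_{m_u}^{\mathsf U},0]$, $W^{\mathsf L}=\max[Q_m^{\mathsf{LU}}-\tilde Q_{m_u}^{\mathsf L},0]$ and choose $\mu^{\mathsf{UU}}_{m,m_u},\mu^{\mathsf{LU}}_{m,m_u}\in\{0,1\}$ with sum $\le1$ maximizing $\mu^{\mathsf{UU}}_{m,m_u}W^{\mathsf U}+\mu^{\mathsf{LU}}_{m,m_u}W^{\mathsf L}$. For link $[m,m_l]$ do the same for $\mu^{\mathsf{UL}}_{m,m_l},\mu^{\mathsf{LL}}_{m,m_l}$ with $Q_m^{\mathsf{UL}},Q_m^{\mathsf{LL}}$ and $\tilde Q_{m_l}^{\mathsf U},\tilde Q_{m_l}^{\mathsf L}$. For $s\in\mathcal S$ and link $[s,m(s)]$ do the same for $\mu^{\mathsf U}_{s,m(s)},\mu^{\mathsf L}_{s,m(s)}$ with $Q_s^{\mathsf U},Q_s^{\mathsf L}$ and $\tilde Q_{m(s)}^{\mathsf U},\tilde Q_{m(s)}^{\mathsf L}$. A service rate whose queue difference (before taking the maximum with 0) is negative is set to 0. The same actions are used in the fictitious and the physical systems for the input servers and columns $1,\dots,n-1$. 4. For every node $m$ in columns $n,\dots,2n-1$ of the physical system, $\mu_{m,m_u}(t)=\mu_{m,m_l}(t)=1$ for all $t$. 5. In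 the fictitious system choose $\mu_{m,D_1}(t),\mu_{m,D_2}(t)\in\{0,1\}$ maximizing $Q_m^{D_1}\mu_{m,D_1}+Q_m^{D_2}\mu_{m,D_2}$ for $m\in\mathcal C_n$. Then update all queues. *)

theory Defs
  imports "HOL-Probability.Probability"
begin

section \<open>Topology of the Benes network\<close>

text \<open>
  Columns, rows, links and servers are numbered from 1.  The type \<open>side\<close> names the two output links
  of a module (\<open>Up\<close> is link \<open>a\<close>, \<open>Lo\<close> is link \<open>b\<close>) and also the two divisions of the traffic.
\<close>

datatype side = Up | Lo

abbreviation servers :: "nat \<Rightarrow> nat set" where
  "servers n \<equiv> {1..2 ^ n}"

abbreviation rows :: "nat \<Rightarrow> nat set" where
  "rows n \<equiv> {1..2 ^ (n - 1)}"

definition division :: "nat \<Rightarrow> side \<Rightarrow> nat set" where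
  "division n c = (case c of Up \<Rightarrow> {1..2 ^ (n - 1)} | Lo \<Rightarrow> {2 ^ (n - 1)<..2 ^ n})"

text \<open>Links (or servers) \<open>2 * i - 1\<close> and \<open>2 * i\<close> belong to the module in row \<open>i\<close>.\<close>

definition row_of :: "nat \<Rightarrow> nat" where
  "row_of x = (x + 1) div 2"

definition out_link :: "side \<Rightarrow> nat \<Rightarrow> nat" where
  "out_link l i = (case l of Up \<Rightarrow> 2 * i - 1 | Lo \<Rightarrow> 2 * i)"

text \<open>
  \<open>hop n l j i\<close> follows output link \<open>l\<close> of the module in column \<open>j\<close> and row \<open>i\<close> of the network with
  \<open>2 * n - 1\<close> columns.  It is the row of the next module (in column \<open>j + 1\<close>) if \<open>j < 2 * n - 1\<close>,
  and the number of the output link of the whole network (that is, the output server) if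
  \<open>j = 2 * n - 1\<close>.  In the recursive case the two subnetworks have \<open>2 ^ k\<close> rows each and occupy
  columns 2 to \<open>2 * k + 2\<close>; output link number \<open>x\<close> of either of them leads to the output module in
  row \<open>x\<close>.
\<close>

fun hop :: "nat \<Rightarrow> side \<Rightarrow> nat \<Rightarrow> nat \<Rightarrow> nat" where
  "hop 0 l j i = 0"
| "hop (Suc 0) l j i = out_link l i"
| "hop (Suc (Suc k)) l j i =
    (if j = 1 then (case l of Up \<Rightarrow> row_of i | Lo \<Rightarrow> 2 ^ k + row_of i)
     else if j < 2 * k + 2 then
       (if i \<le> 2 ^ k then hop (Suc k) l (j - 1) i
        else 2 ^ k + hop (Suc k) l (j - 1) (i - 2 ^ k))
     else if j = 2 * k + 2 then
       (if i \<le> 2 ^ k then hop (Suc k) l (j - 1) i else hop (Suc k) l (j - 1) (i - 2 ^ k))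
     else out_link l i)"

text \<open>
  Since link \<open>Up\<close> always leads to the smaller row number, \<open>hop n Up\<close> and \<open>hop n Lo\<close> are the next hops
  \<open>m\<^sub>u\<close> and \<open>m\<^sub>l\<close>.
\<close>

lemma hop_Up_less_hop_Lo:
  assumes "n \<ge> 1" "j \<in> {1..2 * n - 1}" "i \<in> rows n"
  shows "hop n Up j i < hop n Lo j i"
  using assms
proof (induction n Up j i rule: hop.induct)
  case (3 k j i)
  have i: "1 \<le> i" "i \<le> 2 ^ Suc k" and j: "1 \<le> j" "j \<le> 2 * k + 3"
    using "3.prems" by auto
  have "j - 1 \<in> {1..2 * Suc k - 1}" if "j \<noteq> 1" "j \<le> 2 * k + 2"
    using that j by auto
  moreover have "i \<in> rows (Suc k)" if "i \<le> 2 ^ k"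
    using that i by auto
  moreover have "i - 2 ^ k \<in> rows (Suc k)" if "\<not> i \<le> 2 ^ k"
    using that i by auto
  ultimately show ?case
    using "3.hyps" i j by (auto simp: out_link_def)
qed (auto simp: out_link_def)

text \<open>Rows of column \<open>j - 1\<close> whose output link \<open>l\<close> leads to the module in column \<open>j\<close>, row \<open>i\<close>.\<close>

definition upstream :: "nat \<Rightarrow> side \<Rightarrow> nat \<Rightarrow> nat \<Rightarrow> nat set" where
  "upstream n l j i = {i' \<in> rows n. hop n l (j - 1) i' = i}"

inductive reaches :: "nat \<Rightarrow> side \<Rightarrow> nat \<Rightarrow> nat \<Rightarrow> nat \<Rightarrow> bool" for n where
  last: "reaches n l (2 * n - 1) i (hop n l (2 * n - 1) i)"
| step: "j < 2 * n - 1 \<Longrightarrow> reaches n l' (Suc j) (hop n l j i) d \<Longrightarrow> reaches n l j i d"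

definition reachable_outputs :: "nat \<Rightarrow> side \<Rightarrow> nat \<Rightarrow> nat \<Rightarrow> nat set" where
  "reachable_outputs n l j i = {d. reaches n l j i d}"


section \<open>Stability, rates and utility\<close>

text \<open>The expectation is an extended nonnegative one, so a queue without a mean is not stable.\<close>

definition stable :: "'w measure \<Rightarrow> (nat \<Rightarrow> 'w \<Rightarrow> real) \<Rightarrow> bool" where
  "stable M Q \<longleftrightarrow>
     limsup (\<lambda>T. (\<Sum>t<T. \<integral>\<^sup>+\<omega>. ennreal (Q t \<omega>) \<partial>M) / of_nat T) < \<infinity>"

definition has_average_rate :: "'w measure \<Rightarrow> (nat \<Rightarrow> 'w \<Rightarrow> nat) \<Rightarrow> real \<Rightarrow> bool" where
  "has_average_rate M R r \<longleftrightarrow>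
     (\<lambda>T. (\<Sum>t<T. \<integral>\<omega>. real (R t \<omega>) \<partial>M) / real T) \<longlonglongrightarrow> r"

definition total_utility :: "nat \<Rightarrow> (nat \<Rightarrow> nat \<Rightarrow> real \<Rightarrow> real) \<Rightarrow> (nat \<Rightarrow> nat \<Rightarrow> real) \<Rightarrow> real" where
  "total_utility n U r = (\<Sum>s\<in>servers n. \<Sum>d\<in>servers n. U s d (r s d))"

definition max_slope :: "nat \<Rightarrow> (nat \<Rightarrow> nat \<Rightarrow> real \<Rightarrow> real) \<Rightarrow> real" where
  "max_slope n U' = Max ((\<lambda>(s, d). U' s d 0) ` (servers n \<times> servers n))"

locale benes_traffic = prob_space M
  for M :: "'w measure" +
  fixes n :: nat
    and Amax :: real
    and A :: "nat \<Rightarrow> nat \<Rightarrow> nat \<Rightarrow> 'w \<Rightarrow> nat"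
    and U U' :: "nat \<Rightarrow> nat \<Rightarrow> real \<Rightarrow> real"
  assumes arrivals_indep:
      "s \<in> servers n \<Longrightarrow> d \<in> servers n \<Longrightarrow> indep_vars (\<lambda>_. count_space UNIV) (A s d) UNIV"
    and arrivals_ident:
      "s \<in> servers n \<Longrightarrow> d \<in> servers n \<Longrightarrow>
         distr M (count_space UNIV) (A s d t) = distr M (count_space UNIV) (A s d 0)"
    and arrivals_bounded:
      "s \<in> servers n \<Longrightarrow> d \<in> servers n \<Longrightarrow> \<omega> \<in> space M \<Longrightarrow> real (A s d t \<omega>) \<le> Amax"
    and utility_concave:
      "s \<in> servers n \<Longrightarrow> d \<in> servers n \<Longrightarrow> concave_on {0..} (U s d)"
    and utility_increasing:
      "s \<in> servers n \<Longrightarrow> d \<in> servers n \<Longrightarrow> mono_on {0..} (U s d)"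
    and utility_derivative:
      "s \<in> servers n \<Longrightarrow> d \<in> servers n \<Longrightarrow> 0 \<le> x \<Longrightarrow>
         (U s d has_real_derivative U' s d x) (at x within {0..})"


section \<open>Arbitrary policies and the optimal rate vector\<close>

text \<open>
  A general joint admission, routing and scheduling policy.  \<open>Qs s d\<close> counts the packets of flow
  \<open>(s, d)\<close> at the input server, \<open>fs s d\<close> those sent from it to its module; \<open>Qm j i s d\<close> counts the
  packets of the flow at the module in column \<open>j\<close>, row \<open>i\<close>, and \<open>fm l j i s d\<close> those sent over its
  link \<open>l\<close>.  Over the links of the last column a packet may only go to its own output server.
\<close>

definition benes_policy ::
  "'w measure \<Rightarrow> nat \<Rightarrow> (nat \<Rightarrow> nat \<Rightarrow> nat \<Rightarrow> 'w \<Rightarrow> nat) \<Rightarrow>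
   (nat \<Rightarrow> nat \<Rightarrow> nat \<Rightarrow> 'w \<Rightarrow> nat) \<Rightarrow>
   (nat \<Rightarrow> nat \<Rightarrow> nat \<Rightarrow> 'w \<Rightarrow> nat) \<Rightarrow> (nat \<Rightarrow> nat \<Rightarrow> nat \<Rightarrow> 'w \<Rightarrow> nat) \<Rightarrow>
   (nat \<Rightarrow> nat \<Rightarrow> nat \<Rightarrow> nat \<Rightarrow> nat \<Rightarrow> 'w \<Rightarrow> nat) \<Rightarrow>
   (side \<Rightarrow> nat \<Rightarrow> nat \<Rightarrow> nat \<Rightarrow> nat \<Rightarrow> nat \<Rightarrow> 'w \<Rightarrow> nat) \<Rightarrow> bool" where
  "benes_policy M n A R Qs fs Qm fm \<longleftrightarrow>
    (\<forall>t. \<forall>s\<in>servers n. \<forall>d\<in>servers n.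
       R s d t \<in> measurable M (count_space UNIV) \<and>
       Qs s d t \<in> measurable M (count_space UNIV) \<and>
       fs s d t \<in> measurable M (count_space UNIV) \<and>
       (\<forall>j\<in>{1..2 * n - 1}. \<forall>i\<in>rows n.
          Qm j i s d t \<in> measurable M (count_space UNIV) \<and>
          (\<forall>l. fm l j i s d t \<in> measurable M (count_space UNIV)))) \<and>
    (\<forall>\<omega>\<in>space M. \<forall>s\<in>servers n. \<forall>d\<in>servers n.
       Qs s d 0 \<omega> = 0 \<and>
       (\<forall>t. R s d t \<omega> \<le> A s d t \<omega> \<and>
            fs s d t \<omega> \<le> Qs s d t \<omega> \<and>
            Qs s d (Suc t) \<omega> = Qs s d t \<omega> - fs s d t \<omega> + R s d t \<omega>)) \<and>
    (\<forall>\<omega>\<in>space M. \<forall>s\<in>servers n. \<forall>t. (\<Sum>d\<in>servers n. fs s d t \<omega>) \<le> 1) \<and>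
    (\<forall>\<omega>\<in>space M. \<forall>j\<in>{1..2 * n - 1}. \<forall>i\<in>rows n. \<forall>s\<in>servers n. \<forall>d\<in>servers n.
       Qm j i s d 0 \<omega> = 0 \<and>
       (\<forall>t. (\<Sum>l\<in>{Up, Lo}. fm l j i s d t \<omega>) \<le> Qm j i s d t \<omega> \<and>
            Qm j i s d (Suc t) \<omega> =
              Qm j i s d t \<omega> - (\<Sum>l\<in>{Up, Lo}. fm l j i s d t \<omega>) +
              (if j = 1 then (if row_of s = i then fs s d t \<omega> else 0)
               else (\<Sum>l\<in>{Up, Lo}. \<Sum>i'\<in>upstream n l j i. fm l (j - 1) i' s d t \<omega>)))) \<and>
    (\<forall>\<omega>\<in>space M. \<forall>l. \<forall>j\<in>{1..2 * n - 1}. \<forall>i\<in>rows n. \<forall>t.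
       (\<Sum>s\<in>servers n. \<Sum>d\<in>servers n. fm l j i s d t \<omega>) \<le> 1) \<and>
    (\<forall>\<omega>\<in>space M. \<forall>l. \<forall>i\<in>rows n. \<forall>s\<in>servers n. \<forall>d\<in>servers n. \<forall>t.
       fm l (2 * n - 1) i s d t \<omega> > 0 \<longrightarrow> d = hop n l (2 * n - 1) i)"

text \<open>Average admitted rate vectors of the stabilizing policies.\<close>

definition stabilizable_rates ::
  "'w measure \<Rightarrow> nat \<Rightarrow> (nat \<Rightarrow> nat \<Rightarrow> nat \<Rightarrow> 'w \<Rightarrow> nat) \<Rightarrow> (nat \<Rightarrow> nat \<Rightarrow> real) set" where
  "stabilizable_rates M n A =
     {r. \<exists>R Qs fs Qm fm. benes_policy M n A R Qs fs Qm fm \<and>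
        (\<forall>s\<in>servers n. \<forall>d\<in>servers n.
           stable M (\<lambda>t \<omega>. real (Qs s d t \<omega>)) \<and>
           (\<forall>j\<in>{1..2 * n - 1}. \<forall>i\<in>rows n. stable M (\<lambda>t \<omega>. real (Qm j i s d t \<omega>))) \<and>
           has_average_rate M (R s d) (r s d))}"

text \<open>
  The capacity region is closed, but its boundary (a link used at its full capacity) need not be
  attained by a stabilizing policy when arrivals are random; hence the maximum is taken over the
  closure.  As the utilities are continuous on the nonnegative reals, a vector that is optimal among
  the \<open>stabilizable_rates\<close> themselves is also optimal in this sense.
\<close>

definition optimal_rates ::
  "'w measure \<Rightarrow> nat \<Rightarrow> (nat \<Rightarrow> nat \<Rightarrow> nat \<Rightarrow> 'w \<Rightarrow> nat) \<Rightarrow> (nat \<Rightarrow> nat \<Rightarrow> real \<Rightarrow> real) \<Rightarrow>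
   (nat \<Rightarrow> nat \<Rightarrow> real) \<Rightarrow> bool" where
  "optimal_rates M n A U r \<longleftrightarrow>
     is_arg_max (total_utility n U) (\<lambda>r. r \<in> closure (stabilizable_rates M n A)) r"


section \<open>The physical and the fictitious network\<close>

text \<open>
  The processes of one run of the algorithm; the last two arguments are always the time slot and the
  sample point.  Argument \<open>c\<close> is a division, \<open>l\<close> an output link, \<open>j\<close> a column, \<open>i\<close> a row.

  \<^item> \<open>aux_rate\<close>, \<open>admitted\<close>, \<open>adm_queue\<close>, \<open>reg_queue\<close> are \<open>\<gamma>\<close>, \<open>R\<close>, \<open>H\<close>, \<open>q\<close>.
  \<^item> \<open>server_pkts c s d\<close> and \<open>node_pkts c l j i d\<close> (columns before \<open>n\<close>) count the packets with
    destination \<open>d\<close> in the queues \<open>Q\<^sub>s\<^sup>c\<close> and \<open>Q\<^sub>m\<^sup>c\<^sup>l\<close>; \<open>server_rate\<close>, \<open>node_rate\<close> are the allocated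
    rates, \<open>server_sent\<close>, \<open>node_sent\<close> the packets of each destination actually sent.  The order of
    service within these queues is left open.
  \<^item> \<open>coin c j i\<close> is \<open>X\<^sub>m\<close> for \<open>c = Up\<close> and \<open>Y\<^sub>m\<close> for \<open>c = Lo\<close>.
  \<^item> \<open>dest_queue c i\<close> and \<open>dest_rate c i\<close> belong to the fictitious link from the partition node in
    row \<open>i\<close> to the destination node of division \<open>c\<close>.
  \<^item> \<open>fifo_queue l j i\<close> (columns from \<open>n\<close> on) lists the destinations of the packets queued at link
    \<open>l\<close>, head of line first.
\<close>

record 'w run =
  aux_rate :: "nat \<Rightarrow> nat \<Rightarrow> nat \<Rightarrow> 'w \<Rightarrow> real"
  admitted :: "nat \<Rightarrow> nat \<Rightarrow> nat \<Rightarrow> 'w \<Rightarrow> nat"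
  adm_queue :: "nat \<Rightarrow> nat \<Rightarrow> nat \<Rightarrow> 'w \<Rightarrow> real"
  reg_queue :: "nat \<Rightarrow> nat \<Rightarrow> 'w \<Rightarrow> real"
  server_pkts :: "side \<Rightarrow> nat \<Rightarrow> nat \<Rightarrow> nat \<Rightarrow> 'w \<Rightarrow> nat"
  server_rate :: "side \<Rightarrow> nat \<Rightarrow> nat \<Rightarrow> 'w \<Rightarrow> nat"
  server_sent :: "side \<Rightarrow> nat \<Rightarrow> nat \<Rightarrow> nat \<Rightarrow> 'w \<Rightarrow> nat"
  node_pkts :: "side \<Rightarrow> side \<Rightarrow> nat \<Rightarrow> nat \<Rightarrow> nat \<Rightarrow> nat \<Rightarrow> 'w \<Rightarrow> nat"
  node_rate :: "side \<Rightarrow> side \<Rightarrow> nat \<Rightarrow> nat \<Rightarrow> nat \<Rightarrow> 'w \<Rightarrow> nat"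
  node_sent :: "side \<Rightarrow> side \<Rightarrow> nat \<Rightarrow> nat \<Rightarrow> nat \<Rightarrow> nat \<Rightarrow> 'w \<Rightarrow> nat"
  coin :: "side \<Rightarrow> nat \<Rightarrow> nat \<Rightarrow> nat \<Rightarrow> 'w \<Rightarrow> bool"
  dest_queue :: "side \<Rightarrow> nat \<Rightarrow> nat \<Rightarrow> 'w \<Rightarrow> real"
  dest_rate :: "side \<Rightarrow> nat \<Rightarrow> nat \<Rightarrow> 'w \<Rightarrow> nat"
  fifo_queue :: "side \<Rightarrow> nat \<Rightarrow> nat \<Rightarrow> nat \<Rightarrow> 'w \<Rightarrow> nat list"

definition server_queue :: "nat \<Rightarrow> 'w run \<Rightarrow> side \<Rightarrow> nat \<Rightarrow> nat \<Rightarrow> 'w \<Rightarrow> nat" where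
  "server_queue n w c s t \<omega> = (\<Sum>d\<in>servers n. server_pkts w c s d t \<omega>)"

definition node_queue :: "nat \<Rightarrow> 'w run \<Rightarrow> side \<Rightarrow> side \<Rightarrow> nat \<Rightarrow> nat \<Rightarrow> nat \<Rightarrow> 'w \<Rightarrow> nat" where
  "node_queue n w c l j i t \<omega> = (\<Sum>d\<in>servers n. node_pkts w c l j i d t \<omega>)"

text \<open>\<open>grouped_queue n w c j i\<close> is \<open>Q\<close> with a tilde, for columns 1 to \<open>n\<close>.\<close>

definition grouped_queue :: "nat \<Rightarrow> 'w run \<Rightarrow> side \<Rightarrow> nat \<Rightarrow> nat \<Rightarrow> nat \<Rightarrow> 'w \<Rightarrow> real" where
  "grouped_queue n w c j i t \<omega> =
     (if j < n then real (node_queue n w c Up j i t \<omega>) / 2 + real (node_queue n w c Lo j i t \<omega>) / 2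
      else dest_queue w c i t \<omega>)"

definition server_diff :: "nat \<Rightarrow> 'w run \<Rightarrow> side \<Rightarrow> nat \<Rightarrow> nat \<Rightarrow> 'w \<Rightarrow> real" where
  "server_diff n w c s t \<omega> =
     real (server_queue n w c s t \<omega>) - grouped_queue n w c 1 (row_of s) t \<omega>"

definition node_diff :: "nat \<Rightarrow> 'w run \<Rightarrow> side \<Rightarrow> side \<Rightarrow> nat \<Rightarrow> nat \<Rightarrow> nat \<Rightarrow> 'w \<Rightarrow> real" where
  "node_diff n w c l j i t \<omega> =
     real (node_queue n w c l j i t \<omega>) - grouped_queue n w c (Suc j) (hop n l j i) t \<omega>"

text \<open>
  Packets of division \<open>c\<close> with destination \<open>d\<close> that actually enter the module in column \<open>j \<le> n\<close>, row
  \<open>i\<close>.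
\<close>

definition pkts_in :: "nat \<Rightarrow> 'w run \<Rightarrow> side \<Rightarrow> nat \<Rightarrow> nat \<Rightarrow> nat \<Rightarrow> nat \<Rightarrow> 'w \<Rightarrow> nat" where
  "pkts_in n w c j i d t \<omega> =
     (if j = 1 then (\<Sum>s\<in>{s \<in> servers n. row_of s = i}. server_sent w c s d t \<omega>)
      else (\<Sum>l\<in>{Up, Lo}. \<Sum>i'\<in>upstream n l j i. node_sent w c l (j - 1) i' d t \<omega>))"

text \<open>Total rate allocated for division \<open>c\<close> on the links into the partition node in row \<open>i\<close>.\<close>

definition alloc_in :: "nat \<Rightarrow> 'w run \<Rightarrow> side \<Rightarrow> nat \<Rightarrow> nat \<Rightarrow> 'w \<Rightarrow> nat" where
  "alloc_in n w c i t \<omega> =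
     (\<Sum>l\<in>{Up, Lo}. \<Sum>i'\<in>upstream n l n i. node_rate w c l (n - 1) i' t \<omega>)"

text \<open>
  Packets with destination \<open>d\<close> that actually enter the module in column \<open>j \<ge> n\<close>, row \<open>i\<close> of the
  physical network; the links leaving these columns always have rate 1.
\<close>

definition fifo_in :: "nat \<Rightarrow> 'w run \<Rightarrow> nat \<Rightarrow> nat \<Rightarrow> nat \<Rightarrow> nat \<Rightarrow> 'w \<Rightarrow> nat" where
  "fifo_in n w j i d t \<omega> =
     (if j = n then (\<Sum>c\<in>{Up, Lo}. pkts_in n w c n i d t \<omega>)
      else (\<Sum>l\<in>{Up, Lo}. \<Sum>i'\<in>upstream n l j i.
              if fifo_queue w l (j - 1) i' t \<omega> \<noteq> [] \<and> hd (fifo_queue w l (j - 1) i' t \<omega>) = d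
              then 1 else 0))"

text \<open>A queue with contents \<open>x\<close> (by destination) is served at rate \<open>\<mu>\<close>; the packets \<open>y\<close> leave.\<close>

definition serves :: "nat \<Rightarrow> nat \<Rightarrow> (nat \<Rightarrow> nat) \<Rightarrow> (nat \<Rightarrow> nat) \<Rightarrow> bool" where
  "serves n \<mu> x y \<longleftrightarrow>
     (\<forall>d\<in>servers n. y d \<le> x d) \<and> (\<Sum>d\<in>servers n. y d) = min \<mu> (\<Sum>d\<in>servers n. x d)"

text \<open>
  Backpressure on one link with queue differences \<open>\<delta>U\<close>, \<open>\<delta>L\<close> of the two divisions: \<open>x\<close> and \<open>y\<close> are
  the rates given to the upper and the lower division.
\<close>

definition backpressure :: "real \<Rightarrow> real \<Rightarrow> nat \<Rightarrow> nat \<Rightarrow> bool" where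
  "backpressure \<delta>U \<delta>L x y \<longleftrightarrow>
     is_arg_max (\<lambda>(x, y). real x * max \<delta>U 0 + real y * max \<delta>L 0)
       (\<lambda>(x, y). x \<in> {0, 1} \<and> y \<in> {0, 1} \<and> x + y \<le> 1) (x, y) \<and>
     (\<delta>U < 0 \<longrightarrow> x = 0) \<and> (\<delta>L < 0 \<longrightarrow> y = 0)"

definition coin_index :: "nat \<Rightarrow> (side \<times> nat \<times> nat) set" where
  "coin_index n = {Up, Lo} \<times> {1..n - 1} \<times> rows n"

definition coin_vector :: "nat \<Rightarrow> 'w run \<Rightarrow> nat \<Rightarrow> 'w \<Rightarrow> side \<times> nat \<times> nat \<Rightarrow> bool" where
  "coin_vector n w t \<omega> = restrict (\<lambda>(c, j, i). coin w c j i t \<omega>) (coin_index n)"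

text \<open>
  \<open>F t\<close> is the history before slot \<open>t\<close>, on which the queues at time \<open>t\<close> depend, and \<open>G t\<close> adds the
  arrivals and the control decisions of slot \<open>t\<close>.  Both may contain further randomness, so ties in
  the algorithm may be broken in any nonanticipating way.  The arrivals of slot \<open>t\<close> are independent
  of \<open>F t\<close>.  The coins of slot \<open>t\<close> are independent of \<open>G t\<close>, hence also of the coins of other slots.
  The queues \<open>dest_queue\<close> are only required to satisfy an inequality, since upstream nodes may have
  fewer packets than the allocated rates.
\<close>

locale grouped_backpressure = benes_traffic M n Amax A U U'
  for M :: "'w measure" and n Amax A U U' +
  fixes V \<eta> :: real
    and F G :: "nat \<Rightarrow> 'w measure"
    and w :: "'w run"
  assumes history:
      "subalgebra M (F t)" "subalgebra M (G t)" "subalgebra (G t) (F t)" "subalgebra (F (Suc t)) (G t)"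
    and virtual_queues_adapted:
      "s \<in> servers n \<Longrightarrow> d \<in> servers n \<Longrightarrow> adm_queue w s d t \<in> borel_measurable (F t)"
      "d \<in> servers n \<Longrightarrow> reg_queue w d t \<in> borel_measurable (F t)"
    and packets_adapted:
      "s \<in> servers n \<Longrightarrow> d \<in> servers n \<Longrightarrow>
         server_pkts w c s d t \<in> measurable (F t) (count_space UNIV)"
      "j \<in> {1..n - 1} \<Longrightarrow> i \<in> rows n \<Longrightarrow> d \<in> servers n \<Longrightarrow>
         node_pkts w c l j i d t \<in> measurable (F t) (count_space UNIV)"
      "i \<in> rows n \<Longrightarrow> dest_queue w c i t \<in> borel_measurable (F t)"
      "j \<in> {n..2 * n - 1} \<Longrightarrow> i \<in> rows n \<Longrightarrow>
         fifo_queue w l j i t \<in> measurable (F t) (count_space UNIV)"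
    and decisions_adapted:
      "s \<in> servers n \<Longrightarrow> d \<in> servers n \<Longrightarrow> aux_rate w s d t \<in> borel_measurable (G t)"
      "s \<in> servers n \<Longrightarrow> d \<in> servers n \<Longrightarrow> admitted w s d t \<in> measurable (G t) (count_space UNIV)"
      "s \<in> servers n \<Longrightarrow> server_rate w c s t \<in> measurable (G t) (count_space UNIV)"
      "s \<in> servers n \<Longrightarrow> d \<in> servers n \<Longrightarrow>
         server_sent w c s d t \<in> measurable (G t) (count_space UNIV)"
      "j \<in> {1..n - 1} \<Longrightarrow> i \<in> rows n \<Longrightarrow>
         node_rate w c l j i t \<in> measurable (G t) (count_space UNIV)"
      "j \<in> {1..n - 1} \<Longrightarrow> i \<in> rows n \<Longrightarrow> d \<in> servers n \<Longrightarrow>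
         node_sent w c l j i d t \<in> measurable (G t) (count_space UNIV)"
      "i \<in> rows n \<Longrightarrow> dest_rate w c i t \<in> measurable (G t) (count_space UNIV)"
    and arrivals_adapted:
      "s \<in> servers n \<Longrightarrow> d \<in> servers n \<Longrightarrow> A s d t \<in> measurable (G t) (count_space UNIV)"
    and arrivals_fresh:
      "s \<in> servers n \<Longrightarrow> d \<in> servers n \<Longrightarrow>
         indep_set (sets (F t)) (sets (vimage_algebra (space M) (A s d t) (count_space UNIV)))"
    and coins_adapted:
      "(c, j, i) \<in> coin_index n \<Longrightarrow> coin w c j i t \<in> measurable (F (Suc t)) (count_space UNIV)"
    and coins_indep:
      "indep_vars (\<lambda>_. count_space UNIV) (\<lambda>(c, j, i). coin w c j i t) (coin_index n)"
    and coins_fair: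
      "(c, j, i) \<in> coin_index n \<Longrightarrow> prob {\<omega> \<in> space M. coin w c j i t \<omega>} = 1 / 2"
    and coins_fresh:
      "indep_set (sets (G t))
         (sets (vimage_algebra (space M) (coin_vector n w t)
           (PiM (coin_index n) (\<lambda>_. count_space UNIV))))"
    and choose_aux_rate:
      "\<omega> \<in> space M \<Longrightarrow> s \<in> servers n \<Longrightarrow> d \<in> servers n \<Longrightarrow>
         is_arg_max (\<lambda>g. V * U s d g - adm_queue w s d t \<omega> * g) (\<lambda>g. 0 \<le> g \<and> g \<le> Amax)
           (aux_rate w s d t \<omega>)"
    and choose_admitted:
      "\<omega> \<in> space M \<Longrightarrow> s \<in> servers n \<Longrightarrow> d \<in> division n c \<Longrightarrow>
         admitted w s d t \<omega> =
           (if adm_queue w s d t \<omega> - reg_queue w d t \<omega> - real (server_queue n w c s t \<omega>) > 0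
            then A s d t \<omega> else 0)"
    and choose_server_rate:
      "\<omega> \<in> space M \<Longrightarrow> s \<in> servers n \<Longrightarrow>
         backpressure (server_diff n w Up s t \<omega>) (server_diff n w Lo s t \<omega>)
           (server_rate w Up s t \<omega>) (server_rate w Lo s t \<omega>)"
    and choose_node_rate:
      "\<omega> \<in> space M \<Longrightarrow> j \<in> {1..n - 1} \<Longrightarrow> i \<in> rows n \<Longrightarrow>
         backpressure (node_diff n w Up l j i t \<omega>) (node_diff n w Lo l j i t \<omega>)
           (node_rate w Up l j i t \<omega>) (node_rate w Lo l j i t \<omega>)"
    and choose_dest_rate:
      "\<omega> \<in> space M \<Longrightarrow> i \<in> rows n \<Longrightarrow>
         is_arg_max (\<lambda>(x, y). dest_queue w Up i t \<omega> * real x + dest_queue w Lo i t \<omega> * real y)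
           (\<lambda>(x, y). x \<in> {0, 1} \<and> y \<in> {0, 1}) (dest_rate w Up i t \<omega>, dest_rate w Lo i t \<omega>)"
    and update_adm_queue:
      "\<omega> \<in> space M \<Longrightarrow> s \<in> servers n \<Longrightarrow> d \<in> servers n \<Longrightarrow>
         adm_queue w s d (Suc t) \<omega> =
           max (adm_queue w s d t \<omega> - real (admitted w s d t \<omega>)) 0 + aux_rate w s d t \<omega>"
    and update_reg_queue:
      "\<omega> \<in> space M \<Longrightarrow> d \<in> servers n \<Longrightarrow>
         reg_queue w d (Suc t) \<omega> =
           max (reg_queue w d t \<omega> - (1 - \<eta>)) 0 + (\<Sum>s\<in>servers n. real (admitted w s d t \<omega>))"
    and serve_server:
      "\<omega> \<in> space M \<Longrightarrow> s \<in> servers n \<Longrightarrow>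
         serves n (server_rate w c s t \<omega>)
           (\<lambda>d. server_pkts w c s d t \<omega>) (\<lambda>d. server_sent w c s d t \<omega>)"
    and update_server:
      "\<omega> \<in> space M \<Longrightarrow> s \<in> servers n \<Longrightarrow> d \<in> servers n \<Longrightarrow>
         server_pkts w c s d (Suc t) \<omega> =
           server_pkts w c s d t \<omega> - server_sent w c s d t \<omega> +
           (if d \<in> division n c then admitted w s d t \<omega> else 0)"
    and serve_node:
      "\<omega> \<in> space M \<Longrightarrow> j \<in> {1..n - 1} \<Longrightarrow> i \<in> rows n \<Longrightarrow>
         serves n (node_rate w c l j i t \<omega>)
           (\<lambda>d. node_pkts w c l j i d t \<omega>) (\<lambda>d. node_sent w c l j i d t \<omega>)"
    and update_node:
      "\<omega> \<in> space M \<Longrightarrow> j \<in> {1..n - 1} \<Longrightarrow> i \<in> rows n \<Longrightarrow> d \<in> servers n \<Longrightarrow>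
         node_pkts w c l j i d (Suc t) \<omega> =
           node_pkts w c l j i d t \<omega> - node_sent w c l j i d t \<omega> +
           (if coin w c j i t \<omega> \<longleftrightarrow> l = Up then pkts_in n w c j i d t \<omega> else 0)"
    and update_dest_queue:
      "\<omega> \<in> space M \<Longrightarrow> i \<in> rows n \<Longrightarrow> 0 \<le> dest_queue w c i t \<omega>"
      "\<omega> \<in> space M \<Longrightarrow> i \<in> rows n \<Longrightarrow>
         dest_queue w c i (Suc t) \<omega> \<le>
           max (dest_queue w c i t \<omega> - real (dest_rate w c i t \<omega>)) 0 + real (alloc_in n w c i t \<omega>)"
    and update_fifo_queue:
      "\<omega> \<in> space M \<Longrightarrow> j \<in> {n..2 * n - 1} \<Longrightarrow> i \<in> rows n \<Longrightarrow>
         \<exists>new. fifo_queue w l j i (Suc t) \<omega> = tl (fifo_queue w l j i t \<omega>) @ new \<and>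
           (\<forall>d. count_list new d =
              (if d \<in> reachable_outputs n l j i then fifo_in n w j i d t \<omega> else 0))"

definition fictitious_empty :: "'w measure \<Rightarrow> nat \<Rightarrow> 'w run \<Rightarrow> bool" where
  "fictitious_empty M n w \<longleftrightarrow>
     (\<forall>\<omega>\<in>space M.
        (\<forall>c. \<forall>s\<in>servers n. server_queue n w c s 0 \<omega> = 0) \<and>
        (\<forall>c l. \<forall>j\<in>{1..n - 1}. \<forall>i\<in>rows n. node_queue n w c l j i 0 \<omega> = 0) \<and>
        (\<forall>c. \<forall>i\<in>rows n. dest_queue w c i 0 \<omega> = 0) \<and>
        (\<forall>s\<in>servers n. \<forall>d\<in>servers n. adm_queue w s d 0 \<omega> = 0) \<and>
        (\<forall>d\<in>servers n. reg_queue w d 0 \<omega> = 0))"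

definition physical_empty :: "'w measure \<Rightarrow> nat \<Rightarrow> 'w run \<Rightarrow> bool" where
  "physical_empty M n w \<longleftrightarrow>
     (\<forall>\<omega>\<in>space M.
        (\<forall>c. \<forall>s\<in>servers n. server_queue n w c s 0 \<omega> = 0) \<and>
        (\<forall>c l. \<forall>j\<in>{1..n - 1}. \<forall>i\<in>rows n. node_queue n w c l j i 0 \<omega> = 0) \<and>
        (\<forall>l. \<forall>j\<in>{n..2 * n - 1}. \<forall>i\<in>rows n. fifo_queue w l j i 0 \<omega> = []))"

definition fictitious_stable :: "'w measure \<Rightarrow> nat \<Rightarrow> 'w run \<Rightarrow> bool" where
  "fictitious_stable M n w \<longleftrightarrow>
     (\<forall>c. \<forall>s\<in>servers n. stable M (\<lambda>t \<omega>. real (server_queue n w c s t \<omega>))) \<and>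
     (\<forall>c l. \<forall>j\<in>{1..n - 1}. \<forall>i\<in>rows n. stable M (\<lambda>t \<omega>. real (node_queue n w c l j i t \<omega>))) \<and>
     (\<forall>c. \<forall>i\<in>rows n. stable M (dest_queue w c i)) \<and>
     (\<forall>s\<in>servers n. \<forall>d\<in>servers n. stable M (adm_queue w s d)) \<and>
     (\<forall>d\<in>servers n. stable M (reg_queue w d))"

definition physical_stable :: "'w measure \<Rightarrow> nat \<Rightarrow> 'w run \<Rightarrow> bool" where
  "physical_stable M n w \<longleftrightarrow>
     (\<forall>c. \<forall>s\<in>servers n. stable M (\<lambda>t \<omega>. real (server_queue n w c s t \<omega>))) \<and>
     (\<forall>c l. \<forall>j\<in>{1..n - 1}. \<forall>i\<in>rows n. stable M (\<lambda>t \<omega>. real (node_queue n w c l j i t \<omega>))) \<and>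
     (\<forall>l. \<forall>j\<in>{n..2 * n - 1}. \<forall>i\<in>rows n.
        stable M (\<lambda>t \<omega>. real (length (fifo_queue w l j i t \<omega>))))"

definition drift_const :: "nat \<Rightarrow> real \<Rightarrow> real" where
  "drift_const n Amax =
     1 / 2 * (2 ^ n * (10 * real n - 2) +
              Amax\<^sup>2 * (2 ^ (3 * n - 1) + 2 ^ (2 * n + 1) + 2 ^ (3 * n)))"

end

theory Submission
  imports Defs
begin

text \<open>
  All queues of the fictitious network are bounded by constants: an auxiliary rate vanishes once its
  admission queue exceeds \<open>V U'(0)\<close>, a flow is admitted only while its regulation queue and its server
  queue lie below its admission queue, and backpressure never sends into a queue that exceeds all the
  queues feeding it.

  For the utility, the drift of the sum of squared queues is compared with the decisions that admit
  \<open>(1 - \<eta>) r\<^sup>o\<^sup>p\<^sup>t\<close> and split every flow evenly; these load each partition node with at most 1 packet of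
  each division per slot.  Instead of Jensen's inequality, the tangent to each utility at the
  achieved rate is used, so that only expectations of the rates themselves occur.

  The FIFO queues of the physical network are treated with exponential moments.  Up to bounded
  quantities and centred increments, a destination sends to each partition node \<open>1 / 2\<^sup>n\<^sup>-\<^sup>1\<close> of its
  admitted packets, whose rate the regulation queue keeps at \<open>1 - \<eta>\<close>.  The load of every link is then
  at most \<open>1 - \<eta>\<close>, and an induction on the columns bounds \<open>E exp(\<theta> Q)\<close> for small \<open>\<theta>\<close>.
\<close>

section \<open>Paths in the Benes network\<close>

text \<open>Behind the partition nodes nothing is controlled: packets share FIFO queues, whose
  outflow over an interval depends on the unknown composition of the queue at its start. The
  interval bound for one destination therefore carries a multiple of the upstream backlog at the
  starting slot \<open>t0\<close>, and \<open>t0\<close>, the start of a busy period, is random.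
  First moments do not survive the maximum over \<open>t0\<close>; exponential ones do, since the
  drift \<open>- \<eta>\<close> makes its terms decay geometrically. The backlog factor shrinks the
  admissible exponent from each column to the next, which is harmless with finitely many columns.

  For the utility, the regulation queues are served at rate \<open>1 - \<eta>\<close> only, so the
  optimal vector cannot itself be the competitor; by concavity, scaling it costs at most the term
  with \<open>max_slope\<close>. A competitor must also stay below the mean arrivals. This is proved
  for stabilizing policies and, like the capacity constraints, passes to their closure.

  Arrivals and coins enter through products with bounded measurable factors whose expectation
  vanishes; conditional expectations do not occur.\<close>

lemma finite_upstream [simp]: "finite (upstream n l j i)"
  by (simp add: upstream_def)

lemma row_of_in_rows: "n \<ge> 1 \<Longrightarrow> s \<in> servers n \<Longrightarrow> row_of s \<in> rows n"
  by (cases n) (auto simp: row_of_def)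

lemma hop_last_column: "n \<ge> 1 \<Longrightarrow> hop n l (2 * n - 1) i = out_link l i"
  by (induction n l "2 * n - 1" i rule: hop.induct) auto

lemma hop_in_rows:
  assumes "1 \<le> n" "1 \<le> j" "j < 2 * n - 1" "i \<in> rows n"
  shows "hop n l j i \<in> rows n"
  using assms
proof (induction n l j i rule: hop.induct)
  case (3 k l j i)
  have i: "1 \<le> i" "i \<le> 2 * 2 ^ k" using "3.prems" by auto
  consider "j = 1" | "1 < j" "j < 2 * k + 2" | "j = 2 * k + 2"
    using "3.prems"(2,3) by atomize_elim auto
  then show ?case
  proof cases
    case 1
    then show ?thesis using i by (cases l) (auto simp: row_of_def)
  next
    case 2
    have "hop (Suc k) l (j - 1) i \<in> rows (Suc k)" if "i \<le> 2 ^ k"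
      using "3.IH"(1) that 2 i by simp
    moreover have "hop (Suc k) l (j - 1) (i - 2 ^ k) \<in> rows (Suc k)" if "\<not> i \<le> 2 ^ k"
    proof -
      have "i - 2 ^ k \<in> rows (Suc k)" using that i by auto
      then show ?thesis using "3.IH"(2) that 2 by simp
    qed
    ultimately show ?thesis using 2 by auto
  next
    case 3
    \<comment> \<open>The inner column is now the last one of the subnetwork, so the inner
      \<open>hop\<close> returns a link number, which serves as the row of the outer output
      module.\<close>
    have last: "hop (Suc k) l (Suc (2 * k)) x = out_link l x" for x
      using hop_last_column[of "Suc k" l x] by simp
    show ?thesis using 3 i by (auto simp: last out_link_def split: side.splits)
  qed
qed auto

lemma out_link_eq_iff:
  "i \<ge> 1 \<Longrightarrow> i' \<ge> 1 \<Longrightarrow> out_link l i = out_link l' i' \<longleftrightarrow> l = l' \<and> i = i'"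
  by (cases l; cases l'; simp add: out_link_def; presburger)

lemma out_link_in_servers: "n \<ge> 1 \<Longrightarrow> i \<in> rows n \<Longrightarrow> out_link l i \<in> servers n"
  by (cases n; cases l) (auto simp: out_link_def)

lemma row_of_eq_iff: "i \<ge> 1 \<Longrightarrow> row_of x = i \<longleftrightarrow> x = 2 * i - 1 \<or> x = 2 * i"
  unfolding row_of_def by presburger

lemma servers_of_row:
  assumes "n \<ge> 1" "i \<in> rows n"
  shows "{s \<in> servers n. row_of s = i} = {2 * i - 1, 2 * i}"
  using assms by (cases n) (auto simp: row_of_eq_iff)

text \<open>Both predecessors of a module in column 2 use the same link: \<open>Up\<close> enters
  only the upper subnetwork and \<open>Lo\<close> only the lower one, and rows
  \<open>2 * x - 1\<close> and \<open>2 * x\<close> of column 1 end at the same row of either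
  subnetwork.\<close>

lemma upstream_first:
  assumes "i \<in> rows (Suc (Suc k))"
  shows "upstream (Suc (Suc k)) Up 2 i = (if i \<le> 2 ^ k then {2 * i - 1, 2 * i} else {})"
    and "upstream (Suc (Suc k)) Lo 2 i =
           (if i \<le> 2 ^ k then {} else {2 * (i - 2 ^ k) - 1, 2 * (i - 2 ^ k)})"
proof -
  have row: "row_of x \<le> 2 ^ k" "1 \<le> row_of x" if "x \<in> rows (Suc (Suc k))" for x
    using that by (auto simp: row_of_def)
  have sub: "{2 * x - 1, 2 * x} \<subseteq> rows (Suc (Suc k))" if "1 \<le> x" "x \<le> 2 ^ k" for x
    using that by auto
  have pre: "{x \<in> rows (Suc (Suc k)). row_of x = y} = {2 * y - 1, 2 * y}"
    if "1 \<le> y" "y \<le> 2 ^ k" for y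
    using row_of_eq_iff[OF that(1)] sub[OF that] by blast
  have i: "1 \<le> i" "i \<le> 2 * 2 ^ k" using assms by auto
  show "upstream (Suc (Suc k)) Up 2 i = (if i \<le> 2 ^ k then {2 * i - 1, 2 * i} else {})"
  proof (cases "i \<le> 2 ^ k")
    case True
    then show ?thesis using pre[of i] i by (simp add: upstream_def)
  next
    case False
    then show ?thesis using row by (fastforce simp: upstream_def)
  qed
  show "upstream (Suc (Suc k)) Lo 2 i =
           (if i \<le> 2 ^ k then {} else {2 * (i - 2 ^ k) - 1, 2 * (i - 2 ^ k)})"
  proof (cases "i \<le> 2 ^ k")
    case True
    then show ?thesis using row by (fastforce simp: upstream_def)
  next
    case False
    then have "2 ^ k + row_of x = i \<longleftrightarrow> row_of x = i - 2 ^ k" for x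
      by auto
    then show ?thesis using pre[of "i - 2 ^ k"] i False by (simp add: upstream_def)
  qed
qed

text \<open>Columns strictly inside the subnetworks are copies of those of the smaller network,
  shifted by one column and, for the lower copy, by \<open>2 ^ k\<close> rows. The bound on
  \<open>j\<close> leaves out the last inner column, where the inner \<open>hop\<close> yields a
  link number.\<close>

lemma upstream_middle:
  assumes "2 \<le> j" "j < 2 * k + 2" "i \<in> rows (Suc (Suc k))"
  shows "upstream (Suc (Suc k)) l (Suc j) i =
    (if i \<le> 2 ^ k then upstream (Suc k) l j i else (+) (2 ^ k) ` upstream (Suc k) l j (i - 2 ^ k))"
proof -
  have h: "hop (Suc k) l (j - 1) x \<in> {1..2 ^ k}" if "x \<in> {1..2 ^ k}" for x
    using hop_in_rows[of "Suc k" "j - 1" x l] that assms by auto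
  have img: "x \<in> (+) (2 ^ k) ` S \<longleftrightarrow> x \<ge> 2 ^ k \<and> x - 2 ^ k \<in> S" for x :: nat and S
    by (auto simp: image_iff) (metis le_add_diff_inverse)
  show ?thesis
  proof (rule set_eqI)
    fix x :: nat
    have x: "x - 2 ^ k \<in> {1..2 ^ k}" if "\<not> x \<le> 2 ^ k" "x \<le> 2 * 2 ^ k"
      using that by auto
    show "x \<in> upstream (Suc (Suc k)) l (Suc j) i \<longleftrightarrow> x \<in> (if i \<le> 2 ^ k then upstream (Suc k) l j i
      else (+) (2 ^ k) ` upstream (Suc k) l j (i - 2 ^ k))"
      using assms h[of x] h[of "x - 2 ^ k"] x
      by (cases "x \<le> 2 ^ k"; cases "i \<le> 2 ^ k") (auto simp: upstream_def img)
  qed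
qed

text \<open>Which output link carries the two predecessors depends on the row: on its half in column
  2, on its parity in the last column. Hence the sum over both links.\<close>

lemma card_upstream_le_2:
  assumes "2 \<le> j" "j \<le> 2 * n - 1" "i \<in> rows n"
  shows "card (upstream n Up j i) + card (upstream n Lo j i) \<le> 2"
  using assms
proof (induction n arbitrary: j i rule: less_induct)
  case (less n)
  then obtain k where n: "n = Suc (Suc k)"
    by (cases n; cases "n - 1") auto
  have i: "1 \<le> i" "i \<le> 2 * 2 ^ k" using less.prems n by auto
  consider "j = 2" | "3 \<le> j" "j \<le> 2 * k + 2" | "j = 2 * k + 3"
    using less.prems(1,2) n by atomize_elim auto
  then show ?case
  proof cases
    case 1
    then show ?thesis
      using upstream_first[of i k] less.prems by (auto simp: n)
  next
    case 2
    define i' where "i' = (if i \<le> 2 ^ k then i else i - 2 ^ k)"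
    have "card (upstream n l j i) = card (upstream (Suc k) l (j - 1) i')" for l
      using upstream_middle[of "j - 1" k i l] 2 less.prems(3)
      by (auto simp: n i'_def card_image)
    moreover have "i' \<in> rows (Suc k)" using i by (auto simp: i'_def)
    ultimately show ?thesis
      using less.IH[of "Suc k" "j - 1" i'] 2 n by auto
  next
    case 3
    have last: "hop (Suc k) l (Suc (2 * k)) x = out_link l x" for l x
      using hop_last_column[of "Suc k" l x] by simp
    \<comment> \<open>Output link number \<open>i\<close> of a subnetwork leaves its row
      \<open>(i + 1) div 2\<close> on \<open>Up\<close> if \<open>i\<close> is odd, and its row
      \<open>i div 2\<close> on \<open>Lo\<close> if \<open>i\<close> is even; each of the two
      subnetworks contributes one such row.\<close>
    have "upstream n Up j i \<subseteq> (if odd i then {(i + 1) div 2, 2 ^ k + (i + 1) div 2} else {})"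
      "upstream n Lo j i \<subseteq> (if even i then {i div 2, 2 ^ k + i div 2} else {})"
      unfolding upstream_def n 3 by (auto simp: last out_link_def split: if_splits)
    then have "card (upstream n Up j i) \<le> card (if odd i then {(i + 1) div 2, 2 ^ k + (i + 1) div 2} else {})"
      "card (upstream n Lo j i) \<le> card (if even i then {i div 2, 2 ^ k + i div 2} else {})"
      by (intro card_mono; auto)+
    then show ?thesis by (auto split: if_splits)
  qed
qed

text \<open>Sums \<open>f\<close> over all paths from the first column to row \<open>i\<close> of column \<open>Suc j\<close>.\<close>

primrec path_sum :: "nat \<Rightarrow> (nat \<Rightarrow> real) \<Rightarrow> nat \<Rightarrow> nat \<Rightarrow> real" where
  "path_sum n f 0 i = f i"
| "path_sum n f (Suc j) i =
     (\<Sum>l\<in>{Up, Lo}. \<Sum>i'\<in>upstream n l (Suc (Suc j)) i. path_sum n f j i')"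

text \<open>Peels off the first column. Rows \<open>2 * x - 1\<close> and \<open>2 * x\<close> both
  reach row \<open>x\<close> of the upper and of the lower subnetwork, so both subnetworks see the
  same pair sums; this is why all partition nodes end up with equal values.\<close>

lemma path_sum_subnetwork:
  assumes "j \<le> k" "i \<in> rows (Suc (Suc k))"
  shows "path_sum (Suc (Suc k)) f (Suc j) i =
    path_sum (Suc k) (\<lambda>x. f (2 * x - 1) + f (2 * x)) j (if i \<le> 2 ^ k then i else i - 2 ^ k)"
  using assms
proof (induction j arbitrary: i)
  case 0
  have "2 * x - 1 \<noteq> 2 * x" if "x \<ge> 1" for x :: nat
    using that by presburger
  then have "sum f {2 * x - 1, 2 * x} = f (2 * x - 1) + f (2 * x)" if "x \<ge> 1" for x
    using that by simp
  then show ?case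
    using upstream_first[of i k] 0 by (auto simp: numeral_2_eq_2[symmetric])
next
  case (Suc j)
  let ?g = "\<lambda>x. f (2 * x - 1) + f (2 * x)"
  have sub: "upstream (Suc k) l (Suc (Suc j)) x \<subseteq> rows (Suc k)" for l x
    by (auto simp: upstream_def)
  have IH: "path_sum (Suc (Suc k)) f (Suc j) x =
      path_sum (Suc k) ?g j (if x \<le> 2 ^ k then x else x - 2 ^ k)"
    if "x \<in> rows (Suc (Suc k))" for x
    using Suc that by simp
  have "(\<Sum>x\<in>upstream (Suc (Suc k)) l (Suc (Suc (Suc j))) i. path_sum (Suc (Suc k)) f (Suc j) x) =
    (\<Sum>x\<in>upstream (Suc k) l (Suc (Suc j)) (if i \<le> 2 ^ k then i else i - 2 ^ k).
       path_sum (Suc k) ?g j x)" for l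
  proof (cases "i \<le> 2 ^ k")
    case True
    then have "upstream (Suc (Suc k)) l (Suc (Suc (Suc j))) i = upstream (Suc k) l (Suc (Suc j)) i"
      using upstream_middle[of "Suc (Suc j)" k i l] Suc.prems by simp
    moreover have "path_sum (Suc (Suc k)) f (Suc j) x = path_sum (Suc k) ?g j x"
      if "x \<in> upstream (Suc k) l (Suc (Suc j)) i" for x
      using IH[of x] sub that by fastforce
    ultimately show ?thesis using True by simp
  next
    case False
    have "path_sum (Suc (Suc k)) f (Suc j) (2 ^ k + x) = path_sum (Suc k) ?g j x"
      if "x \<in> upstream (Suc k) l (Suc (Suc j)) (i - 2 ^ k)" for x
      using IH[of "2 ^ k + x"] sub that by fastforce
    then show ?thesis
      using upstream_middle[of "Suc (Suc j)" k i l] Suc.prems False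
      by (simp add: sum.reindex del: path_sum.simps)
  qed
  then show ?case
    by (simp only: path_sum.simps(2)[of _ _ "Suc j"] path_sum.simps(2)[of "Suc k" ?g j])
qed

text \<open>Every module of the first column has exactly one path to each partition node.\<close>

lemma path_sum_partition:
  "i \<in> rows (Suc k) \<Longrightarrow> path_sum (Suc k) f k i = (\<Sum>x\<in>rows (Suc k). f x)"
proof (induction k arbitrary: i f)
  case (Suc k)
  have *: "(if i \<le> 2 ^ k then i else i - 2 ^ k) \<in> rows (Suc k)"
    using Suc.prems by auto
  have pair: "(\<Sum>x\<in>{1..m}. f (2 * x - 1) + f (2 * x)) = (\<Sum>x\<in>{1..2 * m}. f x)" for m
    by (induction m) auto
  show ?case
    using path_sum_subnetwork[of k k i f] Suc.IH[OF *] Suc.prems pair[of "2 ^ k"]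
    by (simp del: path_sum.simps)
qed simp

text \<open>Double counting of the links \<open>l\<close> between two neighbouring columns, once by
  their heads and once by their tails. The last column is excluded since its links end at servers,
  not at rows.\<close>

lemma sum_upstream:
  fixes f :: "nat \<Rightarrow> nat \<Rightarrow> 'a :: comm_monoid_add"
  assumes "1 \<le> n" "1 \<le> j" "j < 2 * n - 1"
  shows "(\<Sum>i\<in>rows n. \<Sum>i'\<in>upstream n l (Suc j) i. f i i') = (\<Sum>i'\<in>rows n. f (hop n l j i') i')"
proof -
  have "(\<Sum>i'\<in>rows n. f (hop n l j i') i') =
    (\<Sum>i\<in>rows n. \<Sum>i'\<in>{i' \<in> rows n. hop n l j i' = i}. f (hop n l j i') i')"
    using hop_in_rows assms by (intro sum.group[symmetric]) auto
  also have "\<dots> = (\<Sum>i\<in>rows n. \<Sum>i'\<in>upstream n l (Suc j) i. f i i')"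
    unfolding upstream_def by (intro sum.cong) auto
  finally show ?thesis ..
qed

section \<open>Output servers behind a link\<close>

lemma reachable_outputs_last: "reachable_outputs n l (2 * n - 1) i = {hop n l (2 * n - 1) i}"
proof -
  have "reaches n l (2 * n - 1) i d \<longleftrightarrow> d = hop n l (2 * n - 1) i" for d
    by (subst reaches.simps) (auto simp del: One_nat_def)
  then show ?thesis by (simp add: reachable_outputs_def)
qed

lemma reachable_outputs_step:
  assumes "j < 2 * n - 1"
  shows "reachable_outputs n l j i =
    reachable_outputs n Up (Suc j) (hop n l j i) \<union> reachable_outputs n Lo (Suc j) (hop n l j i)"
proof -
  have "reaches n l j i d \<longleftrightarrow> (\<exists>l'. reaches n l' (Suc j) (hop n l j i) d)" for d
    using assms by (subst reaches.simps) auto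
  moreover have "(\<exists>l'. P l') \<longleftrightarrow> P Up \<or> P Lo" for P
    by (metis (full_types) side.exhaust)
  ultimately show ?thesis unfolding reachable_outputs_def by auto
qed

text \<open>Descending induction: one more column at most doubles the number of outputs. From column
  \<open>n\<close> on this power of two compensates the doubling of the rate per destination in the
  FIFO queues.\<close>

lemma reachable_outputs_bounds:
  assumes "n \<ge> 1" "1 \<le> j" "j \<le> 2 * n - 1" "i \<in> rows n"
  shows "reachable_outputs n l j i \<subseteq> servers n \<and>
         card (reachable_outputs n l j i) \<le> 2 ^ (2 * n - 1 - j)"
  using assms(3,2,4)
proof (induction j arbitrary: i l rule: inc_induct)
  case base
  then show ?case
    using out_link_in_servers[OF assms(1)] assms(1)
    by (simp add: reachable_outputs_last hop_last_column del: One_nat_def)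
next
  case (step j)
  have h: "hop n l j i \<in> rows n" using step hop_in_rows assms(1) by auto
  have e: "2 * n - 1 - j = Suc (2 * n - 1 - Suc j)" using step by auto
  show ?case
    unfolding reachable_outputs_step[OF step(2)] e power_Suc
    using step.IH[OF _ h, of Up] step.IH[OF _ h, of Lo]
      card_Un_le[of "reachable_outputs n Up (Suc j) (hop n l j i)"
        "reachable_outputs n Lo (Suc j) (hop n l j i)"] by simp
qed

section \<open>Rates of stabilizing policies\<close>

text \<open>The derivative is only relative to \<open>S\<close>, so that the tangent at the boundary
  point 0 is covered. Along points of the segment that tend to \<open>x\<close>, concavity keeps
  each difference quotient, scaled by \<open>y - x\<close>, above \<open>f y - f x\<close>, and the
  limit preserves this.\<close>

lemma concave_on_le_tangent:
  fixes f :: "real \<Rightarrow> real"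
  assumes f: "concave_on S f" and x: "x \<in> S" and y: "y \<in> S"
    and deriv: "(f has_real_derivative f') (at x within S)"
  shows "f y \<le> f x + f' * (y - x)"
proof (cases "y = x")
  case False
  define z where "z k = x + (y - x) / real (Suc k)" for k
  have z_eq: "(1 - 1 / real (Suc k)) *\<^sub>R x + (1 / real (Suc k)) *\<^sub>R y = z k" for k
    unfolding z_def real_scaleR_def by (simp add: algebra_simps diff_divide_distrib)
  have z_in: "z k \<in> S" for k
  proof -
    have "(1 - 1 / real (Suc k)) *\<^sub>R x + (1 / real (Suc k)) *\<^sub>R y \<in> S"
      using f x y by (intro convexD) (auto simp: concave_on_iff)
    then show ?thesis by (simp only: z_eq)
  qed
  have z_ne: "z k \<noteq> x" for k using False by (simp add: z_def)
  have "(\<lambda>k. (y - x) * inverse (real (Suc k))) \<longlonglongrightarrow> (y - x) * 0"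
    by (intro tendsto_mult tendsto_const LIMSEQ_inverse_real_of_nat)
  then have "z \<longlonglongrightarrow> x"
    using tendsto_add[OF tendsto_const[of x], of "\<lambda>k. (y - x) * inverse (real (Suc k))" 0]
    unfolding z_def divide_inverse by simp
  then have "filterlim z (at x within S) sequentially"
    using z_in z_ne by (simp add: filterlim_at)
  then have "(\<lambda>k. (f (z k) - f x) / (z k - x)) \<longlonglongrightarrow> f'"
    using deriv filterlim_compose unfolding has_field_derivative_iff by blast
  then have lim: "(\<lambda>k. (f (z k) - f x) / (z k - x) * (y - x)) \<longlonglongrightarrow> f' * (y - x)"
    by (rule tendsto_mult_right)
  have "(f (z k) - f x) / (z k - x) * (y - x) \<ge> f y - f x" for k
  proof -
    let ?t = "1 / real (Suc k)"
    have "f ((1 - ?t) *\<^sub>R x + ?t *\<^sub>R y) \<ge> (1 - ?t) * f x + ?t * f y"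
      by (rule concave_onD[OF f _ _ x y]) auto
    then have "?t * (f y - f x) \<le> f (z k) - f x"
      unfolding z_eq by (simp only: algebra_simps)
    then have "f y - f x \<le> (f (z k) - f x) * real (Suc k)"
      by (simp add: field_simps)
    also have "\<dots> = (f (z k) - f x) / (z k - x) * (y - x)"
      using False by (simp add: z_def)
    finally show ?thesis .
  qed
  then have "f y - f x \<le> f' * (y - x)"
    using LIMSEQ_le_const[OF lim] by blast
  then show ?thesis by simp
qed simp

section \<open>Slopes of the utilities and mean arrivals\<close>

context benes_traffic
begin

lemma utility_le_tangent:
  assumes "s \<in> servers n" "d \<in> servers n" "0 \<le> x" "0 \<le> y"
  shows "U s d y \<le> U s d x + U' s d x * (y - x)"
  using assms by (intro concave_on_le_tangent[OF utility_concave] utility_derivative) auto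

lemma utility_derivative_nonneg:
  assumes "s \<in> servers n" "d \<in> servers n" "0 \<le> x"
  shows "0 \<le> U' s d x"
proof -
  have "U s d x \<le> U s d (x + 1)"
    using utility_increasing[OF assms(1,2)] assms(3) by (auto simp: mono_on_def)
  then show ?thesis using utility_le_tangent[OF assms, of "x + 1"] assms by simp
qed

lemma Amax_nonneg: "0 \<le> Amax"
proof -
  obtain \<omega> where "\<omega> \<in> space M" using not_empty by auto
  moreover have "1 \<in> servers n" by simp
  ultimately have "real (A 1 1 0 \<omega>) \<le> Amax" using arrivals_bounded by blast
  then show ?thesis using of_nat_0_le_iff order_trans by blast
qed

lemma arrivals_measurable:
  "s \<in> servers n \<Longrightarrow> d \<in> servers n \<Longrightarrow> A s d t \<in> measurable M (count_space UNIV)"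
  using arrivals_indep[of s d] unfolding indep_vars_def by auto

definition mean_arrival :: "nat \<Rightarrow> nat \<Rightarrow> real" where
  "mean_arrival s d = expectation (\<lambda>\<omega>. real (A s d 0 \<omega>))"

lemma expectation_arrivals:
  assumes "s \<in> servers n" "d \<in> servers n"
  shows "expectation (\<lambda>\<omega>. real (A s d t \<omega>)) = mean_arrival s d"
proof -
  have *: "expectation (\<lambda>\<omega>. real (A s d t \<omega>)) =
      integral\<^sup>L (distr M (count_space UNIV) (A s d t)) real" for t
    using arrivals_measurable[OF assms] by (subst integral_distr) auto
  show ?thesis
    by (simp only: mean_arrival_def *[of t] *[of 0] arrivals_ident[OF assms, of t])
qed

lemma integrable_bounded:
  fixes f :: "'w \<Rightarrow> real"
  assumes "f \<in> borel_measurable M" "\<And>\<omega>. \<omega> \<in> space M \<Longrightarrow> \<bar>f \<omega>\<bar> \<le> C"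
  shows "integrable M f"
  using assms by (intro integrable_const_bound[of _ C]) auto

lemma mean_arrival_le:
  assumes "s \<in> servers n" "d \<in> servers n"
  shows "mean_arrival s d \<le> Amax"
proof -
  have [measurable]: "A s d 0 \<in> measurable M (count_space UNIV)"
    using arrivals_measurable[OF assms] .
  have "mean_arrival s d \<le> expectation (\<lambda>_. Amax)"
    unfolding mean_arrival_def using arrivals_bounded[OF assms] Amax_nonneg
    by (intro integral_mono integrable_bounded[of _ Amax]) auto
  then show ?thesis by (simp add: prob_space)
qed

end

section \<open>Stability as a linear bound on accumulated means\<close>

lemma stable_boundedI:
  assumes "\<And>t. (\<integral>\<^sup>+\<omega>. ennreal (Q t \<omega>) \<partial>M) \<le> ennreal C"
  shows "stable M Q"
proof -
  have "(\<Sum>t<T. \<integral>\<^sup>+\<omega>. ennreal (Q t \<omega>) \<partial>M) / of_nat T \<le> ennreal C" for T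
  proof (cases "T = 0")
    case False
    have "(\<Sum>t<T. \<integral>\<^sup>+\<omega>. ennreal (Q t \<omega>) \<partial>M) \<le> (\<Sum>t<T. ennreal C)"
      by (intro sum_mono assms)
    also have "\<dots> = ennreal C * of_nat T" by (simp add: mult.commute)
    finally show ?thesis using False
      by (simp add: divide_le_posI_ennreal mult.commute)
  qed simp
  then have "limsup (\<lambda>T. (\<Sum>t<T. \<integral>\<^sup>+\<omega>. ennreal (Q t \<omega>) \<partial>M) / of_nat T) \<le> ennreal C"
    by (intro Limsup_bounded always_eventually) auto
  then show ?thesis unfolding stable_def using le_less_trans by fastforce
qed

lemma (in prob_space) stable_bounded_pointwise:
  assumes "\<And>t \<omega>. \<omega> \<in> space M \<Longrightarrow> Q t \<omega> \<le> C"
  shows "stable M Q"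
proof (rule stable_boundedI)
  fix t
  have "(\<integral>\<^sup>+\<omega>. ennreal (Q t \<omega>) \<partial>M) \<le> (\<integral>\<^sup>+\<omega>. ennreal C \<partial>M)"
    using assms by (intro nn_integral_mono ennreal_leI)
  then show "(\<integral>\<^sup>+\<omega>. ennreal (Q t \<omega>) \<partial>M) \<le> ennreal C"
    by (simp add: emeasure_space_1)
qed

text \<open>Stability is defined with extended expectations; integrability turns it into an eventual
  linear bound on ordinary ones, the form needed for comparing rates.\<close>

lemma stable_average_bounded:
  assumes "stable M Q" and int: "\<And>t. integrable M (Q t)"
    and nonneg: "\<And>t \<omega>. \<omega> \<in> space M \<Longrightarrow> 0 \<le> Q t \<omega>"
  shows "\<exists>C. \<forall>\<^sub>F T in sequentially. (\<Sum>t<T. \<integral>\<omega>. Q t \<omega> \<partial>M) \<le> C * real T"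
proof -
  obtain c where c: "limsup (\<lambda>T. (\<Sum>t<T. \<integral>\<^sup>+\<omega>. ennreal (Q t \<omega>) \<partial>M) / of_nat T) < c" "c < \<infinity>"
    using assms(1) dense unfolding stable_def by blast
  then obtain C where C: "c = ennreal C" "C \<ge> 0" by (cases c) auto
  have nn: "(\<integral>\<^sup>+\<omega>. ennreal (Q t \<omega>) \<partial>M) = ennreal (\<integral>\<omega>. Q t \<omega> \<partial>M)" for t
    using int nonneg by (intro nn_integral_eq_integral) auto
  have pos: "0 \<le> (\<integral>\<omega>. Q t \<omega> \<partial>M)" for t
    using nonneg by (intro integral_nonneg_AE) auto
  have "\<forall>\<^sub>F T in sequentially. (\<Sum>t<T. \<integral>\<^sup>+\<omega>. ennreal (Q t \<omega>) \<partial>M) / of_nat T < c"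
    using Limsup_lessD[OF c(1)] .
  then have "\<forall>\<^sub>F T in sequentially. (\<Sum>t<T. \<integral>\<omega>. Q t \<omega> \<partial>M) \<le> C * real T"
    using eventually_gt_at_top[of 0]
  proof eventually_elim
    case (elim T)
    have "ennreal (\<Sum>t<T. \<integral>\<omega>. Q t \<omega> \<partial>M) / ennreal (real T) < ennreal C"
      using elim(1) pos by (simp add: nn C sum_ennreal ennreal_of_nat_eq_real_of_nat)
    then have "(\<Sum>t<T. \<integral>\<omega>. Q t \<omega> \<partial>M) / real T < C"
      using elim(2) pos C by (subst (asm) divide_ennreal) (auto simp: sum_nonneg ennreal_less_iff)
    then show ?case using elim(2) by (simp add: field_simps)
  qed
  then show ?thesis by blast
qed

text \<open>A backlog with bounded averages cannot grow linearly, so it does not absorb any rate.\<close>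

lemma rate_le_service_rate:
  fixes S X :: "nat \<Rightarrow> real"
  assumes lim: "(\<lambda>T. S T / real T) \<longlonglongrightarrow> \<rho>"
    and S: "\<And>T. S T \<le> real T + X T"
    and nonneg: "\<And>T. 0 \<le> X T"
    and avg: "\<forall>\<^sub>F T in sequentially. (\<Sum>t<T. X t) \<le> C * real T"
  shows "\<rho> \<le> 1"
proof (rule ccontr)
  assume "\<not> \<rho> \<le> 1"
  define e where "e = (\<rho> - 1) / 2"
  have e: "e > 0" "1 + e < \<rho>" using \<open>\<not> \<rho> \<le> 1\<close> by (auto simp: e_def field_simps)
  from avg obtain N1 where N1: "\<And>T. T \<ge> N1 \<Longrightarrow> (\<Sum>t<T. X t) \<le> C * real T"
    by (auto simp: eventually_at_top_linorder)
  have "\<forall>\<^sub>F T in sequentially. S T / real T > 1 + e"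
    using order_tendstoD(1)[OF lim e(2)] .
  then obtain N2 where N2: "\<And>T. T \<ge> N2 \<Longrightarrow> S T / real T > 1 + e"
    by (auto simp: eventually_at_top_linorder)
  have X: "X T \<ge> e * real T" if "T \<ge> N2" for T
  proof (cases "T = 0")
    case False
    then have "S T > (1 + e) * real T" using N2[OF that] by (simp add: field_simps)
    then show ?thesis using S[of T] by (simp add: algebra_simps)
  qed (use nonneg in auto)
  \<comment> \<open>Bounded averages allow \<open>X\<close> to be large in single slots, so a whole
    window is used: over \<open>{m..<2 * m}\<close> the sum of \<open>X\<close> is at least
    \<open>e * m * m\<close>, against at most \<open>2 * \<bar>C\<bar> * m\<close>, and
    \<open>m\<close> is large enough to separate the two.\<close>
  define m where "m = max (max N1 N2) (nat \<lceil>2 * \<bar>C\<bar> / e\<rceil> + 1)"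
  have m: "m \<ge> N1" "m \<ge> N2" "m > 0" "real m > 2 * \<bar>C\<bar> / e"
    unfolding m_def by linarith+
  have "e * real m * real m = (\<Sum>t\<in>{m..<2 * m}. e * real m)" by simp
  also have "\<dots> \<le> (\<Sum>t\<in>{m..<2 * m}. X t)"
    using m e X by (intro sum_mono) (smt (verit) atLeastLessThan_iff le_trans mult_left_mono of_nat_mono)
  also have "\<dots> \<le> (\<Sum>t<2 * m. X t)"
    using nonneg by (intro sum_mono2) auto
  also have "\<dots> \<le> C * real (2 * m)" using N1[of "2 * m"] m by simp
  also have "\<dots> \<le> 2 * \<bar>C\<bar> * real m" using m by (simp add: mult_right_mono)
  finally have "e * real m \<le> 2 * \<bar>C\<bar>" using m by simp
  then show False using m e by (simp add: field_simps)
qed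


text \<open>Packets for \<open>d\<close> leave the network only over the single last-column link
  that ends at \<open>d\<close>. Treating the whole network as one queue served at rate at most 1
  gives the constraint at an output server without any study of the routing.\<close>

lemma policy_conservation:
  assumes pol: "benes_policy M n A R Qs fs Qm fm" and n: "n \<ge> 1"
    and \<omega>: "\<omega> \<in> space M" and d: "d \<in> servers n"
  defines "backlog \<equiv> \<lambda>t. (\<Sum>s\<in>servers n. Qs s d t \<omega>) +
      (\<Sum>j\<in>{1..2 * n - 1}. \<Sum>i\<in>rows n. \<Sum>s\<in>servers n. Qm j i s d t \<omega>)"
    and "out \<equiv> \<lambda>t. (\<Sum>l\<in>{Up, Lo}. \<Sum>i\<in>rows n. \<Sum>s\<in>servers n. fm l (2 * n - 1) i s d t \<omega>)"
  shows "backlog 0 = 0" "out t \<le> 1"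
    "backlog (Suc t) + out t = backlog t + (\<Sum>s\<in>servers n. R s d t \<omega>)"
proof -
  note p = pol[unfolded benes_policy_def, THEN conjunct2, THEN conjunct1, rule_format]
    pol[unfolded benes_policy_def, THEN conjunct2, THEN conjunct2, THEN conjunct1, rule_format]
    pol[unfolded benes_policy_def, THEN conjunct2, THEN conjunct2, THEN conjunct2, THEN conjunct1, rule_format]
    pol[unfolded benes_policy_def, THEN conjunct2, THEN conjunct2, THEN conjunct2, THEN conjunct2,
      THEN conjunct1, rule_format]
    pol[unfolded benes_policy_def, THEN conjunct2, THEN conjunct2, THEN conjunct2, THEN conjunct2,
      THEN conjunct2, rule_format]
  have server: "Qs s d 0 \<omega> = 0" "fs s d t \<omega> \<le> Qs s d t \<omega>"
      "Qs s d (Suc t) \<omega> = Qs s d t \<omega> - fs s d t \<omega> + R s d t \<omega>"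
    if "s \<in> servers n" for s t
    using p(1)[OF \<omega> that d] by blast+
  have node: "Qm j i s d 0 \<omega> = 0" "(\<Sum>l\<in>{Up, Lo}. fm l j i s d t \<omega>) \<le> Qm j i s d t \<omega>"
      "Qm j i s d (Suc t) \<omega> = Qm j i s d t \<omega> - (\<Sum>l\<in>{Up, Lo}. fm l j i s d t \<omega>) +
         (if j = 1 then (if row_of s = i then fs s d t \<omega> else 0)
          else (\<Sum>l\<in>{Up, Lo}. \<Sum>i'\<in>upstream n l j i. fm l (j - 1) i' s d t \<omega>))"
    if "j \<in> {1..2 * n - 1}" "i \<in> rows n" "s \<in> servers n" for j i s t
    using p(3)[OF \<omega> that d] by blast+
  have cap: "(\<Sum>s\<in>servers n. \<Sum>d\<in>servers n. fm l j i s d t \<omega>) \<le> 1"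
    if "j \<in> {1..2 * n - 1}" "i \<in> rows n" for l j i t
    using p(4)[OF \<omega> that] .
  have last: "d = hop n l (2 * n - 1) i" if "i \<in> rows n" "s \<in> servers n" "fm l (2 * n - 1) i s d t \<omega> > 0"
    for l i s t
    using p(5)[OF \<omega> that(1,2) d] that(3) by blast
  show "backlog 0 = 0" unfolding backlog_def using server(1) node(1)
    by (simp del: atLeastAtMost_iff)
  define h where "h l i = (\<Sum>s\<in>servers n. fm l (2 * n - 1) i s d t \<omega>)" for l i
  define g where "g = (\<lambda>(l, i). h l i)"
  have g: "g p = (\<Sum>s\<in>servers n. fm (fst p) (2 * n - 1) (snd p) s d t \<omega>)" for p
    by (simp only: g_def h_def case_prod_beta)
  have out_h: "out t = (\<Sum>l\<in>{Up, Lo}. \<Sum>i\<in>rows n. h l i)" by (simp only: out_def h_def)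
  define P where "P = {Up, Lo} \<times> rows n"
  have P: "finite P" "\<And>q. q \<in> P \<Longrightarrow> snd q \<in> rows n"
    by (auto simp: P_def)
  have "(\<Sum>l\<in>{Up, Lo}. \<Sum>i\<in>rows n. h l i) = (\<Sum>p\<in>P. g p)"
    unfolding g_def P_def by (rule sum.cartesian_product)
  also have "\<dots> \<le> 1"
  proof (cases "\<exists>p\<in>P. g p > 0")
    case True
    then obtain p where p: "p \<in> P" "g p > 0" by (elim bexE)
    \<comment> \<open>A link that carries such packets has number \<open>d\<close>, and
      \<open>out_link\<close> is injective, so at most one summand of \<open>out\<close> is
      nonzero.\<close>
    have link: "d = out_link (fst q) (snd q)" if "q \<in> P" "g q > 0" for q
    proof -
      have "\<exists>s\<in>servers n. fm (fst q) (2 * n - 1) (snd q) s d t \<omega> > 0"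
        using that(2) sum.neutral unfolding g by (metis (mono_tags, lifting) less_irrefl not_gr_zero)
      then show ?thesis
        using last[of "snd q" _ "fst q"] P(2)[OF that(1)] hop_last_column[OF n] by metis
    qed
    have "g q = 0" if "q \<in> P - {p}" for q
    proof (rule ccontr)
      assume "g q \<noteq> 0"
      then have "out_link (fst q) (snd q) = out_link (fst p) (snd p)"
        using link[of q] link[of p] p that by auto
      moreover have "1 \<le> snd q" "1 \<le> snd p" using P(2)[of q] P(2)[of p] that p(1) by auto
      ultimately have "q = p" by (simp only: out_link_eq_iff prod_eq_iff)
      then show False using that by auto
    qed
    then have "(\<Sum>p\<in>P. g p) = g p"
      using p(1) P(1) by (subst sum.mono_neutral_right[of _ "{p}"]) auto
    also have "\<dots> \<le> (\<Sum>s\<in>servers n. \<Sum>d\<in>servers n. fm (fst p) (2 * n - 1) (snd p) s d t \<omega>)"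
      unfolding g using d by (intro sum_mono member_le_sum) auto
    also have "\<dots> \<le> 1" using P(2)[OF p(1)] n by (intro cap) auto
    finally show ?thesis .
  next
    case False
    then have "(\<Sum>p\<in>P. g p) = 0" by (intro sum.neutral) auto
    then show ?thesis by linarith
  qed
  finally show "out t \<le> 1" by (simp only: out_h)
  define col where "col j t = (\<Sum>i\<in>rows n. \<Sum>s\<in>servers n. Qm j i s d t \<omega>)" for j t
  define flow where "flow j = (\<Sum>l\<in>{Up, Lo}. \<Sum>i\<in>rows n. \<Sum>s\<in>servers n. fm l j i s d t \<omega>)" for j
  define flow0 where "flow0 = (\<Sum>s\<in>servers n. fs s d t \<omega>)"
  have col: "col j (Suc t) + flow j = col j t + (if j = 1 then flow0 else flow (j - 1))"
    if j: "j \<in> {1..2 * n - 1}" for j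
  proof -
    define inp where "inp i s = (if j = 1 then (if row_of s = i then fs s d t \<omega> else 0)
          else (\<Sum>l\<in>{Up, Lo}. \<Sum>i'\<in>upstream n l j i. fm l (j - 1) i' s d t \<omega>))" for i s
    have "Qm j i s d (Suc t) \<omega> + (\<Sum>l\<in>{Up, Lo}. fm l j i s d t \<omega>) = Qm j i s d t \<omega> + inp i s"
      if "i \<in> rows n" "s \<in> servers n" for i s
      using node(2,3)[OF j that, of t] unfolding inp_def by linarith
    then have "(\<Sum>i\<in>rows n. \<Sum>s\<in>servers n. Qm j i s d (Suc t) \<omega> + (\<Sum>l\<in>{Up, Lo}. fm l j i s d t \<omega>)) =
        (\<Sum>i\<in>rows n. \<Sum>s\<in>servers n. Qm j i s d t \<omega> + inp i s)"
      by (intro sum.cong) auto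
    then have eq: "col j (Suc t) + flow j = col j t + (\<Sum>i\<in>rows n. \<Sum>s\<in>servers n. inp i s)"
      unfolding col_def flow_def by (simp add: sum.distrib add_ac)
    show ?thesis
    proof (cases "j = 1")
      case True
      have "(\<Sum>i\<in>rows n. \<Sum>s\<in>servers n. inp i s) =
          (\<Sum>s\<in>servers n. \<Sum>i\<in>rows n. if row_of s = i then fs s d t \<omega> else 0)"
        unfolding inp_def using True by (subst sum.swap) simp
      also have "\<dots> = flow0"
        unfolding flow0_def using row_of_in_rows[OF n] by (intro sum.cong) auto
      finally show ?thesis using eq True by simp
    next
      case False
      then obtain k where k: "j = Suc k" "1 \<le> k" "k < 2 * n - 1" using j by (cases j) auto
      have "(\<Sum>i\<in>rows n. \<Sum>s\<in>servers n. inp i s) =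
          (\<Sum>l\<in>{Up, Lo}. \<Sum>s\<in>servers n. \<Sum>i\<in>rows n. \<Sum>i'\<in>upstream n l (Suc k) i. fm l k i' s d t \<omega>)"
        unfolding inp_def using False k(1) by (subst sum.swap) (simp add: sum.distrib)
      also have "\<dots> = (\<Sum>l\<in>{Up, Lo}. \<Sum>s\<in>servers n. \<Sum>i\<in>rows n. fm l k i s d t \<omega>)"
        using k n by (subst sum_upstream) auto
      also have "\<dots> = flow k"
        unfolding flow_def by (intro sum.cong refl sum.swap)
      finally show ?thesis using eq False k by simp
    qed
  qed
  \<comment> \<open>The flows between neighbouring columns cancel; only the flows into the first
    column and out of column \<open>k\<close> remain.\<close>
  have sum_col: "(\<Sum>j\<in>{1..k}. col j (Suc t)) + flow k = (\<Sum>j\<in>{1..k}. col j t) + flow0"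
    if "1 \<le> k" "k \<le> 2 * n - 1" for k
    using that
  proof (induction k rule: nat_induct_at_least)
    case base
    then show ?case using col[of 1] by simp
  next
    case (Suc k)
    then show ?case using col[of "Suc k"] by simp
  qed
  have srv: "(\<Sum>s\<in>servers n. Qs s d (Suc t) \<omega>) + flow0 =
      (\<Sum>s\<in>servers n. Qs s d t \<omega>) + (\<Sum>s\<in>servers n. R s d t \<omega>)"
  proof -
    have "Qs s d (Suc t) \<omega> + fs s d t \<omega> = Qs s d t \<omega> + R s d t \<omega>" if "s \<in> servers n" for s
      using server(2,3)[OF that, of t] by linarith
    then have "(\<Sum>s\<in>servers n. Qs s d (Suc t) \<omega> + fs s d t \<omega>) =
        (\<Sum>s\<in>servers n. Qs s d t \<omega> + R s d t \<omega>)"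
      by (intro sum.cong) auto
    then show ?thesis by (simp add: sum.distrib flow0_def)
  qed
  have "out t = flow (2 * n - 1)" by (simp add: out_def flow_def)
  then show "backlog (Suc t) + out t = backlog t + (\<Sum>s\<in>servers n. R s d t \<omega>)"
    using srv sum_col[OF _ order.refl] n unfolding backlog_def col_def by linarith
qed


lemma average_bounded_sum:
  fixes f :: "'a \<Rightarrow> nat \<Rightarrow> real"
  assumes "finite I" "\<And>x. x \<in> I \<Longrightarrow> \<exists>C. \<forall>\<^sub>F T in sequentially. (\<Sum>t<T. f x t) \<le> C * real T"
  shows "\<exists>C. \<forall>\<^sub>F T in sequentially. (\<Sum>t<T. \<Sum>x\<in>I. f x t) \<le> C * real T"
proof -
  obtain C where C: "\<And>x. x \<in> I \<Longrightarrow> \<forall>\<^sub>F T in sequentially. (\<Sum>t<T. f x t) \<le> C x * real T"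
    using assms(2) by metis
  have "\<forall>\<^sub>F T in sequentially. \<forall>x\<in>I. (\<Sum>t<T. f x t) \<le> C x * real T"
    using assms(1) C by (intro eventually_ball_finite) auto
  then have "\<forall>\<^sub>F T in sequentially. (\<Sum>t<T. \<Sum>x\<in>I. f x t) \<le> (\<Sum>x\<in>I. C x) * real T"
    by eventually_elim (subst sum.swap, auto simp: sum_distrib_right intro: sum_mono)
  then show ?thesis by blast
qed

text \<open>The two sum constraints are \<open>rate_le_service_rate\<close> for two aggregates: the
  server \<open>s\<close> with its single outgoing link, and the total backlog for \<open>d\<close>.
  The bound by \<open>mean_arrival\<close> will make such a vector comparable with the admission
  rule.\<close>

lemma (in benes_traffic) stabilizable_rates_capacity:
  assumes n: "n \<ge> 1" and r: "r \<in> stabilizable_rates M n A"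
  shows "\<And>s d. s \<in> servers n \<Longrightarrow> d \<in> servers n \<Longrightarrow> 0 \<le> r s d \<and> r s d \<le> mean_arrival s d"
    and "\<And>s. s \<in> servers n \<Longrightarrow> (\<Sum>d\<in>servers n. r s d) \<le> 1"
    and "\<And>d. d \<in> servers n \<Longrightarrow> (\<Sum>s\<in>servers n. r s d) \<le> 1"
proof -
  from r obtain R Qs fs Qm fm where pol: "benes_policy M n A R Qs fs Qm fm"
    and st: "\<forall>s\<in>servers n. \<forall>d\<in>servers n.
           stable M (\<lambda>t \<omega>. real (Qs s d t \<omega>)) \<and>
           (\<forall>j\<in>{1..2 * n - 1}. \<forall>i\<in>rows n. stable M (\<lambda>t \<omega>. real (Qm j i s d t \<omega>))) \<and>
           has_average_rate M (R s d) (r s d)"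
    unfolding stabilizable_rates_def by blast
  note st1 = st[rule_format, THEN conjunct1]
    and st2 = st[rule_format, THEN conjunct2, THEN conjunct1, rule_format]
    and st3 = st[rule_format, THEN conjunct2, THEN conjunct2]
  note meas = pol[unfolded benes_policy_def, THEN conjunct1, rule_format]
  have [measurable]: "R s d t \<in> measurable M (count_space UNIV)"
    "Qs s d t \<in> measurable M (count_space UNIV)"
    if "s \<in> servers n" "d \<in> servers n" for s d t
    using meas[OF that] by auto
  have [measurable]: "Qm j i s d t \<in> measurable M (count_space UNIV)"
    if "s \<in> servers n" "d \<in> servers n" "j \<in> {1..2 * n - 1}" "i \<in> rows n" for j i s d t
    using meas[OF that(1,2), of t] that(3,4) by auto
  note server = pol[unfolded benes_policy_def, THEN conjunct2, THEN conjunct1, rule_format]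
  note cap = pol[unfolded benes_policy_def, THEN conjunct2, THEN conjunct2, THEN conjunct1, rule_format]
  define bl where "bl d t \<omega> = (\<Sum>s\<in>servers n. Qs s d t \<omega>) +
      (\<Sum>j\<in>{1..2 * n - 1}. \<Sum>i\<in>rows n. \<Sum>s\<in>servers n. Qm j i s d t \<omega>)" for d t \<omega>
  note cons = policy_conservation[OF pol n, folded bl_def]
  have R_le: "real (R s d t \<omega>) \<le> Amax" and R_le_A: "R s d t \<omega> \<le> A s d t \<omega>"
    if "\<omega> \<in> space M" "s \<in> servers n" "d \<in> servers n" for s d t \<omega>
    using server[OF that] arrivals_bounded[OF that(2,3,1), of t] by (auto intro: order_trans[rotated])
  have int_R: "integrable M (\<lambda>\<omega>. real (R s d t \<omega>))"
    if "s \<in> servers n" "d \<in> servers n" for s d t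
    using R_le that by (intro integrable_bounded[of _ Amax]) auto
  \<comment> \<open>A crude bound, linear in \<open>t\<close>, that serves to make every queue
    integrable.\<close>
  have bl_le: "real (bl d t \<omega>) \<le> real t * (2 ^ n * Amax)" if "\<omega> \<in> space M" "d \<in> servers n" for d t \<omega>
  proof (induction t)
    case (Suc t)
    have "real (bl d (Suc t) \<omega>) \<le> real (bl d t \<omega>) + (\<Sum>s\<in>servers n. real (R s d t \<omega>))"
      using cons(3)[OF that, of t] by (simp flip: of_nat_sum of_nat_add)
    also have "(\<Sum>s\<in>servers n. real (R s d t \<omega>)) \<le> (\<Sum>s\<in>servers n. Amax)"
      using R_le that by (intro sum_mono) auto
    finally show ?case using Suc by (simp add: algebra_simps)
  qed (use cons(1) that in simp)
  have Qs_le: "Qs s d t \<omega> \<le> bl d t \<omega>" if "s \<in> servers n" for s d t \<omega>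
    using that by (auto simp: bl_def intro!: trans_le_add1 member_le_sum)
  have Qm_le: "Qm j i s d t \<omega> \<le> bl d t \<omega>" if "s \<in> servers n" "j \<in> {1..2 * n - 1}" "i \<in> rows n" for j i s d t \<omega>
  proof -
    have "Qm j i s d t \<omega> \<le> (\<Sum>s\<in>servers n. Qm j i s d t \<omega>)"
      using that by (intro member_le_sum) auto
    also have "\<dots> \<le> (\<Sum>i\<in>rows n. \<Sum>s\<in>servers n. Qm j i s d t \<omega>)"
      using that by (intro member_le_sum[of i "rows n" "\<lambda>i. \<Sum>s\<in>servers n. Qm j i s d t \<omega>"]) auto
    also have "\<dots> \<le> (\<Sum>j\<in>{1..2 * n - 1}. \<Sum>i\<in>rows n. \<Sum>s\<in>servers n. Qm j i s d t \<omega>)"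
      using that by (intro member_le_sum[of j _ "\<lambda>j. \<Sum>i\<in>rows n. \<Sum>s\<in>servers n. Qm j i s d t \<omega>"]) auto
    finally show ?thesis by (simp add: bl_def)
  qed
  have int_Qs: "integrable M (\<lambda>\<omega>. real (Qs s d t \<omega>))" if "s \<in> servers n" "d \<in> servers n" for s d t
    using that order_trans[OF of_nat_mono[OF Qs_le[OF that(1), of d t]] bl_le[OF _ that(2), of _ t]]
    by (intro integrable_bounded[of _ "real t * (2 ^ n * Amax)"]) auto
  have int_Qm: "integrable M (\<lambda>\<omega>. real (Qm j i s d t \<omega>))"
    if "s \<in> servers n" "d \<in> servers n" "j \<in> {1..2 * n - 1}" "i \<in> rows n" for j i s d t
    using that order_trans[OF of_nat_mono[OF Qm_le[OF that(1,3,4), of d t]] bl_le[OF _ that(2), of _ t]]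
    by (intro integrable_bounded[of _ "real t * (2 ^ n * Amax)"]) auto
  have avg_Qs: "\<exists>C. \<forall>\<^sub>F T in sequentially. (\<Sum>t<T. \<integral>\<omega>. real (Qs s d t \<omega>) \<partial>M) \<le> C * real T"
    if "s \<in> servers n" "d \<in> servers n" for s d
    using stable_average_bounded[OF st1[OF that] int_Qs[OF that]] by simp
  have avg_Qm: "\<exists>C. \<forall>\<^sub>F T in sequentially. (\<Sum>t<T. \<integral>\<omega>. real (Qm j i s d t \<omega>) \<partial>M) \<le> C * real T"
    if "s \<in> servers n" "d \<in> servers n" "j \<in> {1..2 * n - 1}" "i \<in> rows n" for j i s d
    using stable_average_bounded[OF st2[OF that] int_Qm[OF that]] by simp
  have rate: "(\<lambda>T. (\<Sum>t<T. \<integral>\<omega>. real (R s d t \<omega>) \<partial>M) / real T) \<longlonglongrightarrow> r s d"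
    if "s \<in> servers n" "d \<in> servers n" for s d
    using st3[OF that] unfolding has_average_rate_def .
  {
    fix s d assume sd: "s \<in> servers n" "d \<in> servers n"
    have [measurable]: "A s d t \<in> measurable M (count_space UNIV)" for t
      using arrivals_measurable[OF sd] .
    have "(\<integral>\<omega>. real (R s d t \<omega>) \<partial>M) \<le> (\<integral>\<omega>. real (A s d t \<omega>) \<partial>M)" for t
      using R_le_A sd arrivals_bounded int_R
      by (intro integral_mono integrable_bounded[of "\<lambda>\<omega>. real (A s d t \<omega>)" Amax]) auto
    then have le: "(\<integral>\<omega>. real (R s d t \<omega>) \<partial>M) \<le> mean_arrival s d" for t
      by (simp add: expectation_arrivals[OF sd])
    have "(\<Sum>t<T. \<integral>\<omega>. real (R s d t \<omega>) \<partial>M) / real T \<le> mean_arrival s d" if "T \<ge> 1" for T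
      using sum_bounded_above[of "{..<T}" "\<lambda>t. \<integral>\<omega>. real (R s d t \<omega>) \<partial>M", OF le] that
      by (simp add: field_simps)
    then have "r s d \<le> mean_arrival s d"
      by (intro LIMSEQ_le_const2[OF rate[OF sd]]) blast
    moreover have "0 \<le> r s d"
      by (intro LIMSEQ_le_const[OF rate[OF sd]] exI[of _ 0]) (auto intro!: divide_nonneg_nonneg sum_nonneg)
    ultimately show "0 \<le> r s d \<and> r s d \<le> mean_arrival s d" by blast
  }
  {
    fix s assume s: "s \<in> servers n"
    obtain C where C: "\<forall>\<^sub>F T in sequentially.
        (\<Sum>t<T. \<Sum>d\<in>servers n. \<integral>\<omega>. real (Qs s d t \<omega>) \<partial>M) \<le> C * real T"
      using average_bounded_sum[of "servers n" "\<lambda>d t. \<integral>\<omega>. real (Qs s d t \<omega>) \<partial>M"] avg_Qs s by auto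
    have path: "(\<Sum>t<T. \<Sum>d\<in>servers n. R s d t \<omega>) \<le> (\<Sum>d\<in>servers n. Qs s d T \<omega>) + T"
      if \<omega>: "\<omega> \<in> space M" for T \<omega>
    proof (induction T)
      case (Suc T)
      have "Qs s d (Suc T) \<omega> + fs s d T \<omega> = Qs s d T \<omega> + R s d T \<omega>" if "d \<in> servers n" for d
        using server[OF \<omega> s that] by (metis add.assoc add.commute le_add_diff_inverse)
      then have "(\<Sum>d\<in>servers n. Qs s d (Suc T) \<omega> + fs s d T \<omega>) =
          (\<Sum>d\<in>servers n. Qs s d T \<omega> + R s d T \<omega>)" by (intro sum.cong) auto
      then show ?case using Suc cap[OF \<omega> s, of T] by (simp add: sum.distrib)
    qed simp
    have S: "(\<Sum>t<T. \<Sum>d\<in>servers n. \<integral>\<omega>. real (R s d t \<omega>) \<partial>M) \<le>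
        real T + (\<Sum>d\<in>servers n. \<integral>\<omega>. real (Qs s d T \<omega>) \<partial>M)" for T
    proof -
      have "(\<integral>\<omega>. (\<Sum>t<T. \<Sum>d\<in>servers n. real (R s d t \<omega>)) \<partial>M) \<le>
          (\<integral>\<omega>. (\<Sum>d\<in>servers n. real (Qs s d T \<omega>)) + real T \<partial>M)"
        using path[of _ T] s
        by (intro integral_mono Bochner_Integration.integrable_add Bochner_Integration.integrable_sum
            int_R int_Qs) (auto simp flip: of_nat_sum of_nat_add)
      also have "\<dots> = (\<Sum>d\<in>servers n. \<integral>\<omega>. real (Qs s d T \<omega>) \<partial>M) + real T"
        using int_Qs[OF s] by (simp add: prob_space del: atLeastAtMost_iff)
      finally show ?thesis
        using int_R[OF s] by (simp add: add.commute del: atLeastAtMost_iff)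
    qed
    have lim: "(\<lambda>T. (\<Sum>t<T. \<Sum>d\<in>servers n. \<integral>\<omega>. real (R s d t \<omega>) \<partial>M) / real T) \<longlonglongrightarrow> (\<Sum>d\<in>servers n. r s d)"
      using tendsto_sum[of "servers n", OF rate[OF s]]
      by (subst sum.swap) (simp add: sum_divide_distrib)
    show "(\<Sum>d\<in>servers n. r s d) \<le> 1"
      by (rule rate_le_service_rate[OF lim S _ C]) (auto intro!: sum_nonneg)
  }
  {
    fix d assume d: "d \<in> servers n"
    define X where "X T = (\<Sum>s\<in>servers n. \<integral>\<omega>. real (Qs s d T \<omega>) \<partial>M) +
      (\<Sum>j\<in>{1..2 * n - 1}. \<Sum>i\<in>rows n. \<Sum>s\<in>servers n. \<integral>\<omega>. real (Qm j i s d T \<omega>) \<partial>M)" for T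
    obtain C1 where C1: "\<forall>\<^sub>F T in sequentially.
        (\<Sum>t<T. \<Sum>s\<in>servers n. \<integral>\<omega>. real (Qs s d t \<omega>) \<partial>M) \<le> C1 * real T"
      using average_bounded_sum[of "servers n" "\<lambda>s t. \<integral>\<omega>. real (Qs s d t \<omega>) \<partial>M"] avg_Qs d by auto
    obtain C2 where C2: "\<forall>\<^sub>F T in sequentially.
        (\<Sum>t<T. \<Sum>j\<in>{1..2 * n - 1}. \<Sum>i\<in>rows n. \<Sum>s\<in>servers n. \<integral>\<omega>. real (Qm j i s d t \<omega>) \<partial>M) \<le> C2 * real T"
      using average_bounded_sum[of "{1..2 * n - 1}"
          "\<lambda>j t. \<Sum>i\<in>rows n. \<Sum>s\<in>servers n. \<integral>\<omega>. real (Qm j i s d t \<omega>) \<partial>M", OF _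
        average_bounded_sum[of "rows n" "\<lambda>i t. \<Sum>s\<in>servers n. \<integral>\<omega>. real (Qm _ i s d t \<omega>) \<partial>M", OF _
        average_bounded_sum[of "servers n" "\<lambda>s t. \<integral>\<omega>. real (Qm _ _ s d t \<omega>) \<partial>M", OF _
          avg_Qm[OF _ d]]]] by auto
    have C: "\<forall>\<^sub>F T in sequentially. (\<Sum>t<T. X t) \<le> (C1 + C2) * real T"
      using C1 C2 by eventually_elim (simp add: X_def sum.distrib algebra_simps)
    have path: "(\<Sum>t<T. \<Sum>s\<in>servers n. R s d t \<omega>) \<le> bl d T \<omega> + T" if \<omega>: "\<omega> \<in> space M" for T \<omega>
    proof (induction T)
      case (Suc T)
      then show ?case using cons(2,3)[OF \<omega> d, of T] by simp
    qed simp
    have S: "(\<Sum>t<T. \<Sum>s\<in>servers n. \<integral>\<omega>. real (R s d t \<omega>) \<partial>M) \<le> real T + X T" for T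
    proof -
      have "(\<integral>\<omega>. (\<Sum>t<T. \<Sum>s\<in>servers n. real (R s d t \<omega>)) \<partial>M) \<le>
          (\<integral>\<omega>. ((\<Sum>s\<in>servers n. real (Qs s d T \<omega>)) +
      (\<Sum>j\<in>{1..2 * n - 1}. \<Sum>i\<in>rows n. \<Sum>s\<in>servers n. real (Qm j i s d T \<omega>))) + real T \<partial>M)"
        using path[of _ T] d unfolding bl_def
        by (intro integral_mono Bochner_Integration.integrable_add Bochner_Integration.integrable_sum
            int_R int_Qs int_Qm) (auto simp flip: of_nat_sum of_nat_add)
      also have "\<dots> = X T + real T"
        unfolding X_def using int_Qs[OF _ d] int_Qm[OF _ d]
        by (simp add: prob_space del: atLeastAtMost_iff One_nat_def)
      finally show ?thesis
        using int_R[OF _ d] by (simp add: add.commute del: atLeastAtMost_iff)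
    qed
    have lim: "(\<lambda>T. (\<Sum>t<T. \<Sum>s\<in>servers n. \<integral>\<omega>. real (R s d t \<omega>) \<partial>M) / real T) \<longlonglongrightarrow> (\<Sum>s\<in>servers n. r s d)"
      using tendsto_sum[of "servers n", OF rate[OF _ d]]
      by (subst sum.swap) (simp add: sum_divide_distrib)
    show "(\<Sum>s\<in>servers n. r s d) \<le> 1"
      by (rule rate_le_service_rate[OF lim S _ C]) (auto simp: X_def intro!: add_nonneg_nonneg sum_nonneg)
  }
qed

text \<open>All constraints are closed conditions on finitely many coordinates, hence pass from the
  stabilizable rates to their closure, where the optimum is taken.\<close>

lemma (in benes_traffic) optimal_rates_capacity:
  assumes n: "n \<ge> 1" and r: "optimal_rates M n A U r"
  shows "\<And>s d. s \<in> servers n \<Longrightarrow> d \<in> servers n \<Longrightarrow> 0 \<le> r s d \<and> r s d \<le> mean_arrival s d"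
    and "\<And>s. s \<in> servers n \<Longrightarrow> (\<Sum>d\<in>servers n. r s d) \<le> 1"
    and "\<And>d. d \<in> servers n \<Longrightarrow> (\<Sum>s\<in>servers n. r s d) \<le> 1"
proof -
  define K where "K = {r. (\<forall>s\<in>servers n. \<forall>d\<in>servers n. 0 \<le> r s d \<and> r s d \<le> mean_arrival s d) \<and>
    (\<forall>s\<in>servers n. (\<Sum>d\<in>servers n. r s d) \<le> 1) \<and> (\<forall>d\<in>servers n. (\<Sum>s\<in>servers n. r s d) \<le> 1)}"
  \<comment> \<open>Functions carry the product topology, so evaluation at a pair of servers is
    continuous.\<close>
  have coord: "continuous_on UNIV (\<lambda>r :: nat \<Rightarrow> nat \<Rightarrow> real. r s d)" for s d
    by (rule continuous_on_compose2[OF continuous_on_product_coordinates[of d]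
          continuous_on_product_coordinates[of s]]) auto
  have K: "K = (\<Inter>s\<in>servers n. \<Inter>d\<in>servers n. {r. 0 \<le> r s d} \<inter> {r. r s d \<le> mean_arrival s d}) \<inter>
      (\<Inter>s\<in>servers n. {r. (\<Sum>d\<in>servers n. r s d) \<le> 1}) \<inter> (\<Inter>d\<in>servers n. {r. (\<Sum>s\<in>servers n. r s d) \<le> 1})"
    unfolding K_def by (auto simp del: atLeastAtMost_iff)
  have "closed K"
    unfolding K
    by (intro closed_Int closed_INT ballI closed_Collect_le continuous_on_const coord continuous_on_sum)
  moreover have "stabilizable_rates M n A \<subseteq> K"
    using stabilizable_rates_capacity[OF n] unfolding K_def by blast
  ultimately have "closure (stabilizable_rates M n A) \<subseteq> K" by (rule closure_minimal[rotated])
  then have "r \<in> K" using r unfolding optimal_rates_def is_arg_max_def by blast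
  then show "\<And>s d. s \<in> servers n \<Longrightarrow> d \<in> servers n \<Longrightarrow> 0 \<le> r s d \<and> r s d \<le> mean_arrival s d"
    "\<And>s. s \<in> servers n \<Longrightarrow> (\<Sum>d\<in>servers n. r s d) \<le> 1"
    "\<And>d. d \<in> servers n \<Longrightarrow> (\<Sum>s\<in>servers n. r s d) \<le> 1"
    unfolding K_def by blast+
qed

section \<open>Deterministic queue bounds\<close>

lemma division_Un: "division n Up \<union> division n Lo = servers n"
proof -
  have "x \<le> 2 ^ n" if "x \<le> 2 ^ (n - 1)" for x :: nat
    using that by (rule order_trans) (intro power_increasing, auto)
  then show ?thesis by (auto simp: division_def)
qed

lemma division_Int: "division n Up \<inter> division n Lo = {}"
  by (auto simp: division_def)

lemma finite_division [simp]: "finite (division n c)"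
  by (cases c) (auto simp: division_def)

lemma division_subset: "division n c \<subseteq> servers n"
  using division_Un[of n] by (cases c) auto

lemma sum_servers_division:
  fixes f :: "nat \<Rightarrow> 'a :: comm_monoid_add"
  shows "(\<Sum>d\<in>servers n. f d) = (\<Sum>c\<in>{Up, Lo}. \<Sum>d\<in>division n c. f d)"
  using sum.union_disjoint[of "division n Up" "division n Lo" f] division_Int
  by (simp add: division_Un)

lemma card_division_le: "card (division n c) \<le> 2 ^ (n - 1)" if "n \<ge> 1"
  using that by (cases n; cases c) (auto simp: division_def)

text \<open>The objective is linear, so the best of the three integer choices also beats every
  fractional pair \<open>a\<close>, \<open>b\<close> in the triangle. The truncation at 0 disappears
  because a division with a negative difference gets rate 0.\<close>

lemma backpressureD:
  assumes "backpressure \<delta>U \<delta>L x y"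
  shows "x + y \<le> 1" "\<delta>U < 0 \<Longrightarrow> x = 0" "\<delta>L < 0 \<Longrightarrow> y = 0"
    "0 \<le> a \<Longrightarrow> 0 \<le> b \<Longrightarrow> a + b \<le> 1 \<Longrightarrow> a * \<delta>U + b * \<delta>L \<le> real x * \<delta>U + real y * \<delta>L"
proof -
  let ?f = "\<lambda>p. case p of (x, y) \<Rightarrow> real x * max \<delta>U 0 + real y * max \<delta>L 0"
  let ?P = "\<lambda>(x :: nat, y :: nat). x \<in> {0, 1} \<and> y \<in> {0, 1} \<and> x + y \<le> 1"
  have max: "?P (x, y)" "\<And>p. ?P p \<Longrightarrow> ?f p \<le> ?f (x, y)"
    and neg: "\<delta>U < 0 \<Longrightarrow> x = 0" "\<delta>L < 0 \<Longrightarrow> y = 0"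
    using assms unfolding backpressure_def is_arg_max_def by (auto simp: not_less)
  show "x + y \<le> 1" "\<delta>U < 0 \<Longrightarrow> x = 0" "\<delta>L < 0 \<Longrightarrow> y = 0"
    using max(1) neg by auto
  assume ab: "0 \<le> a" "0 \<le> b" "a + b \<le> 1"
  define m where "m = ?f (x, y)"
  have m: "max \<delta>U 0 \<le> m" "max \<delta>L 0 \<le> m"
    using max(2)[of "(1, 0)"] max(2)[of "(0, 1)"] by (auto simp: m_def)
  have "a * \<delta>U + b * \<delta>L \<le> a * m + b * m"
    using m ab by (intro add_mono mult_left_mono) auto
  also have "\<dots> = (a + b) * m" by (simp add: algebra_simps)
  also have "\<dots> \<le> 1 * m" using m ab by (intro mult_right_mono) auto
  finally have le: "a * \<delta>U + b * \<delta>L \<le> 1 * m" .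
  have e: "real x * max \<delta>U 0 = real x * \<delta>U" "real y * max \<delta>L 0 = real y * \<delta>L"
    using neg by (cases "\<delta>U < 0"; cases "\<delta>L < 0"; simp)+
  have "1 * m = real x * \<delta>U + real y * \<delta>L" by (simp only: m_def prod.case mult_1_left e)
  then show "a * \<delta>U + b * \<delta>L \<le> real x * \<delta>U + real y * \<delta>L" using le by linarith
qed

text \<open>Turns conservation of packets into the recursion with a positive part, given that
  exactly the minimum of rate and content is sent.\<close>

lemma served_queue:
  fixes q q' r :: nat and x :: real
  assumes "real q' + real (min r q) = real q + x"
  shows "real q' = max (real q - real r) 0 + x"
  using assms by (cases "r \<le> q") (auto simp: max_def)

section \<open>One-slot recursions of the queues\<close>

locale empty_benes_run = grouped_backpressure +
  assumes n_ge_2: "n \<ge> 2" and V_pos: "V \<ge> 1" and eta: "0 < \<eta>" "\<eta> < 1"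
    and fict_empty: "fictitious_empty M n w" and phys_empty: "physical_empty M n w"
begin

lemma initially_empty:
  assumes "\<omega> \<in> space M"
  shows "s \<in> servers n \<Longrightarrow> server_queue n w c s 0 \<omega> = 0"
    "j \<in> {1..n - 1} \<Longrightarrow> i \<in> rows n \<Longrightarrow> node_queue n w c l j i 0 \<omega> = 0"
    "i \<in> rows n \<Longrightarrow> dest_queue w c i 0 \<omega> = 0"
    "s \<in> servers n \<Longrightarrow> d \<in> servers n \<Longrightarrow> adm_queue w s d 0 \<omega> = 0"
    "d \<in> servers n \<Longrightarrow> reg_queue w d 0 \<omega> = 0"
    "j \<in> {n..2 * n - 1} \<Longrightarrow> i \<in> rows n \<Longrightarrow> fifo_queue w l j i 0 \<omega> = []"
  using bspec[OF fict_empty[unfolded fictitious_empty_def] assms]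
    bspec[OF phys_empty[unfolded physical_empty_def] assms]
  by (simp_all del: atLeastAtMost_iff One_nat_def)

text \<open>Allocated inflow of any module up to column \<open>n\<close>. It dominates the packets
  that really arrive and depends only on the rates that backpressure chooses.\<close>

definition alloc :: "side \<Rightarrow> nat \<Rightarrow> nat \<Rightarrow> nat \<Rightarrow> 'a \<Rightarrow> real" where
  "alloc c j i t \<omega> =
     (if j = 1 then (\<Sum>s\<in>{s \<in> servers n. row_of s = i}. real (server_rate w c s t \<omega>))
      else (\<Sum>l\<in>{Up, Lo}. \<Sum>i'\<in>upstream n l j i. real (node_rate w c l (j - 1) i' t \<omega>)))"

lemma alloc_nonneg: "0 \<le> alloc c j i t \<omega>"
  by (auto simp: alloc_def intro!: add_nonneg_nonneg sum_nonneg)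

lemma alloc_in_eq: "real (alloc_in n w c i t \<omega>) = alloc c n i t \<omega>"
  using n_ge_2 by (auto simp: alloc_def alloc_in_def)

lemma upstream_subset: "upstream n l j i \<subseteq> rows n"
  by (auto simp: upstream_def)

lemma server_rate_le:
  assumes "\<omega> \<in> space M" "s \<in> servers n"
  shows "(\<Sum>c\<in>{Up, Lo}. real (server_rate w c s t \<omega>)) \<le> 1"
  using backpressureD(1)[OF choose_server_rate[OF assms, of t]] by simp

lemma node_rate_le:
  assumes "\<omega> \<in> space M" "j \<in> {1..n - 1}" "i \<in> rows n"
  shows "(\<Sum>c\<in>{Up, Lo}. real (node_rate w c l j i t \<omega>)) \<le> 1"
  using backpressureD(1)[OF choose_node_rate[OF assms, of l t]] by simp

lemma sum_upstream_le:
  fixes f :: "side \<Rightarrow> nat \<Rightarrow> real"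
  assumes "2 \<le> j" "j \<le> 2 * n - 1" "i \<in> rows n" "0 \<le> B"
    and "\<And>l i'. i' \<in> upstream n l j i \<Longrightarrow> f l i' \<le> B"
  shows "(\<Sum>l\<in>{Up, Lo}. \<Sum>i'\<in>upstream n l j i. f l i') \<le> 2 * B"
proof -
  have "(\<Sum>l\<in>{Up, Lo}. \<Sum>i'\<in>upstream n l j i. f l i') \<le> (\<Sum>l\<in>{Up, Lo}. real (card (upstream n l j i)) * B)"
    using assms(5) by (intro sum_mono) (auto intro: sum_bounded_above)
  also have "\<dots> = real (card (upstream n Up j i) + card (upstream n Lo j i)) * B"
    by (simp add: algebra_simps)
  also have "\<dots> \<le> 2 * B"
    using card_upstream_le_2[OF assms(1-3)] assms(4) by (intro mult_right_mono) linarith+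
  finally show ?thesis .
qed

lemma card_servers_of_row_le: "i \<in> rows n \<Longrightarrow> card {s \<in> servers n. row_of s = i} \<le> 2"
  using servers_of_row[of n i] n_ge_2 by (simp add: card_insert_if)

text \<open>Exchanging the sums shows why the total is 2 and not 4: both divisions share each of the
  two incoming links.\<close>

lemma alloc_total_le:
  assumes "\<omega> \<in> space M" "j \<in> {1..n}" "i \<in> rows n"
  shows "(\<Sum>c\<in>{Up, Lo}. alloc c j i t \<omega>) \<le> 2"
proof (cases "j = 1")
  case True
  have "(\<Sum>c\<in>{Up, Lo}. alloc c j i t \<omega>) =
      (\<Sum>s\<in>{s \<in> servers n. row_of s = i}. \<Sum>c\<in>{Up, Lo}. real (server_rate w c s t \<omega>))"
    unfolding alloc_def using True by (subst sum.swap) simp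
  also have "\<dots> \<le> (\<Sum>s\<in>{s \<in> servers n. row_of s = i}. 1)"
    using server_rate_le[OF assms(1)] by (intro sum_mono) blast
  also have "\<dots> \<le> 2" using card_servers_of_row_le[OF assms(3)] by simp
  finally show ?thesis .
next
  case False
  have "(\<Sum>c\<in>{Up, Lo}. alloc c j i t \<omega>) =
      (\<Sum>l\<in>{Up, Lo}. \<Sum>i'\<in>upstream n l j i. \<Sum>c\<in>{Up, Lo}. real (node_rate w c l (j - 1) i' t \<omega>))"
    unfolding alloc_def using False by (simp add: sum.distrib)
  also have "\<dots> \<le> 2 * 1"
  proof (intro sum_upstream_le assms)
    fix l i' assume "i' \<in> upstream n l j i"
    then have "i' \<in> rows n" using upstream_subset by blast
    moreover have "j - 1 \<in> {1..n - 1}" using False assms(2) by auto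
    ultimately show "(\<Sum>c\<in>{Up, Lo}. real (node_rate w c l (j - 1) i' t \<omega>)) \<le> 1"
      using node_rate_le[OF assms(1)] by blast
  qed (use False assms(2) n_ge_2 in auto)
  finally show ?thesis by simp
qed

lemma alloc_le:
  assumes "\<omega> \<in> space M" "j \<in> {1..n}" "i \<in> rows n"
  shows "alloc c j i t \<omega> \<le> 2"
  using alloc_total_le[OF assms, of t] alloc_nonneg[of Up j i t \<omega>] alloc_nonneg[of Lo j i t \<omega>]
  by (cases c) auto

lemma server_sent_le:
  assumes "\<omega> \<in> space M" "s \<in> servers n"
  shows "(\<Sum>d\<in>servers n. server_sent w c s d t \<omega>) \<le> server_rate w c s t \<omega>"
  using serve_server[OF assms, of c t] unfolding serves_def by simp

lemma node_sent_le:
  assumes "\<omega> \<in> space M" "j \<in> {1..n - 1}" "i \<in> rows n"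
  shows "(\<Sum>d\<in>servers n. node_sent w c l j i d t \<omega>) \<le> node_rate w c l j i t \<omega>"
  using serve_node[OF assms, of c l t] unfolding serves_def by simp

lemma pkts_in_le_alloc:
  assumes "\<omega> \<in> space M" "j \<in> {1..n}" "i \<in> rows n"
  shows "real (\<Sum>d\<in>servers n. pkts_in n w c j i d t \<omega>) \<le> alloc c j i t \<omega>"
proof (cases "j = 1")
  case True
  have "(\<Sum>d\<in>servers n. pkts_in n w c j i d t \<omega>) =
      (\<Sum>s\<in>{s \<in> servers n. row_of s = i}. \<Sum>d\<in>servers n. server_sent w c s d t \<omega>)"
    unfolding pkts_in_def using True by (subst sum.swap) simp
  also have "\<dots> \<le> (\<Sum>s\<in>{s \<in> servers n. row_of s = i}. server_rate w c s t \<omega>)"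
    using server_sent_le[OF assms(1)] by (intro sum_mono) blast
  finally have "real (\<Sum>d\<in>servers n. pkts_in n w c j i d t \<omega>) \<le>
      real (\<Sum>s\<in>{s \<in> servers n. row_of s = i}. server_rate w c s t \<omega>)"
    by (rule of_nat_mono)
  then show ?thesis using True by (simp add: alloc_def)
next
  case False
  have "(\<Sum>d\<in>servers n. pkts_in n w c j i d t \<omega>) =
      (\<Sum>l\<in>{Up, Lo}. \<Sum>i'\<in>upstream n l j i. \<Sum>d\<in>servers n. node_sent w c l (j - 1) i' d t \<omega>)"
    unfolding pkts_in_def using False
    by (simp add: sum.distrib) (intro arg_cong2[where f = "(+)"] sum.swap)
  also have "\<dots> \<le> (\<Sum>l\<in>{Up, Lo}. \<Sum>i'\<in>upstream n l j i. node_rate w c l (j - 1) i' t \<omega>)"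
  proof (intro sum_mono)
    fix l i' assume "i' \<in> upstream n l j i"
    then have "i' \<in> rows n" using upstream_subset by blast
    moreover have "j - 1 \<in> {1..n - 1}" using False assms(2) by auto
    ultimately show "(\<Sum>d\<in>servers n. node_sent w c l (j - 1) i' d t \<omega>) \<le> node_rate w c l (j - 1) i' t \<omega>"
      using node_sent_le[OF assms(1)] by blast
  qed
  finally have "real (\<Sum>d\<in>servers n. pkts_in n w c j i d t \<omega>) \<le>
      real (\<Sum>l\<in>{Up, Lo}. \<Sum>i'\<in>upstream n l j i. node_rate w c l (j - 1) i' t \<omega>)"
    by (rule of_nat_mono)
  then show ?thesis using False by (simp add: alloc_def)
qed

lemma server_queue_step:
  assumes "\<omega> \<in> space M" "s \<in> servers n"
  shows "real (server_queue n w c s (Suc t) \<omega>) =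
    max (real (server_queue n w c s t \<omega>) - real (server_rate w c s t \<omega>)) 0 +
    (\<Sum>d\<in>division n c. real (admitted w s d t \<omega>))"
proof -
  have sv: "\<And>d. d \<in> servers n \<Longrightarrow> server_sent w c s d t \<omega> \<le> server_pkts w c s d t \<omega>"
    "(\<Sum>d\<in>servers n. server_sent w c s d t \<omega>) = min (server_rate w c s t \<omega>) (server_queue n w c s t \<omega>)"
    using serve_server[OF assms, of c t] unfolding serves_def server_queue_def by auto
  have "(\<Sum>d\<in>servers n. server_pkts w c s d (Suc t) \<omega> + server_sent w c s d t \<omega>) =
     (\<Sum>d\<in>servers n. server_pkts w c s d t \<omega> + (if d \<in> division n c then admitted w s d t \<omega> else 0))"
  proof (intro sum.cong refl)
    fix d assume d: "d \<in> servers n"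
    show "server_pkts w c s d (Suc t) \<omega> + server_sent w c s d t \<omega> =
      server_pkts w c s d t \<omega> + (if d \<in> division n c then admitted w s d t \<omega> else 0)"
      using sv(1)[OF d] update_server[OF assms d, of c t] by linarith
  qed
  then have "server_queue n w c s (Suc t) \<omega> + min (server_rate w c s t \<omega>) (server_queue n w c s t \<omega>) =
    server_queue n w c s t \<omega> + (\<Sum>d\<in>servers n. if d \<in> division n c then admitted w s d t \<omega> else 0)"
    using sv(2) by (simp add: sum.distrib server_queue_def)
  also have "(\<Sum>d\<in>servers n. if d \<in> division n c then admitted w s d t \<omega> else 0) =
      (\<Sum>d\<in>division n c. admitted w s d t \<omega>)"
    using division_subset[of n c] by (intro sum.mono_neutral_cong_right) auto
  finally have "real (server_queue n w c s (Suc t) \<omega>) +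
      real (min (server_rate w c s t \<omega>) (server_queue n w c s t \<omega>)) =
    real (server_queue n w c s t \<omega>) + (\<Sum>d\<in>division n c. real (admitted w s d t \<omega>))"
    by (simp flip: of_nat_sum of_nat_add)
  then show ?thesis by (rule served_queue)
qed

lemma node_queue_step_eq:
  assumes "\<omega> \<in> space M" "j \<in> {1..n - 1}" "i \<in> rows n"
  shows "real (node_queue n w c l j i (Suc t) \<omega>) =
    max (real (node_queue n w c l j i t \<omega>) - real (node_rate w c l j i t \<omega>)) 0 +
    (if coin w c j i t \<omega> \<longleftrightarrow> l = Up then real (\<Sum>d\<in>servers n. pkts_in n w c j i d t \<omega>) else 0)"
proof -
  let ?b = "coin w c j i t \<omega> \<longleftrightarrow> l = Up"
  have sv: "\<And>d. d \<in> servers n \<Longrightarrow> node_sent w c l j i d t \<omega> \<le> node_pkts w c l j i d t \<omega>"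
    "(\<Sum>d\<in>servers n. node_sent w c l j i d t \<omega>) =
       min (node_rate w c l j i t \<omega>) (node_queue n w c l j i t \<omega>)"
    using serve_node[OF assms, of c l t] unfolding serves_def node_queue_def by auto
  have "(\<Sum>d\<in>servers n. node_pkts w c l j i d (Suc t) \<omega> + node_sent w c l j i d t \<omega>) =
     (\<Sum>d\<in>servers n. node_pkts w c l j i d t \<omega> + (if ?b then pkts_in n w c j i d t \<omega> else 0))"
  proof (intro sum.cong refl)
    fix d assume d: "d \<in> servers n"
    show "node_pkts w c l j i d (Suc t) \<omega> + node_sent w c l j i d t \<omega> =
      node_pkts w c l j i d t \<omega> + (if ?b then pkts_in n w c j i d t \<omega> else 0)"
      using sv(1)[OF d] update_node[OF assms d, of c l t] by linarith
  qed
  then have "node_queue n w c l j i (Suc t) \<omega> + min (node_rate w c l j i t \<omega>) (node_queue n w c l j i t \<omega>) =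
    node_queue n w c l j i t \<omega> + (if ?b then (\<Sum>d\<in>servers n. pkts_in n w c j i d t \<omega>) else 0)"
    using sv(2) by (simp add: sum.distrib node_queue_def)
  then have "real (node_queue n w c l j i (Suc t) \<omega>) +
      real (min (node_rate w c l j i t \<omega>) (node_queue n w c l j i t \<omega>)) =
    real (node_queue n w c l j i t \<omega>) + (if ?b then real (\<Sum>d\<in>servers n. pkts_in n w c j i d t \<omega>) else 0)"
    by (cases ?b) (simp_all del: of_nat_sum flip: of_nat_add)
  then show ?thesis by (rule served_queue)
qed

lemma node_queue_step:
  assumes "\<omega> \<in> space M" "j \<in> {1..n - 1}" "i \<in> rows n"
  shows "real (node_queue n w c l j i (Suc t) \<omega>) \<le>
    max (real (node_queue n w c l j i t \<omega>) - real (node_rate w c l j i t \<omega>)) 0 +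
    (if coin w c j i t \<omega> \<longleftrightarrow> l = Up then alloc c j i t \<omega> else 0)"
proof -
  have "j \<in> {1..n}" using assms(2) by auto
  then show ?thesis
    using node_queue_step_eq[OF assms, of c l t] pkts_in_le_alloc[OF assms(1) _ assms(3), of j c t]
    by (simp split: if_splits)
qed

lemma dest_queue_step:
  assumes "\<omega> \<in> space M" "i \<in> rows n"
  shows "dest_queue w c i (Suc t) \<omega> \<le>
    max (dest_queue w c i t \<omega> - real (dest_rate w c i t \<omega>)) 0 + alloc c n i t \<omega>"
  using update_dest_queue(2)[OF assms, of c t] by (simp add: alloc_in_eq)

section \<open>Bounds on the virtual queues and the server queues\<close>

lemma aux_rate_bounds:
  assumes "\<omega> \<in> space M" "s \<in> servers n" "d \<in> servers n"
  shows "0 \<le> aux_rate w s d t \<omega>" "aux_rate w s d t \<omega> \<le> Amax"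
    "0 \<le> g \<Longrightarrow> g \<le> Amax \<Longrightarrow> V * U s d g - adm_queue w s d t \<omega> * g \<le>
       V * U s d (aux_rate w s d t \<omega>) - adm_queue w s d t \<omega> * aux_rate w s d t \<omega>"
  using choose_aux_rate[OF assms, of t] unfolding is_arg_max_def by (auto simp: not_less)

lemma admitted_le:
  assumes "\<omega> \<in> space M" "s \<in> servers n" "d \<in> servers n"
  shows "admitted w s d t \<omega> \<le> A s d t \<omega>" "real (admitted w s d t \<omega>) \<le> Amax"
proof -
  obtain c where c: "d \<in> division n c" using assms(3) division_Un by blast
  show *: "admitted w s d t \<omega> \<le> A s d t \<omega>"
    using choose_admitted[OF assms(1,2) c, of t] by simp
  show "real (admitted w s d t \<omega>) \<le> Amax"
    using * arrivals_bounded[OF assms(2,3,1), of t] by linarith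
qed

text \<open>A sum over all flows in place of a maximum: the slopes are nonnegative, so it dominates
  each single \<open>V * U' s d 0 + Amax\<close> and gives one constant for all flows.\<close>

definition adm_bound :: real where
  "adm_bound = V * (\<Sum>s\<in>servers n. \<Sum>d\<in>servers n. U' s d 0) + Amax"

lemma V_derivative_le:
  assumes "s \<in> servers n" "d \<in> servers n"
  shows "V * U' s d 0 + Amax \<le> adm_bound"
proof -
  have "U' s d 0 \<le> (\<Sum>d\<in>servers n. U' s d 0)"
    using utility_derivative_nonneg[OF assms(1)] assms(2) by (intro member_le_sum) auto
  also have "\<dots> \<le> (\<Sum>s\<in>servers n. \<Sum>d\<in>servers n. U' s d 0)"
    using utility_derivative_nonneg assms(1)
    by (intro member_le_sum[of s _ "\<lambda>s. \<Sum>d\<in>servers n. U' s d 0"] sum_nonneg) auto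
  finally show ?thesis using V_pos unfolding adm_bound_def by (simp add: mult_left_mono)
qed

lemma adm_queue_nonneg:
  assumes "\<omega> \<in> space M" "s \<in> servers n" "d \<in> servers n"
  shows "0 \<le> adm_queue w s d t \<omega>"
proof (cases t)
  case 0
  then show ?thesis using initially_empty(4)[OF assms] by simp
next
  case (Suc t)
  then show ?thesis
    using update_adm_queue[OF assms, of t] aux_rate_bounds(1)[OF assms, of t] by simp
qed

text \<open>Above \<open>V U'(0)\<close> the auxiliary rate is zero, so an admission queue stops growing there.\<close>

lemma adm_queue_le:
  assumes \<omega>: "\<omega> \<in> space M" "s \<in> servers n" "d \<in> servers n"
  shows "adm_queue w s d t \<omega> \<le> adm_bound"
proof -
  have "adm_queue w s d t \<omega> \<le> V * U' s d 0 + Amax"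
  proof (induction t)
    case 0
    show ?case
      using initially_empty(4)[OF assms] Amax_nonneg V_pos utility_derivative_nonneg[OF assms(2,3), of 0] by simp
  next
    case (Suc t)
    let ?H = "adm_queue w s d t \<omega>" and ?g = "aux_rate w s d t \<omega>"
    show ?case
    proof (cases "?H \<le> V * U' s d 0")
      case True
      have "max (?H - real (admitted w s d t \<omega>)) 0 \<le> V * U' s d 0"
        using True adm_queue_nonneg[OF assms, of t] by simp
      then show ?thesis
        using update_adm_queue[OF assms, of t] aux_rate_bounds(2)[OF assms, of t] by linarith
    next
      case False
      \<comment> \<open>Comparing the chosen rate with the choice 0 and using the tangent at 0
        yields \<open>(?H - V * U' s d 0) * ?g \<le> 0\<close>, which forces \<open>?g = 0\<close>
        in this case.\<close>
      have "V * U s d ?g \<le> V * (U s d 0 + U' s d 0 * (?g - 0))"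
        using utility_le_tangent[OF assms(2,3), of 0 ?g] aux_rate_bounds(1)[OF assms, of t] V_pos
        by (intro mult_left_mono) auto
      moreover have "V * U s d 0 \<le> V * U s d ?g - ?H * ?g"
        using aux_rate_bounds(3)[OF assms, of 0 t] Amax_nonneg by simp
      ultimately have "(?H - V * U' s d 0) * ?g \<le> 0" by (simp add: algebra_simps)
      then have "?g = 0"
        using False aux_rate_bounds(1)[OF assms, of t] by (simp add: mult_le_0_iff)
      then show ?thesis
        using Suc update_adm_queue[OF assms, of t] adm_queue_nonneg[OF assms, of t] by simp
    qed
  qed
  then show ?thesis using V_derivative_le[OF assms(2,3)] by linarith
qed

lemma reg_queue_nonneg:
  assumes "\<omega> \<in> space M" "d \<in> servers n"
  shows "0 \<le> reg_queue w d t \<omega>"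
proof (cases t)
  case 0
  then show ?thesis using initially_empty(5)[OF assms] by simp
next
  case (Suc t)
  then show ?thesis using update_reg_queue[OF assms, of t] by (simp add: sum_nonneg)
qed

text \<open>A queue that accepts packets only up to the level \<open>adm_bound\<close> overshoots it
  by at most one slot of arrivals from \<open>2 ^ n\<close> flows.\<close>

definition src_bound :: real where
  "src_bound = adm_bound + 2 ^ n * Amax"

lemma adm_bound_nonneg: "0 \<le> adm_bound"
  using Amax_nonneg V_pos utility_derivative_nonneg
  unfolding adm_bound_def by (auto intro!: add_nonneg_nonneg mult_nonneg_nonneg sum_nonneg)

text \<open>Admission requires the admission queue to exceed the regulation queue; above
  \<open>adm_bound\<close> this fails for every source, and the queue can only drain.\<close>

lemma reg_queue_le:
  assumes \<omega>: "\<omega> \<in> space M" "d \<in> servers n"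
  shows "reg_queue w d t \<omega> \<le> src_bound"
proof (induction t)
  case 0
  show ?case using initially_empty(5)[OF assms] adm_bound_nonneg Amax_nonneg by (simp add: src_bound_def)
next
  case (Suc t)
  obtain c where c: "d \<in> division n c" using assms(2) division_Un by blast
  have q: "max (reg_queue w d t \<omega> - (1 - \<eta>)) 0 \<le> reg_queue w d t \<omega>"
    using reg_queue_nonneg[OF assms, of t] eta by simp
  show ?case
  proof (cases "reg_queue w d t \<omega> \<le> adm_bound")
    case True
    have "(\<Sum>s\<in>servers n. real (admitted w s d t \<omega>)) \<le> (\<Sum>s\<in>servers n. Amax)"
      using admitted_le(2)[OF \<omega>(1) _ \<omega>(2)] by (intro sum_mono) auto
    also have "(\<Sum>s\<in>servers n. Amax) = 2 ^ n * Amax" by simp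
    finally show ?thesis
      unfolding src_bound_def using update_reg_queue[OF assms, of t] q True by linarith
  next
    case False
    have "admitted w s d t \<omega> = 0" if "s \<in> servers n" for s
      using choose_admitted[OF \<omega>(1) that c, of t] adm_queue_le[OF \<omega>(1) that \<omega>(2), of t] False by simp
    then have "(\<Sum>s\<in>servers n. real (admitted w s d t \<omega>)) = 0" by (intro sum.neutral) auto
    then show ?thesis using update_reg_queue[OF assms, of t] q Suc by simp
  qed
qed

text \<open>The same threshold argument with the server queue in the decisive role; the regulation
  queue, being nonnegative, only makes admission harder.\<close>

lemma server_queue_le:
  assumes \<omega>: "\<omega> \<in> space M" "s \<in> servers n"
  shows "real (server_queue n w c s t \<omega>) \<le> src_bound"
proof (induction t)
  case 0
  show ?case using initially_empty(1)[OF assms] adm_bound_nonneg Amax_nonneg by (simp add: src_bound_def)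
next
  case (Suc t)
  let ?Q = "real (server_queue n w c s t \<omega>)"
  have q: "max (?Q - real (server_rate w c s t \<omega>)) 0 \<le> ?Q" by simp
  show ?case
  proof (cases "?Q \<le> adm_bound")
    case True
    have "(\<Sum>d\<in>division n c. real (admitted w s d t \<omega>)) \<le> (\<Sum>d\<in>servers n. real (admitted w s d t \<omega>))"
      using division_subset by (intro sum_mono2) auto
    also have "\<dots> \<le> (\<Sum>s\<in>servers n. Amax)"
      using admitted_le(2)[OF \<omega>] by (intro sum_mono) auto
    also have "(\<Sum>s\<in>servers n. Amax) = 2 ^ n * Amax" by simp
    finally show ?thesis
      unfolding src_bound_def using server_queue_step[OF assms, of c t] q True by linarith
  next
    case False
    have "admitted w s d t \<omega> = 0" if "d \<in> division n c" for d
    proof -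
      have d: "d \<in> servers n" using that division_subset by blast
      show ?thesis
        using choose_admitted[OF \<omega> that, of t] adm_queue_le[OF \<omega> d, of t]
          reg_queue_nonneg[OF \<omega>(1) d, of t] False by simp
    qed
    then have "(\<Sum>d\<in>division n c. real (admitted w s d t \<omega>)) = 0" by (intro sum.neutral) auto
    then show ?thesis using server_queue_step[OF assms, of c t] q Suc by simp
  qed
qed

section \<open>Bounds along the columns\<close>

lemma dest_queue_nonneg: "\<omega> \<in> space M \<Longrightarrow> i \<in> rows n \<Longrightarrow> 0 \<le> dest_queue w c i t \<omega>"
  by (rule update_dest_queue(1))

text \<open>The coin puts the inflow into only one of the two averaged queues, so before column
  \<open>n\<close> the growth is at most half of \<open>alloc\<close>; the full amount is the bound
  that also covers the partition nodes.\<close>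

lemma grouped_queue_step:
  assumes "\<omega> \<in> space M" "j \<in> {1..n}" "i \<in> rows n"
  shows "grouped_queue n w c j i (Suc t) \<omega> \<le> grouped_queue n w c j i t \<omega> + alloc c j i t \<omega>"
proof (cases "j < n")
  case True
  then have j: "j \<in> {1..n - 1}" using assms(2) by auto
  have "real (node_queue n w c Up j i (Suc t) \<omega>) + real (node_queue n w c Lo j i (Suc t) \<omega>) \<le>
     real (node_queue n w c Up j i t \<omega>) + real (node_queue n w c Lo j i t \<omega>) + alloc c j i t \<omega>"
    using node_queue_step[OF assms(1) j assms(3), of c Up t] node_queue_step[OF assms(1) j assms(3), of c Lo t]
      alloc_nonneg[of c j i t \<omega>]
    by (cases "coin w c j i t \<omega>") auto
  then show ?thesis using True alloc_nonneg[of c j i t \<omega>] by (simp add: grouped_queue_def)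
next
  case False
  then have [simp]: "j = n" using assms(2) by auto
  have "max (dest_queue w c i t \<omega> - real (dest_rate w c i t \<omega>)) 0 \<le> dest_queue w c i t \<omega>"
    using dest_queue_nonneg[OF assms(1,3), of c t] by simp
  then show ?thesis using dest_queue_step[OF assms(1,3), of c t] by (simp add: grouped_queue_def)
qed

text \<open>Backpressure never sends into a queue that exceeds all the queues feeding it.\<close>

lemma grouped_queue_le:
  assumes \<omega>: "\<omega> \<in> space M" "j \<in> {1..n}" "i \<in> rows n" and B: "0 \<le> B"
    and up: "\<And>t s. j = 1 \<Longrightarrow> s \<in> servers n \<Longrightarrow> real (server_queue n w c s t \<omega>) \<le> B"
      "\<And>t l i'. j \<noteq> 1 \<Longrightarrow> i' \<in> rows n \<Longrightarrow> real (node_queue n w c l (j - 1) i' t \<omega>) \<le> B"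
  shows "grouped_queue n w c j i t \<omega> \<le> B + 2"
proof (induction t)
  case 0
  have "grouped_queue n w c j i 0 \<omega> = 0"
    using initially_empty(2,3)[OF \<omega>(1)] \<omega>(2,3) unfolding grouped_queue_def by auto
  then show ?case using B by simp
next
  case (Suc t)
  show ?case
  proof (cases "grouped_queue n w c j i t \<omega> \<le> B")
    case True
    then show ?thesis using grouped_queue_step[OF \<omega>, of c t] alloc_le[OF \<omega>, of c t] by linarith
  next
    case False
    have "alloc c j i t \<omega> = 0"
    proof (cases "j = 1")
      case True
      have "server_rate w c s t \<omega> = 0" if s: "s \<in> servers n" "row_of s = i" for s
      proof -
        have "server_diff n w c s t \<omega> < 0"
          using False up(1)[OF True s(1), of t] s(2) True by (simp add: server_diff_def)
        then show ?thesis
          using backpressureD(2,3)[OF choose_server_rate[OF \<omega>(1) s(1), of t]] by (cases c) auto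
      qed
      then show ?thesis using True by (auto simp: alloc_def intro!: sum.neutral)
    next
      case j: False
      have "node_rate w c l (j - 1) i' t \<omega> = 0" if i': "i' \<in> upstream n l j i" for l i'
      proof -
        have i'r: "i' \<in> rows n" and hop: "hop n l (j - 1) i' = i"
          using i' by (auto simp: upstream_def)
        have jm: "j - 1 \<in> {1..n - 1}" "Suc (j - 1) = j" using j \<omega>(2) by auto
        have "node_diff n w c l (j - 1) i' t \<omega> < 0"
          using False up(2)[OF j i'r, of l t] hop jm by (simp add: node_diff_def)
        then show ?thesis
          using backpressureD(2,3)[OF choose_node_rate[OF \<omega>(1) jm(1) i'r, of l t]] by (cases c) auto
      qed
      then show ?thesis using j by (auto simp: alloc_def intro!: sum.neutral)
    qed
    then show ?thesis using grouped_queue_step[OF \<omega>, of c t] Suc by linarith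
  qed
qed

text \<open>Bounds every single queue in column \<open>j\<close>, column 0 being the servers. The 2
  inside the bracket is the largest inflow of one slot; the factor 2 passes from the average
  \<open>grouped_queue\<close> to one of its two queues.\<close>

primrec col_bound :: "nat \<Rightarrow> real" where
  "col_bound 0 = src_bound"
| "col_bound (Suc j) = 2 * (col_bound j + 2)"

lemma col_bound_mono: "0 \<le> col_bound j \<and> col_bound j \<le> col_bound (j + k)"
proof -
  have nn: "0 \<le> col_bound j" for j
    using adm_bound_nonneg Amax_nonneg by (induction j) (auto simp: src_bound_def)
  have "col_bound j \<le> col_bound (j + k)"
  proof (induction k)
    case (Suc k)
    then show ?case using nn[of "j + k"] by simp
  qed simp
  then show ?thesis using nn by simp
qed

lemma grouped_queue_le_col_bound:
  assumes \<omega>: "\<omega> \<in> space M" and j: "j < n" and i: "i \<in> rows n"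
  shows "grouped_queue n w c (Suc j) i t \<omega> \<le> col_bound j + 2"
  using j i
proof (induction j arbitrary: i t)
  case 0
  show ?case
  proof (rule grouped_queue_le[OF \<omega> _ 0(2)])
    show "real (server_queue n w c s t \<omega>) \<le> col_bound 0" if "s \<in> servers n" for s t
      using server_queue_le[OF \<omega> that] by simp
  qed (use col_bound_mono[of 0 0] n_ge_2 in simp_all)
next
  case (Suc j)
  show ?case
  proof (rule grouped_queue_le[OF \<omega> _ Suc.prems(2)])
    show "real (node_queue n w c l (Suc (Suc j) - 1) i' t \<omega>) \<le> col_bound (Suc j)"
      if "i' \<in> rows n" for l i' t
      using Suc.IH[OF _ that, of t] Suc.prems(1) by (cases l) (simp_all add: grouped_queue_def)
  qed (use col_bound_mono[of "Suc j" 0] Suc.prems(1) in simp_all)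
qed

definition queue_bound :: real where
  "queue_bound = col_bound n"

lemma queue_bound_nonneg: "0 \<le> queue_bound"
  using col_bound_mono[of n 0] by (simp add: queue_bound_def)

lemma src_bound_le: "src_bound \<le> queue_bound"
  using col_bound_mono[of 0 n] by (simp add: queue_bound_def)

lemma grouped_queue_bound:
  assumes "\<omega> \<in> space M" "j \<in> {1..n}" "i \<in> rows n"
  shows "2 * grouped_queue n w c j i t \<omega> \<le> queue_bound"
proof -
  obtain k where k: "j = Suc k" "k < n" using assms(2) by (cases j) auto
  have "2 * grouped_queue n w c j i t \<omega> \<le> col_bound j"
    using grouped_queue_le_col_bound[OF assms(1) k(2) assms(3), of c t] k by simp
  also have "\<dots> \<le> queue_bound"
    using col_bound_mono[of j "n - j"] assms(2) by (simp add: queue_bound_def)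
  finally show ?thesis .
qed

lemma queues_bounded:
  assumes "\<omega> \<in> space M"
  shows "s \<in> servers n \<Longrightarrow> real (server_queue n w c s t \<omega>) \<le> queue_bound"
    "j \<in> {1..n - 1} \<Longrightarrow> i \<in> rows n \<Longrightarrow> real (node_queue n w c l j i t \<omega>) \<le> queue_bound"
    "i \<in> rows n \<Longrightarrow> dest_queue w c i t \<omega> \<le> queue_bound"
    "s \<in> servers n \<Longrightarrow> d \<in> servers n \<Longrightarrow> adm_queue w s d t \<omega> \<le> queue_bound"
    "d \<in> servers n \<Longrightarrow> reg_queue w d t \<omega> \<le> queue_bound"
proof -
  have ab: "adm_bound \<le> src_bound" using Amax_nonneg by (simp add: src_bound_def)
  show "real (server_queue n w c s t \<omega>) \<le> queue_bound" if "s \<in> servers n"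
    using server_queue_le[OF assms that, of c t] src_bound_le by linarith
  show "real (node_queue n w c l j i t \<omega>) \<le> queue_bound" if "j \<in> {1..n - 1}" "i \<in> rows n"
  proof -
    have "j \<in> {1..n}" "j < n" using that(1) by auto
    then show ?thesis using grouped_queue_bound[OF assms _ that(2), of j c t]
      by (cases l) (auto simp: grouped_queue_def)
  qed
  show "dest_queue w c i t \<omega> \<le> queue_bound" if "i \<in> rows n"
    using grouped_queue_bound[OF assms _ that, of n c t] n_ge_2 dest_queue_nonneg[OF assms that, of c t]
    by (simp add: grouped_queue_def)
  show "adm_queue w s d t \<omega> \<le> queue_bound" if "s \<in> servers n" "d \<in> servers n"
    using adm_queue_le[OF assms that, of t] ab src_bound_le by linarith
  show "reg_queue w d t \<omega> \<le> queue_bound" if "d \<in> servers n"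
    using reg_queue_le[OF assms that, of t] src_bound_le by linarith
qed

lemma fictitious_stable: "fictitious_stable M n w"
  unfolding fictitious_stable_def
  by (intro conjI allI ballI stable_bounded_pointwise[where C = queue_bound] queues_bounded)

end

section \<open>Randomness of the splitting and of the arrivals\<close>

lemma abs_mult_le:
  fixes a b :: real
  assumes "\<bar>a\<bar> \<le> B" "\<bar>b\<bar> \<le> C"
  shows "\<bar>a * b\<bar> \<le> B * C"
  unfolding abs_mult using assms abs_ge_zero[of a] by (intro mult_mono) linarith+

lemma (in prob_space) indep_set_mono:
  assumes "indep_set X Y" "X' \<subseteq> X" "Y' \<subseteq> Y"
  shows "indep_set X' Y'"
  unfolding indep_set_def
  by (rule indep_sets_mono_sets[OF assms(1)[unfolded indep_set_def]])
    (use assms(2,3) in \<open>auto split: bool.splits\<close>)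

text \<open>Independence is given between sigma-algebras stored as measures; the sigma-algebras
  generated by \<open>f\<close> and \<open>g\<close> lie inside them, which reduces the claim to
  independent random variables.\<close>

lemma (in prob_space) indep_set_expectation_mult:
  fixes f g :: "'a \<Rightarrow> real"
  assumes indep: "indep_set (sets N) (sets K)"
    and N: "subalgebra M N" and K: "subalgebra M K"
    and f: "f \<in> borel_measurable N" "integrable M f"
    and g: "g \<in> borel_measurable K" "integrable M g"
  shows "expectation (\<lambda>\<omega>. f \<omega> * g \<omega>) = expectation f * expectation g"
proof -
  have sub: "sigma_sets (space M) {h -` B \<inter> space M | B. B \<in> sets borel} \<subseteq> sets L"
    if "subalgebra M L" "h \<in> borel_measurable L" for h :: "'a \<Rightarrow> real" and L
  proof -
    have sp: "space L = space M" using that(1) by (simp add: subalgebra_def)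
    have "{h -` B \<inter> space M | B. B \<in> sets borel} \<subseteq> sets L"
      using measurable_sets[OF that(2)] sp by auto
    from sets.sigma_sets_subset[OF this] show ?thesis using sp by simp
  qed
  have "indep_var borel f borel g"
    unfolding indep_var_eq
    using indep_set_mono[OF indep sub[OF N f(1)] sub[OF K g(1)]] f(2) g(2) by auto
  then show ?thesis by (rule indep_var_lebesgue_integral[OF _ f(2) g(2)])
qed

section \<open>Filtrations and centred increments\<close>

context grouped_backpressure
begin

lemma measurable_F_imp_M: "f \<in> measurable (F t) K \<Longrightarrow> f \<in> measurable M K"
  by (rule measurable_from_subalg[OF history(1)])

lemma measurable_G_imp_M: "f \<in> measurable (G t) K \<Longrightarrow> f \<in> measurable M K"
  by (rule measurable_from_subalg[OF history(2)])

lemma measurable_F_imp_G: "f \<in> measurable (F t) K \<Longrightarrow> f \<in> measurable (G t) K"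
  by (rule measurable_from_subalg[OF history(3)])

lemma measurable_G_imp_F: "f \<in> measurable (G t) K \<Longrightarrow> f \<in> measurable (F (Suc t)) K"
  by (rule measurable_from_subalg[OF history(4)])

lemma measurable_F_mono: "t \<le> t' \<Longrightarrow> f \<in> measurable (F t) K \<Longrightarrow> f \<in> measurable (F t') K"
  by (induction rule: dec_induct) (auto intro: measurable_F_imp_G measurable_G_imp_F)

text \<open>A weight fixed before slot \<open>t\<close> is uncorrelated with the arrivals of that
  slot, so they may be replaced by their mean. What enters is the independence of this one flow from
  the history, so flows of the same slot may be correlated.\<close>

lemma expectation_fresh_arrival:
  assumes sd: "s \<in> servers n" "d \<in> servers n" and f: "f \<in> borel_measurable (F t)"
    and bounded: "\<And>\<omega>. \<omega> \<in> space M \<Longrightarrow> \<bar>f \<omega>\<bar> \<le> C"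
  shows "expectation (\<lambda>\<omega>. f \<omega> * (real (A s d t \<omega>) - mean_arrival s d)) = 0"
proof -
  let ?K = "vimage_algebra (space M) (A s d t) (count_space UNIV)"
  have AM: "A s d t \<in> measurable M (count_space UNIV)" by (rule arrivals_measurable[OF sd])
  have K: "subalgebra M ?K"
    using AM unfolding subalgebra_def by (auto simp: sets_vimage_algebra2 intro: measurable_sets)
  have AK: "A s d t \<in> measurable ?K (count_space UNIV)"
    by (intro measurable_vimage_algebra1) auto
  have g: "(\<lambda>\<omega>. real (A s d t \<omega>)) \<in> borel_measurable ?K"
    by (rule measurable_compose[OF AK]) auto
  have iA: "integrable M (\<lambda>\<omega>. real (A s d t \<omega>))"
    using arrivals_bounded[OF sd] measurable_from_subalg[OF K g]
    by (intro integrable_bounded[of _ Amax]) auto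
  have int_f: "integrable M f"
    using bounded measurable_F_imp_M[OF f] by (intro integrable_bounded[of _ C]) auto
  have ifA: "integrable M (\<lambda>\<omega>. f \<omega> * real (A s d t \<omega>))"
  proof (rule integrable_bounded[of _ "C * Amax"])
    show "(\<lambda>\<omega>. f \<omega> * real (A s d t \<omega>)) \<in> borel_measurable M"
      using measurable_F_imp_M[OF f] measurable_from_subalg[OF K g] by auto
    show "\<bar>f \<omega> * real (A s d t \<omega>)\<bar> \<le> C * Amax" if "\<omega> \<in> space M" for \<omega>
      using bounded[OF that] arrivals_bounded[OF sd that, of t]
      by (intro abs_mult_le) auto
  qed
  have "expectation (\<lambda>\<omega>. f \<omega> * real (A s d t \<omega>)) = expectation f * mean_arrival s d"
    using indep_set_expectation_mult[OF arrivals_fresh[OF sd] history(1) K f int_f g iA]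
    by (simp add: expectation_arrivals[OF sd])
  then show ?thesis
    using int_f ifA by (simp add: right_diff_distrib)
qed

text \<open>
  The random splitting contributes conditionally centred increments.  It suffices to know that these
  are orthogonal to all bounded functions of the history and the decisions of the slot.
\<close>

definition noise :: "real \<Rightarrow> nat \<Rightarrow> ('w \<Rightarrow> real) \<Rightarrow> bool" where
  "noise C t D \<longleftrightarrow> D \<in> borel_measurable (F (Suc t)) \<and> (\<forall>\<omega>\<in>space M. \<bar>D \<omega>\<bar> \<le> C) \<and>
     (\<forall>Y B. Y \<in> borel_measurable (G t) \<longrightarrow> (\<forall>\<omega>\<in>space M. \<bar>Y \<omega>\<bar> \<le> B) \<longrightarrow>
        expectation (\<lambda>\<omega>. Y \<omega> * D \<omega>) = 0)"

lemma noiseD: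
  assumes "noise C t D"
  shows "D \<in> borel_measurable (F (Suc t))" "D \<in> borel_measurable M"
    "\<And>\<omega>. \<omega> \<in> space M \<Longrightarrow> \<bar>D \<omega>\<bar> \<le> C"
    "\<And>Y B. Y \<in> borel_measurable (G t) \<Longrightarrow> (\<And>\<omega>. \<omega> \<in> space M \<Longrightarrow> \<bar>Y \<omega>\<bar> \<le> B) \<Longrightarrow>
        expectation (\<lambda>\<omega>. Y \<omega> * D \<omega>) = 0"
  using assms measurable_F_imp_M unfolding noise_def by blast+

lemma noise_expectation: "noise C t D \<Longrightarrow> expectation D = 0"
  using noiseD(4)[of C t D "\<lambda>_. 1" 1] by simp

lemma noise_mono: "noise C t D \<Longrightarrow> C \<le> C' \<Longrightarrow> noise C' t D"
  unfolding noise_def by (auto intro: order_trans)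

lemma noise_bound_nonneg: "noise C t D \<Longrightarrow> 0 \<le> C"
proof -
  assume D: "noise C t D"
  obtain \<omega> where "\<omega> \<in> space M" using not_empty by auto
  then show "0 \<le> C" using noiseD(3)[OF D] abs_ge_zero order_trans by blast
qed

lemma noise_zero: "noise 0 t (\<lambda>_. 0)"
  unfolding noise_def by auto

lemma integrable_mult_bounded:
  fixes Y D :: "'w \<Rightarrow> real"
  assumes "Y \<in> borel_measurable M" "D \<in> borel_measurable M"
    and "\<And>\<omega>. \<omega> \<in> space M \<Longrightarrow> \<bar>Y \<omega>\<bar> \<le> B" "\<And>\<omega>. \<omega> \<in> space M \<Longrightarrow> \<bar>D \<omega>\<bar> \<le> C"
  shows "integrable M (\<lambda>\<omega>. Y \<omega> * D \<omega>)"
proof (rule integrable_bounded[of _ "B * C"])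
  show "\<bar>Y \<omega> * D \<omega>\<bar> \<le> B * C" if "\<omega> \<in> space M" for \<omega>
    using assms(3,4)[OF that] by (auto simp: abs_mult intro!: mult_mono order_trans[OF abs_ge_zero])
qed (use assms in auto)

lemma noise_add:
  assumes "noise C t D" "noise C' t D'"
  shows "noise (C + C') t (\<lambda>\<omega>. D \<omega> + D' \<omega>)"
  unfolding noise_def
proof (intro conjI allI impI ballI)
  show "(\<lambda>\<omega>. D \<omega> + D' \<omega>) \<in> borel_measurable (F (Suc t))"
    using noiseD(1)[OF assms(1)] noiseD(1)[OF assms(2)] by simp
  show "\<bar>D \<omega> + D' \<omega>\<bar> \<le> C + C'" if "\<omega> \<in> space M" for \<omega>
    using noiseD(3)[OF assms(1) that] noiseD(3)[OF assms(2) that] by linarith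
  fix Y :: "'w \<Rightarrow> real" and B :: real assume Y: "Y \<in> borel_measurable (G t)" "\<forall>\<omega>\<in>space M. \<bar>Y \<omega>\<bar> \<le> B"
  have "integrable M (\<lambda>\<omega>. Y \<omega> * D \<omega>)" "integrable M (\<lambda>\<omega>. Y \<omega> * D' \<omega>)"
    using Y measurable_G_imp_M[OF Y(1)] noiseD(2,3)[OF assms(1)] noiseD(2,3)[OF assms(2)]
    by (auto intro: integrable_mult_bounded)
  then show "expectation (\<lambda>\<omega>. Y \<omega> * (D \<omega> + D' \<omega>)) = 0"
    using noiseD(4)[OF assms(1) Y(1), of B] noiseD(4)[OF assms(2) Y(1), of B] Y(2)
    by (simp add: distrib_left)
qed

lemma noise_sum:
  assumes "finite I" "\<And>x. x \<in> I \<Longrightarrow> noise C t (D x)"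
  shows "noise (real (card I) * C) t (\<lambda>\<omega>. \<Sum>x\<in>I. D x \<omega>)"
  using assms
proof (induction I rule: finite_induct)
  case empty
  then show ?case using noise_zero by simp
next
  case (insert x I)
  then show ?case
    using noise_add[of C t "D x" "real (card I) * C" "\<lambda>\<omega>. \<Sum>x\<in>I. D x \<omega>"] by (simp add: algebra_simps)
qed

text \<open>The factor may depend on the decisions of the slot itself, because it can be absorbed
  into the test function \<open>Y\<close>. So packet counts of slot \<open>t\<close> may multiply
  the coins of slot \<open>t\<close>.\<close>

lemma noise_mult:
  assumes b: "b \<in> borel_measurable (G t)" "\<And>\<omega>. \<omega> \<in> space M \<Longrightarrow> \<bar>b \<omega>\<bar> \<le> B" and D: "noise C t D"
  shows "noise (B * C) t (\<lambda>\<omega>. b \<omega> * D \<omega>)"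
  unfolding noise_def
proof (intro conjI allI impI ballI)
  show "(\<lambda>\<omega>. b \<omega> * D \<omega>) \<in> borel_measurable (F (Suc t))"
    using measurable_G_imp_F[OF b(1)] noiseD(1)[OF D] by simp
  show "\<bar>b \<omega> * D \<omega>\<bar> \<le> B * C" if "\<omega> \<in> space M" for \<omega>
    using b(2)[OF that] noiseD(3)[OF D that]
    by (intro abs_mult_le) auto
  fix Y :: "'w \<Rightarrow> real" and B' :: real assume Y: "Y \<in> borel_measurable (G t)" "\<forall>\<omega>\<in>space M. \<bar>Y \<omega>\<bar> \<le> B'"
  have "expectation (\<lambda>\<omega>. (Y \<omega> * b \<omega>) * D \<omega>) = 0"
  proof (rule noiseD(4)[OF D])
    show "(\<lambda>\<omega>. Y \<omega> * b \<omega>) \<in> borel_measurable (G t)" using Y b by simp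
    show "\<bar>Y \<omega> * b \<omega>\<bar> \<le> B' * B" if "\<omega> \<in> space M" for \<omega>
      using b(2)[OF that] Y(2) that
      by (intro abs_mult_le) auto
  qed
  then show "expectation (\<lambda>\<omega>. Y \<omega> * (b \<omega> * D \<omega>)) = 0" by (simp add: mult.assoc)
qed

lemma noise_cmult: "noise C t D \<Longrightarrow> noise (\<bar>a\<bar> * C) t (\<lambda>\<omega>. a * D \<omega>)"
  by (rule noise_mult) auto

text \<open>The centred indicator of the event that the coin selects link \<open>l\<close>.\<close>

definition turn :: "side \<Rightarrow> side \<Rightarrow> nat \<Rightarrow> nat \<Rightarrow> nat \<Rightarrow> 'w \<Rightarrow> real" where
  "turn c l j i t \<omega> = (if coin w c j i t \<omega> \<longleftrightarrow> l = Up then 1 / 2 else - 1 / 2)"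

text \<open>Freshness is assumed for the vector of all coins of a slot, so \<open>turn\<close> is
  first recognised as a function of one coordinate. Its mean vanishes by fairness, and independence
  transfers this to every test function.\<close>

lemma noise_turn:
  assumes ji: "j \<in> {1..n - 1}" "i \<in> rows n"
  shows "noise (1 / 2) t (turn c l j i t)"
proof -
  have ix: "(c, j, i) \<in> coin_index n" using ji by (cases c) (auto simp: coin_index_def)
  let ?N = "PiM (coin_index n) (\<lambda>_. count_space (UNIV :: bool set))"
  let ?K = "vimage_algebra (space M) (coin_vector n w t) ?N"
  have comp: "turn c l j i t \<in> borel_measurable N" if "coin w c j i t \<in> measurable N (count_space UNIV)" for N
  proof -
    have "(\<lambda>\<omega>. (\<lambda>b. if b \<longleftrightarrow> l = Up then 1 / 2 else - 1 / 2 :: real) (coin w c j i t \<omega>)) \<in> borel_measurable N"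
      by (rule measurable_compose[OF that]) simp
    then show ?thesis by (simp add: turn_def[abs_def])
  qed
  have vec: "coin_vector n w t \<in> measurable ?K ?N"
    by (intro measurable_vimage_algebra1) (auto simp: space_PiM coin_vector_def)
  have "coin w c j i t \<in> measurable ?K (count_space UNIV)"
  proof -
    have "(\<lambda>\<omega>. coin_vector n w t \<omega> (c, j, i)) \<in> measurable ?K (count_space UNIV)"
      by (rule measurable_compose[OF vec measurable_component_singleton[OF ix]])
    then show ?thesis using ix by (simp add: coin_vector_def)
  qed
  then have tK: "turn c l j i t \<in> borel_measurable ?K" by (rule comp)
  have coinF: "coin w c j i t \<in> measurable (F (Suc t)) (count_space UNIV)"
    by (rule coins_adapted[OF ix])
  then have tF: "turn c l j i t \<in> borel_measurable (F (Suc t))" by (rule comp)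
  have coinM: "coin w c j i t \<in> measurable M (count_space UNIV)"
    by (rule measurable_F_imp_M[OF coinF])
  have cvM: "coin_vector n w t \<in> measurable M ?N"
    unfolding coin_vector_def
  proof (rule measurable_restrict)
    fix x assume x: "x \<in> coin_index n"
    obtain c j i where [simp]: "x = (c, j, i)" by (cases x)
    have "coin w c j i t \<in> measurable M (count_space UNIV)"
      using x by (intro measurable_F_imp_M[OF coins_adapted]) simp
    then show "(\<lambda>\<omega>. case x of (c, j, i) \<Rightarrow> coin w c j i t \<omega>) \<in> measurable M (count_space UNIV)"
      by simp
  qed
  have K: "subalgebra M ?K"
    using cvM measurable_space[OF cvM] unfolding subalgebra_def
    by (auto simp: sets_vimage_algebra2 intro: measurable_sets)
  have tM: "turn c l j i t \<in> borel_measurable M" by (rule measurable_F_imp_M[OF tF])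
  have bt: "\<bar>turn c l j i t \<omega>\<bar> \<le> 1 / 2" for \<omega> by (simp add: turn_def)
  have it: "integrable M (turn c l j i t)" using tM bt by (rule integrable_bounded)
  define E where "E = {\<omega> \<in> space M. coin w c j i t \<omega>}"
  have "E = coin w c j i t -` {True} \<inter> space M" by (auto simp: E_def)
  then have E: "E \<in> events" using measurable_sets[OF coinM, of "{True}"] by simp
  have "expectation (\<lambda>\<omega>. indicator E \<omega> - 1 / 2 :: real) = prob E - 1 / 2"
    using E emeasure_finite[of E]
    by (subst Bochner_Integration.integral_diff)
      (simp_all add: prob_space integrable_real_indicator less_top[symmetric])
  then have e0: "expectation (\<lambda>\<omega>. indicator E \<omega> - 1 / 2 :: real) = 0"
    using coins_fair[OF ix, of t] by (simp add: E_def)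
  have "expectation (turn c l j i t) =
      expectation (\<lambda>\<omega>. (if l = Up then 1 else - 1) * (indicator E \<omega> - 1 / 2))"
    by (rule Bochner_Integration.integral_cong[OF refl]) (auto simp: turn_def indicator_def E_def)
  then have et: "expectation (turn c l j i t) = 0" using e0 by simp
  show ?thesis
    unfolding noise_def
  proof (intro conjI allI impI ballI)
    show "turn c l j i t \<in> borel_measurable (F (Suc t))" by (rule tF)
    show "\<bar>turn c l j i t \<omega>\<bar> \<le> 1 / 2" for \<omega> by (rule bt)
    fix Y :: "'w \<Rightarrow> real" and B :: real assume Y: "Y \<in> borel_measurable (G t)" "\<forall>\<omega>\<in>space M. \<bar>Y \<omega>\<bar> \<le> B"
    have "integrable M Y"
      using measurable_G_imp_M[OF Y(1)] Y(2) by (intro integrable_bounded[of _ B]) auto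
    then show "expectation (\<lambda>\<omega>. Y \<omega> * turn c l j i t \<omega>) = 0"
      using indep_set_expectation_mult[OF coins_fresh history(2) K Y(1) _ tK it] et by simp
  qed
qed

section \<open>Measurability of queues and decisions\<close>

lemma measurable_server_queue: "s \<in> servers n \<Longrightarrow>
    (\<lambda>\<omega>. real (server_queue n w c s t \<omega>)) \<in> borel_measurable (F t)"
  unfolding server_queue_def of_nat_sum
  by (intro borel_measurable_sum measurable_compose[OF packets_adapted(1)]) auto

lemma measurable_node_queue: "j \<in> {1..n - 1} \<Longrightarrow> i \<in> rows n \<Longrightarrow>
    (\<lambda>\<omega>. real (node_queue n w c l j i t \<omega>)) \<in> borel_measurable (F t)"
  unfolding node_queue_def of_nat_sum
  by (intro borel_measurable_sum measurable_compose[OF packets_adapted(2)]) auto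

lemma measurable_admitted: "s \<in> servers n \<Longrightarrow> d \<in> servers n \<Longrightarrow>
    (\<lambda>\<omega>. real (admitted w s d t \<omega>)) \<in> borel_measurable (G t)"
  by (rule measurable_compose[OF decisions_adapted(2)]) auto

lemma measurable_pkts_in:
  assumes "j \<in> {1..n}" "i \<in> rows n" "d \<in> servers n"
  shows "(\<lambda>\<omega>. real (pkts_in n w c j i d t \<omega>)) \<in> borel_measurable (G t)"
proof (cases "j = 1")
  case True
  have "(\<lambda>\<omega>. \<Sum>s\<in>{s \<in> servers n. row_of s = i}. real (server_sent w c s d t \<omega>)) \<in> borel_measurable (G t)"
    using assms by (intro borel_measurable_sum measurable_compose[OF decisions_adapted(4)]) auto
  then show ?thesis using True by (simp add: pkts_in_def)
next
  case False
  have "(\<lambda>\<omega>. \<Sum>l\<in>{Up, Lo}. \<Sum>i'\<in>upstream n l j i. real (node_sent w c l (j - 1) i' d t \<omega>)) \<in>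
      borel_measurable (G t)"
  proof (intro borel_measurable_sum)
    fix l i' assume "i' \<in> upstream n l j i"
    then have "i' \<in> rows n" by (simp add: upstream_def)
    moreover have "j - 1 \<in> {1..n - 1}" using False assms(1) by auto
    ultimately show "(\<lambda>\<omega>. real (node_sent w c l (j - 1) i' d t \<omega>)) \<in> borel_measurable (G t)"
      using assms(3) by (intro measurable_compose[OF decisions_adapted(6)]) auto
  qed
  then show ?thesis using False by (simp add: pkts_in_def)
qed

end

lemma (in empty_benes_run) measurable_alloc:
  assumes "j \<in> {1..n}" "i \<in> rows n"
  shows "alloc c j i t \<in> borel_measurable (G t)"
proof (cases "j = 1")
  case True
  have "(\<lambda>\<omega>. \<Sum>s\<in>{s \<in> servers n. row_of s = i}. real (server_rate w c s t \<omega>)) \<in> borel_measurable (G t)"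
    by (intro borel_measurable_sum measurable_compose[OF decisions_adapted(3)]) auto
  then show ?thesis using True by (simp add: alloc_def[abs_def])
next
  case False
  have "(\<lambda>\<omega>. \<Sum>l\<in>{Up, Lo}. \<Sum>i'\<in>upstream n l j i. real (node_rate w c l (j - 1) i' t \<omega>)) \<in>
      borel_measurable (G t)"
  proof (intro borel_measurable_sum)
    fix l i' assume "i' \<in> upstream n l j i"
    then have "i' \<in> rows n" by (simp add: upstream_def)
    moreover have "j - 1 \<in> {1..n - 1}" using False assms(1) by auto
    ultimately show "(\<lambda>\<omega>. real (node_rate w c l (j - 1) i' t \<omega>)) \<in> borel_measurable (G t)"
      by (intro measurable_compose[OF decisions_adapted(5)]) auto
  qed
  then show ?thesis using False by (simp add: alloc_def[abs_def])
qed

section \<open>Optimality of backpressure\<close>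

context empty_benes_run
begin

abbreviation "squeue c s t \<omega> \<equiv> real (server_queue n w c s t \<omega>)"
abbreviation "nqueue c l j i t \<omega> \<equiv> real (node_queue n w c l j i t \<omega>)"
abbreviation "srate c s t \<omega> \<equiv> real (server_rate w c s t \<omega>)"
abbreviation "nrate c l j i t \<omega> \<equiv> real (node_rate w c l j i t \<omega>)"

lemma sum_servers_by_row:
  fixes f :: "nat \<Rightarrow> 'b :: comm_monoid_add"
  shows "(\<Sum>i\<in>rows n. \<Sum>s\<in>{s \<in> servers n. row_of s = i}. f s) = (\<Sum>s\<in>servers n. f s)"
  using row_of_in_rows[of n] n_ge_2 by (intro sum.group) auto

text \<open>The two fictitious links of a partition node have separate capacities, so serving both
  at once is feasible and bounds the optimum from below.\<close>

lemma dest_rate_max: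
  assumes "\<omega> \<in> space M" "i \<in> rows n"
  shows "real (dest_rate w c i t \<omega>) \<le> 1"
    "(\<Sum>c\<in>{Up, Lo}. dest_queue w c i t \<omega>) \<le> (\<Sum>c\<in>{Up, Lo}. dest_queue w c i t \<omega> * real (dest_rate w c i t \<omega>))"
proof -
  let ?f = "\<lambda>p. case p of (x :: nat, y :: nat) \<Rightarrow> dest_queue w Up i t \<omega> * real x + dest_queue w Lo i t \<omega> * real y"
  let ?P = "\<lambda>(x :: nat, y :: nat). x \<in> {0, 1} \<and> y \<in> {0, 1}"
  have *: "?P (dest_rate w Up i t \<omega>, dest_rate w Lo i t \<omega>)"
    "\<And>p. ?P p \<Longrightarrow> ?f p \<le> ?f (dest_rate w Up i t \<omega>, dest_rate w Lo i t \<omega>)"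
    using choose_dest_rate[OF assms, of t] unfolding is_arg_max_def by (auto simp: not_less)
  show "real (dest_rate w c i t \<omega>) \<le> 1" using *(1) by (cases c) auto
  show "(\<Sum>c\<in>{Up, Lo}. dest_queue w c i t \<omega>) \<le> (\<Sum>c\<in>{Up, Lo}. dest_queue w c i t \<omega> * real (dest_rate w c i t \<omega>))"
    using *(2)[of "(1, 1)"] by simp
qed

text \<open>
  The competing rates split every flow evenly at each module.  They balance at all modules, so only the
  queues of the input servers remain, and they load each fictitious link by at most 1 because every
  partition node receives the same share of each flow.
\<close>

lemma backpressure_optimal:
  assumes \<omega>: "\<omega> \<in> space M"
    and x: "\<And>c s. s \<in> servers n \<Longrightarrow> 0 \<le> x c s" "\<And>s. s \<in> servers n \<Longrightarrow> x Up s + x Lo s \<le> 1"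
      "\<And>c. (\<Sum>s\<in>servers n. x c s) \<le> 2 ^ (n - 1)"
  shows "(\<Sum>s\<in>servers n. \<Sum>c\<in>{Up, Lo}. x c s * squeue c s t \<omega>) \<le>
    (\<Sum>s\<in>servers n. \<Sum>c\<in>{Up, Lo}. srate c s t \<omega> * squeue c s t \<omega>) +
    (\<Sum>j\<in>{1..n - 1}. \<Sum>i\<in>rows n. \<Sum>c\<in>{Up, Lo}. \<Sum>l\<in>{Up, Lo}.
       nrate c l j i t \<omega> * nqueue c l j i t \<omega> - alloc c j i t \<omega> * nqueue c l j i t \<omega> / 2) +
    (\<Sum>i\<in>rows n. \<Sum>c\<in>{Up, Lo}.
       dest_queue w c i t \<omega> * (real (dest_rate w c i t \<omega>) - alloc c n i t \<omega>))"
proof -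
  define R where "R i = {s \<in> servers n. row_of s = i}" for i
  define g where "g c j i = grouped_queue n w c j i t \<omega>" for c j i
  define a where "a c j i = alloc c j i t \<omega>" for c j i
  \<comment> \<open>The competing inflow of division \<open>c\<close>: the rates of the servers
    summed over all paths, halved once at each of the \<open>j - 1\<close> modules passed.\<close>
  define y where "y c j i = path_sum n (\<lambda>i. \<Sum>s\<in>R i. x c s) (j - 1) i / 2 ^ (j - 1)" for c j i
  \<comment> \<open>\<open>\<Phi>\<close> and \<open>\<Psi>\<close> weight the competing and the
    actual inflow of a column with its grouped queues; these are the terms that telescope.\<close>
  define \<Phi> where "\<Phi> j = (\<Sum>i\<in>rows n. \<Sum>c\<in>{Up, Lo}. y c j i * g c j i)" for j
  define \<Psi> where "\<Psi> j = (\<Sum>i\<in>rows n. \<Sum>c\<in>{Up, Lo}. a c j i * g c j i)" for j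
  define N where "N j = (\<Sum>i\<in>rows n. \<Sum>l\<in>{Up, Lo}. \<Sum>c\<in>{Up, Lo}. nrate c l j i t \<omega> * nqueue c l j i t \<omega>)" for j
  have y1: "y c 1 i = (\<Sum>s\<in>R i. x c s)" for c i by (simp add: y_def)
  have y_Suc: "y c (Suc j) i = (\<Sum>l\<in>{Up, Lo}. \<Sum>i'\<in>upstream n l (Suc j) i. y c j i' / 2)" if "1 \<le> j" for c j i
    using that by (cases j) (simp_all add: y_def sum_divide_distrib add_divide_distrib mult.commute)
  have R_servers: "s \<in> servers n" if "s \<in> R i" for s i using that by (simp add: R_def)
  have y_nonneg: "0 \<le> y c j i" if "1 \<le> j" for c j i
    using that
  proof (induction j arbitrary: i rule: nat_induct_at_least)
    case base
    show ?case unfolding y1 using x(1) R_servers by (intro sum_nonneg) blast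
  next
    case (Suc j)
    then show ?case unfolding y_Suc[OF Suc.hyps] by (intro sum_nonneg) simp
  qed
  \<comment> \<open>Half of this inflow goes to each outgoing link, so the even split respects the
    link capacity 1 and is an admissible competitor in \<open>backpressureD\<close>.\<close>
  have y_le: "y Up j i + y Lo j i \<le> 2" if "1 \<le> j" "j \<le> n" "i \<in> rows n" for j i
    using that
  proof (induction j arbitrary: i rule: nat_induct_at_least)
    case base
    have "y Up 1 i + y Lo 1 i = (\<Sum>s\<in>R i. x Up s + x Lo s)" by (simp only: y1 sum.distrib)
    also have "\<dots> \<le> (\<Sum>s\<in>R i. 1)" using x(2) R_servers by (intro sum_mono) blast
    also have "\<dots> \<le> 2" using card_servers_of_row_le[OF base(2)] by (simp add: R_def)
    finally show ?case .
  next
    case (Suc j)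
    have "y Up (Suc j) i + y Lo (Suc j) i =
        (\<Sum>l\<in>{Up, Lo}. \<Sum>i'\<in>upstream n l (Suc j) i. (y Up j i' + y Lo j i') / 2)"
      unfolding y_Suc[OF Suc.hyps] by (simp add: sum.distrib add_divide_distrib)
    also have "\<dots> \<le> 2 * 1"
    proof (intro sum_upstream_le)
      fix l i' assume "i' \<in> upstream n l (Suc j) i"
      then have "i' \<in> rows n" by (simp add: upstream_def)
      then show "(y Up j i' + y Lo j i') / 2 \<le> 1" using Suc.IH[of i'] Suc.prems by simp
    qed (use Suc in auto)
    finally show ?case by simp
  qed
  have y_n: "y c n i \<le> 1" if "i \<in> rows n" for c i
  proof -
    have "path_sum n (\<lambda>i. \<Sum>s\<in>R i. x c s) (n - 1) i = (\<Sum>i\<in>rows n. \<Sum>s\<in>R i. x c s)"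
      using path_sum_partition[of i "n - 1" "\<lambda>i. \<Sum>s\<in>R i. x c s"] that n_ge_2 by simp
    also have "\<dots> = (\<Sum>s\<in>servers n. x c s)" unfolding R_def by (rule sum_servers_by_row)
    also have "\<dots> \<le> 2 ^ (n - 1)" by (rule x(3))
    finally show ?thesis by (simp add: y_def)
  qed
  have by_row: "(\<Sum>s\<in>servers n. \<Sum>c\<in>{Up, Lo}. f c s * g c 1 (row_of s)) =
      (\<Sum>i\<in>rows n. \<Sum>c\<in>{Up, Lo}. (\<Sum>s\<in>R i. f c s) * g c 1 i)" for f
  proof -
    have "(\<Sum>s\<in>servers n. \<Sum>c\<in>{Up, Lo}. f c s * g c 1 (row_of s)) =
        (\<Sum>i\<in>rows n. \<Sum>s\<in>R i. \<Sum>c\<in>{Up, Lo}. f c s * g c 1 (row_of s))"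
      unfolding R_def by (rule sum_servers_by_row[symmetric])
    also have "\<dots> = (\<Sum>i\<in>rows n. \<Sum>c\<in>{Up, Lo}. (\<Sum>s\<in>R i. f c s) * g c 1 i)"
    proof (intro sum.cong refl)
      fix i
      have "(\<Sum>s\<in>R i. \<Sum>c\<in>{Up, Lo}. f c s * g c 1 (row_of s)) = (\<Sum>s\<in>R i. \<Sum>c\<in>{Up, Lo}. f c s * g c 1 i)"
        by (intro sum.cong refl) (simp add: R_def)
      then show "(\<Sum>s\<in>R i. \<Sum>c\<in>{Up, Lo}. f c s * g c 1 (row_of s)) = (\<Sum>c\<in>{Up, Lo}. (\<Sum>s\<in>R i. f c s) * g c 1 i)"
        by (simp add: sum.distrib sum_distrib_right)
    qed
    finally show ?thesis .
  qed
  \<comment> \<open>Queue differences are indexed by the sending module; \<open>sum_upstream\<close>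
    regroups their subtracted part by the receiving module.\<close>
  have by_hop: "(\<Sum>i\<in>rows n. \<Sum>l\<in>{Up, Lo}. \<Sum>c\<in>{Up, Lo}. f c l i * g c (Suc j) (hop n l j i)) =
      (\<Sum>i\<in>rows n. \<Sum>c\<in>{Up, Lo}. (\<Sum>l\<in>{Up, Lo}. \<Sum>i'\<in>upstream n l (Suc j) i. f c l i') * g c (Suc j) i)"
    if "1 \<le> j" "j < n" for f j
  proof -
    have *: "(\<Sum>i\<in>rows n. \<Sum>i'\<in>upstream n l (Suc j) i. f c l i' * g c (Suc j) i) =
        (\<Sum>i\<in>rows n. f c l i * g c (Suc j) (hop n l j i))" for c l
      using that n_ge_2 by (intro sum_upstream) auto
    have "(\<Sum>i\<in>rows n. \<Sum>c\<in>{Up, Lo}. (\<Sum>l\<in>{Up, Lo}. \<Sum>i'\<in>upstream n l (Suc j) i. f c l i') * g c (Suc j) i) =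
        (\<Sum>c\<in>{Up, Lo}. \<Sum>l\<in>{Up, Lo}. \<Sum>i\<in>rows n. \<Sum>i'\<in>upstream n l (Suc j) i. f c l i' * g c (Suc j) i)"
      by (simp add: sum.distrib sum_distrib_right distrib_right)
    also have "\<dots> = (\<Sum>c\<in>{Up, Lo}. \<Sum>l\<in>{Up, Lo}. \<Sum>i\<in>rows n. f c l i * g c (Suc j) (hop n l j i))"
      by (simp only: *)
    finally show ?thesis by (simp add: sum.distrib)
  qed
  have g_mid: "g c j i = nqueue c Up j i t \<omega> / 2 + nqueue c Lo j i t \<omega> / 2" if "j < n" for c j i
    using that by (simp add: g_def grouped_queue_def)
  have g_n: "g c n i = dest_queue w c i t \<omega>" for c i
    by (simp add: g_def grouped_queue_def)
  have srv: "(\<Sum>s\<in>servers n. \<Sum>c\<in>{Up, Lo}. x c s * squeue c s t \<omega>) - \<Phi> 1 \<le>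
      (\<Sum>s\<in>servers n. \<Sum>c\<in>{Up, Lo}. srate c s t \<omega> * squeue c s t \<omega>) - \<Psi> 1"
  proof -
    have "(\<Sum>s\<in>servers n. \<Sum>c\<in>{Up, Lo}. x c s * (squeue c s t \<omega> - g c 1 (row_of s))) \<le>
        (\<Sum>s\<in>servers n. \<Sum>c\<in>{Up, Lo}. srate c s t \<omega> * (squeue c s t \<omega> - g c 1 (row_of s)))"
    proof (rule sum_mono)
      fix s assume s: "s \<in> servers n"
      show "(\<Sum>c\<in>{Up, Lo}. x c s * (squeue c s t \<omega> - g c 1 (row_of s))) \<le>
        (\<Sum>c\<in>{Up, Lo}. srate c s t \<omega> * (squeue c s t \<omega> - g c 1 (row_of s)))"
        using backpressureD(4)[OF choose_server_rate[OF \<omega> s, of t] x(1)[OF s] x(1)[OF s] x(2)[OF s]]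
        by (simp add: server_diff_def g_def)
    qed
    moreover have "(\<Sum>s\<in>servers n. \<Sum>c\<in>{Up, Lo}. x c s * g c 1 (row_of s)) = \<Phi> 1"
      unfolding by_row \<Phi>_def y1 ..
    moreover have "(\<Sum>s\<in>servers n. \<Sum>c\<in>{Up, Lo}. srate c s t \<omega> * g c 1 (row_of s)) = \<Psi> 1"
      unfolding by_row \<Psi>_def a_def alloc_def R_def by simp
    ultimately show ?thesis by (simp only: right_diff_distrib sum_subtractf)
  qed
  have col: "\<Phi> j - \<Phi> (Suc j) \<le> N j - \<Psi> (Suc j)" if j: "1 \<le> j" "j < n" for j
  proof -
    let ?h = "\<lambda>c l i. g c (Suc j) (hop n l j i)"
    have "(\<Sum>i\<in>rows n. \<Sum>l\<in>{Up, Lo}. \<Sum>c\<in>{Up, Lo}. y c j i / 2 * (nqueue c l j i t \<omega> - ?h c l i)) \<le>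
        (\<Sum>i\<in>rows n. \<Sum>l\<in>{Up, Lo}. \<Sum>c\<in>{Up, Lo}. nrate c l j i t \<omega> * (nqueue c l j i t \<omega> - ?h c l i))"
    proof (rule sum_mono, rule sum_mono)
      fix i l assume i: "i \<in> rows n"
      have j': "j \<in> {1..n - 1}" using j by auto
      show "(\<Sum>c\<in>{Up, Lo}. y c j i / 2 * (nqueue c l j i t \<omega> - ?h c l i)) \<le>
        (\<Sum>c\<in>{Up, Lo}. nrate c l j i t \<omega> * (nqueue c l j i t \<omega> - ?h c l i))"
        using backpressureD(4)[OF choose_node_rate[OF \<omega> j' i, of l t], of "y Up j i / 2" "y Lo j i / 2"]
          y_nonneg[OF j(1)] y_le[of j i] j i
        by (simp add: node_diff_def g_def)
    qed
    moreover have "(\<Sum>i\<in>rows n. \<Sum>l\<in>{Up, Lo}. \<Sum>c\<in>{Up, Lo}. y c j i / 2 * ?h c l i) = \<Phi> (Suc j)"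
      using by_hop[OF j, of "\<lambda>c l i. y c j i / 2"] unfolding \<Phi>_def y_Suc[OF j(1)] by simp
    moreover have "(\<Sum>i\<in>rows n. \<Sum>l\<in>{Up, Lo}. \<Sum>c\<in>{Up, Lo}. nrate c l j i t \<omega> * ?h c l i) = \<Psi> (Suc j)"
      using by_hop[OF j, of "\<lambda>c l i. nrate c l j i t \<omega>"] j unfolding \<Psi>_def a_def alloc_def by simp
    \<comment> \<open>The even split fits the definition of the grouped queue: half of
      \<open>y\<close> on each link, times the two queues, is \<open>y\<close> times their
      average.\<close>
    moreover have "(\<Sum>i\<in>rows n. \<Sum>l\<in>{Up, Lo}. \<Sum>c\<in>{Up, Lo}. y c j i / 2 * nqueue c l j i t \<omega>) = \<Phi> j"
      unfolding \<Phi>_def g_mid[OF j(2)] by (rule sum.cong[OF refl]) (simp add: algebra_simps add_divide_distrib)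
    ultimately show ?thesis unfolding N_def by (simp only: right_diff_distrib sum_subtractf)
  qed
  have tele: "\<Phi> 1 - \<Phi> (Suc k) + \<Psi> (Suc k) - \<Psi> 1 \<le> (\<Sum>j\<in>{1..k}. N j - \<Psi> j)" if "k < n" for k
    using that
  proof (induction k)
    case (Suc k)
    then show ?case using col[of "Suc k"] by simp
  qed simp
  have dest: "\<Phi> n \<le> (\<Sum>i\<in>rows n. \<Sum>c\<in>{Up, Lo}. dest_queue w c i t \<omega> * real (dest_rate w c i t \<omega>))"
    unfolding \<Phi>_def
  proof (rule sum_mono)
    fix i assume i: "i \<in> rows n"
    have "(\<Sum>c\<in>{Up, Lo}. y c n i * g c n i) \<le> (\<Sum>c\<in>{Up, Lo}. 1 * dest_queue w c i t \<omega>)"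
      unfolding g_n by (intro sum_mono mult_right_mono y_n[OF i] dest_queue_nonneg[OF \<omega> i])
    also have "\<dots> \<le> (\<Sum>c\<in>{Up, Lo}. dest_queue w c i t \<omega> * real (dest_rate w c i t \<omega>))"
      using dest_rate_max(2)[OF \<omega> i] by simp
    finally show "(\<Sum>c\<in>{Up, Lo}. y c n i * g c n i) \<le>
      (\<Sum>c\<in>{Up, Lo}. dest_queue w c i t \<omega> * real (dest_rate w c i t \<omega>))" .
  qed
  have "N j - \<Psi> j = (\<Sum>i\<in>rows n. \<Sum>c\<in>{Up, Lo}. \<Sum>l\<in>{Up, Lo}.
       nrate c l j i t \<omega> * nqueue c l j i t \<omega> - alloc c j i t \<omega> * nqueue c l j i t \<omega> / 2)" if "j < n" for j
    unfolding N_def \<Psi>_def g_mid[OF that] a_def sum_subtractf[symmetric]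
    by (rule sum.cong[OF refl]) (simp add: algebra_simps add_divide_distrib)
  then have nodes: "(\<Sum>j\<in>{1..n - 1}. N j - \<Psi> j) =
    (\<Sum>j\<in>{1..n - 1}. \<Sum>i\<in>rows n. \<Sum>c\<in>{Up, Lo}. \<Sum>l\<in>{Up, Lo}.
       nrate c l j i t \<omega> * nqueue c l j i t \<omega> - alloc c j i t \<omega> * nqueue c l j i t \<omega> / 2)"
    by (intro sum.cong refl) auto
  have dests: "(\<Sum>i\<in>rows n. \<Sum>c\<in>{Up, Lo}.
       dest_queue w c i t \<omega> * (real (dest_rate w c i t \<omega>) - alloc c n i t \<omega>)) =
    (\<Sum>i\<in>rows n. \<Sum>c\<in>{Up, Lo}. dest_queue w c i t \<omega> * real (dest_rate w c i t \<omega>)) - \<Psi> n"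
    unfolding \<Psi>_def a_def g_n sum_subtractf[symmetric]
    by (rule sum.cong[OF refl]) (simp add: algebra_simps add_divide_distrib)
  have "Suc (n - 1) = n" using n_ge_2 by simp
  then have "\<Phi> 1 - \<Phi> n + \<Psi> n - \<Psi> 1 \<le> (\<Sum>j\<in>{1..n - 1}. N j - \<Psi> j)"
    using tele[of "n - 1"] n_ge_2 by simp
  then show ?thesis using srv dest unfolding nodes dests by linarith
qed

end

section \<open>Lyapunov drift\<close>

text \<open>The standard drift inequality: dropping the service in the mixed term only enlarges it.
  The recursion is assumed as an inequality so that queues fed by fewer packets than allocated are
  included.\<close>

lemma queue_square_le:
  fixes Q Q' \<mu> r :: real
  assumes "0 \<le> Q" "0 \<le> \<mu>" "0 \<le> r" "0 \<le> Q'" "Q' \<le> max (Q - \<mu>) 0 + r"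
  shows "Q'\<^sup>2 \<le> Q\<^sup>2 + 2 * (Q * (r - \<mu>)) + \<mu>\<^sup>2 + r\<^sup>2"
proof -
  let ?p = "max (Q - \<mu>) 0"
  have "Q'\<^sup>2 \<le> (?p + r)\<^sup>2" using assms by (intro power_mono) auto
  also have "\<dots> = ?p\<^sup>2 + 2 * (?p * r) + r\<^sup>2" by (simp add: power2_sum)
  also have "?p\<^sup>2 \<le> (Q - \<mu>)\<^sup>2" by (auto simp: max_def)
  also have "?p * r \<le> Q * r" using assms by (intro mult_right_mono) auto
  finally show ?thesis by (simp add: power2_eq_square algebra_simps)
qed

section \<open>One-slot drift of the squared queues\<close>

context empty_benes_run
begin

text \<open>The squares carry no factor 1/2, hence the doubled constant and noise terms in the drift
  bounds.\<close>

definition lyapunov :: "nat \<Rightarrow> 'a \<Rightarrow> real" where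
  "lyapunov t \<omega> =
     (\<Sum>s\<in>servers n. \<Sum>c\<in>{Up, Lo}. (squeue c s t \<omega>)\<^sup>2) +
     (\<Sum>j\<in>{1..n - 1}. \<Sum>i\<in>rows n. \<Sum>c\<in>{Up, Lo}. \<Sum>l\<in>{Up, Lo}. (nqueue c l j i t \<omega>)\<^sup>2) +
     (\<Sum>i\<in>rows n. \<Sum>c\<in>{Up, Lo}. (dest_queue w c i t \<omega>)\<^sup>2) +
     (\<Sum>s\<in>servers n. \<Sum>d\<in>servers n. (adm_queue w s d t \<omega>)\<^sup>2) +
     (\<Sum>d\<in>servers n. (reg_queue w d t \<omega>)\<^sup>2)"

lemma lyapunov_nonneg: "0 \<le> lyapunov t \<omega>"
  unfolding lyapunov_def by (intro add_nonneg_nonneg sum_nonneg) auto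

text \<open>Rates are 0 or 1, so their squares add up over both divisions to at most the link
  capacity 1. Each division has at most \<open>2 ^ (n - 1)\<close> destinations, which gives the
  second constant.\<close>

lemma squared_server_queues_step:
  assumes \<omega>: "\<omega> \<in> space M" and s: "s \<in> servers n"
  shows "(\<Sum>c\<in>{Up, Lo}. (squeue c s (Suc t) \<omega>)\<^sup>2) \<le> (\<Sum>c\<in>{Up, Lo}. (squeue c s t \<omega>)\<^sup>2 +
    2 * (squeue c s t \<omega> * ((\<Sum>d\<in>division n c. real (admitted w s d t \<omega>)) - srate c s t \<omega>))) +
    (1 + 2 * (2 ^ (n - 1) * Amax)\<^sup>2)"
proof -
  have adm: "(\<Sum>d\<in>division n c. real (admitted w s d t \<omega>)) \<le> 2 ^ (n - 1) * Amax" for c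
  proof -
    have "(\<Sum>d\<in>division n c. real (admitted w s d t \<omega>)) \<le> real (card (division n c)) * Amax"
      using admitted_le(2)[OF \<omega> s] division_subset by (intro sum_bounded_above) blast
    also have "\<dots> \<le> real (2 ^ (n - 1)) * Amax"
      using card_division_le[of n c] n_ge_2 Amax_nonneg by (intro mult_right_mono of_nat_mono) auto
    finally show ?thesis by simp
  qed
  have *: "(squeue c s (Suc t) \<omega>)\<^sup>2 \<le> (squeue c s t \<omega>)\<^sup>2 +
    2 * (squeue c s t \<omega> * ((\<Sum>d\<in>division n c. real (admitted w s d t \<omega>)) - srate c s t \<omega>)) +
    srate c s t \<omega> + (2 ^ (n - 1) * Amax)\<^sup>2" for c
  proof -
    let ?R = "\<Sum>d\<in>division n c. real (admitted w s d t \<omega>)"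
    have r: "0 \<le> ?R" by (intro sum_nonneg) auto
    have "srate c s t \<omega> \<le> 1" using server_rate_le[OF \<omega> s, of t] by (cases c) auto
    then have "(srate c s t \<omega>)\<^sup>2 \<le> srate c s t \<omega>"
      by (simp add: power2_eq_square mult_left_le_one_le)
    moreover have "?R\<^sup>2 \<le> (2 ^ (n - 1) * Amax)\<^sup>2" using adm r by (intro power_mono) auto
    moreover have "(squeue c s (Suc t) \<omega>)\<^sup>2 \<le> (squeue c s t \<omega>)\<^sup>2 +
        2 * (squeue c s t \<omega> * (?R - srate c s t \<omega>)) + (srate c s t \<omega>)\<^sup>2 + ?R\<^sup>2"
      using r server_queue_step[OF \<omega> s, of c t] by (intro queue_square_le) auto
    ultimately show ?thesis by linarith
  qed
  show ?thesis using *[of Up] *[of Lo] server_rate_le[OF \<omega> s, of t] by simp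
qed

text \<open>The 6 is 2 for the two outgoing links plus 4 for the inflow: it totals at most 2 over
  the divisions, and the coin sends the inflow of a division into exactly one of its two
  queues.\<close>

lemma squared_node_queues_step:
  assumes \<omega>: "\<omega> \<in> space M" and j: "j \<in> {1..n - 1}" and i: "i \<in> rows n"
  shows "(\<Sum>c\<in>{Up, Lo}. \<Sum>l\<in>{Up, Lo}. (nqueue c l j i (Suc t) \<omega>)\<^sup>2) \<le>
    (\<Sum>c\<in>{Up, Lo}. \<Sum>l\<in>{Up, Lo}. (nqueue c l j i t \<omega>)\<^sup>2 -
      2 * (nrate c l j i t \<omega> * nqueue c l j i t \<omega> - alloc c j i t \<omega> * nqueue c l j i t \<omega> / 2) +
      2 * (nqueue c l j i t \<omega> * alloc c j i t \<omega> * turn c l j i t \<omega>)) + 6"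
proof -
  have jn: "j \<in> {1..n}" using j by auto
  have *: "(nqueue c l j i (Suc t) \<omega>)\<^sup>2 \<le> (nqueue c l j i t \<omega>)\<^sup>2 -
      2 * (nrate c l j i t \<omega> * nqueue c l j i t \<omega> - alloc c j i t \<omega> * nqueue c l j i t \<omega> / 2) +
      2 * (nqueue c l j i t \<omega> * alloc c j i t \<omega> * turn c l j i t \<omega>) + nrate c l j i t \<omega> +
      (if coin w c j i t \<omega> \<longleftrightarrow> l = Up then (alloc c j i t \<omega>)\<^sup>2 else 0)" for c l
  proof -
    define R where "R = (if coin w c j i t \<omega> \<longleftrightarrow> l = Up then alloc c j i t \<omega> else 0)"
    have "nrate c l j i t \<omega> \<le> 1" using node_rate_le[OF \<omega> j i, of l t] by (cases c) auto
    then have "(nrate c l j i t \<omega>)\<^sup>2 \<le> nrate c l j i t \<omega>"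
      by (simp add: power2_eq_square mult_left_le_one_le)
    moreover have "(nqueue c l j i (Suc t) \<omega>)\<^sup>2 \<le> (nqueue c l j i t \<omega>)\<^sup>2 +
      2 * (nqueue c l j i t \<omega> * (R - nrate c l j i t \<omega>)) + (nrate c l j i t \<omega>)\<^sup>2 + R\<^sup>2"
      using alloc_nonneg[of c j i t \<omega>] node_queue_step[OF \<omega> j i, of c l t]
      by (intro queue_square_le) (auto simp: R_def)
    moreover
    \<comment> \<open>The indicator of the coin is its mean 1/2 plus the centred
      \<open>turn\<close>; the mean joins the backpressure terms, the rest becomes noise.\<close>
    have R: "R = alloc c j i t \<omega> / 2 + alloc c j i t \<omega> * turn c l j i t \<omega>"
      by (simp add: turn_def R_def)
    have "nqueue c l j i t \<omega> * (R - nrate c l j i t \<omega>) =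
      - (nrate c l j i t \<omega> * nqueue c l j i t \<omega> - alloc c j i t \<omega> * nqueue c l j i t \<omega> / 2) +
      nqueue c l j i t \<omega> * alloc c j i t \<omega> * turn c l j i t \<omega>"
      unfolding R by (simp add: algebra_simps)
    moreover have "R\<^sup>2 = (if coin w c j i t \<omega> \<longleftrightarrow> l = Up then (alloc c j i t \<omega>)\<^sup>2 else 0)"
      by (simp add: R_def)
    moreover have "x' \<le> x - 2 * u + 2 * v + r + z"
      if "r' \<le> r" "x' \<le> x + 2 * p + r' + q" "p = - u + v" "q = z" for x x' u v r r' z p q :: real
      using that by linarith
    ultimately show ?thesis by blast
  qed
  have "(\<Sum>c\<in>{Up, Lo}. \<Sum>l\<in>{Up, Lo}. nrate c l j i t \<omega>) \<le> 2"
    using node_rate_le[OF \<omega> j i, of Up t] node_rate_le[OF \<omega> j i, of Lo t] by simp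
  moreover have "(alloc Up j i t \<omega>)\<^sup>2 + (alloc Lo j i t \<omega>)\<^sup>2 \<le> 4"
  proof -
    have "(alloc Up j i t \<omega>)\<^sup>2 + (alloc Lo j i t \<omega>)\<^sup>2 \<le> (alloc Up j i t \<omega> + alloc Lo j i t \<omega>)\<^sup>2"
      using alloc_nonneg by (simp add: power2_sum)
    also have "\<dots> \<le> 2\<^sup>2" using alloc_total_le[OF \<omega> jn i, of t] alloc_nonneg by (intro power_mono) auto
    finally show ?thesis by simp
  qed
  moreover have "(\<Sum>l\<in>{Up, Lo}. if coin w c j i t \<omega> \<longleftrightarrow> l = Up then (alloc c j i t \<omega>)\<^sup>2 else 0) =
      (alloc c j i t \<omega>)\<^sup>2" for c by simp
  ultimately have "(\<Sum>c\<in>{Up, Lo}. \<Sum>l\<in>{Up, Lo}. nrate c l j i t \<omega> +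
      (if coin w c j i t \<omega> \<longleftrightarrow> l = Up then (alloc c j i t \<omega>)\<^sup>2 else 0)) \<le> 6"
    by (simp only: sum.distrib) simp
  then show ?thesis using *[of Up Up] *[of Up Lo] *[of Lo Up] *[of Lo Lo] by simp
qed

text \<open>Here the 6 is 2 for the two separate fictitious links plus 4 for the squared
  inflow.\<close>

lemma squared_dest_queues_step:
  assumes \<omega>: "\<omega> \<in> space M" and i: "i \<in> rows n"
  shows "(\<Sum>c\<in>{Up, Lo}. (dest_queue w c i (Suc t) \<omega>)\<^sup>2) \<le>
    (\<Sum>c\<in>{Up, Lo}. (dest_queue w c i t \<omega>)\<^sup>2 -
      2 * (dest_queue w c i t \<omega> * (real (dest_rate w c i t \<omega>) - alloc c n i t \<omega>))) + 6"
proof -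
  have n: "n \<in> {1..n}" using n_ge_2 by simp
  have *: "(dest_queue w c i (Suc t) \<omega>)\<^sup>2 \<le> (dest_queue w c i t \<omega>)\<^sup>2 -
      2 * (dest_queue w c i t \<omega> * (real (dest_rate w c i t \<omega>) - alloc c n i t \<omega>)) + 1 + (alloc c n i t \<omega>)\<^sup>2" for c
  proof -
    have "(real (dest_rate w c i t \<omega>))\<^sup>2 \<le> 1"
      using dest_rate_max(1)[OF \<omega> i, of c t] by (simp add: power_le_one)
    then show ?thesis
      using queue_square_le[OF dest_queue_nonneg[OF \<omega> i, of c t] _ alloc_nonneg
          dest_queue_nonneg[OF \<omega> i] dest_queue_step[OF \<omega> i, of c t]]
      by (simp add: algebra_simps)
  qed
  have "(alloc Up n i t \<omega>)\<^sup>2 + (alloc Lo n i t \<omega>)\<^sup>2 \<le> (alloc Up n i t \<omega> + alloc Lo n i t \<omega>)\<^sup>2"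
    using alloc_nonneg by (simp add: power2_sum)
  also have "\<dots> \<le> 2\<^sup>2" using alloc_total_le[OF \<omega> n i, of t] alloc_nonneg by (intro power_mono) auto
  finally show ?thesis using *[of Up] *[of Lo] by simp
qed

lemma squared_adm_queue_step:
  assumes "\<omega> \<in> space M" "s \<in> servers n" "d \<in> servers n"
  shows "(adm_queue w s d (Suc t) \<omega>)\<^sup>2 \<le> (adm_queue w s d t \<omega>)\<^sup>2 +
    2 * (adm_queue w s d t \<omega> * (aux_rate w s d t \<omega> - real (admitted w s d t \<omega>))) + 2 * Amax\<^sup>2"
proof -
  have "(real (admitted w s d t \<omega>))\<^sup>2 \<le> Amax\<^sup>2" "(aux_rate w s d t \<omega>)\<^sup>2 \<le> Amax\<^sup>2"
    using admitted_le(2)[OF assms, of t] aux_rate_bounds(1,2)[OF assms, of t]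
    by (auto intro!: power_mono)
  then show ?thesis
    using queue_square_le[OF adm_queue_nonneg[OF assms, of t] _ aux_rate_bounds(1)[OF assms, of t]
        adm_queue_nonneg[OF assms], of "real (admitted w s d t \<omega>)" "Suc t"]
      update_adm_queue[OF assms, of t] by simp
qed

lemma squared_reg_queue_step:
  assumes "\<omega> \<in> space M" "d \<in> servers n"
  shows "(reg_queue w d (Suc t) \<omega>)\<^sup>2 \<le> (reg_queue w d t \<omega>)\<^sup>2 +
    2 * (reg_queue w d t \<omega> * ((\<Sum>s\<in>servers n. real (admitted w s d t \<omega>)) - (1 - \<eta>))) +
    (1 + (2 ^ n * Amax)\<^sup>2)"
proof -
  let ?R = "\<Sum>s\<in>servers n. real (admitted w s d t \<omega>)"
  have r: "0 \<le> ?R" by (intro sum_nonneg) auto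
  have "?R \<le> (\<Sum>s\<in>servers n. Amax)"
    using admitted_le(2)[OF assms(1) _ assms(2)] by (intro sum_mono) auto
  then have "?R\<^sup>2 \<le> (2 ^ n * Amax)\<^sup>2" using r by (intro power_mono) auto
  moreover have "(1 - \<eta>)\<^sup>2 \<le> 1" using eta by (simp add: power_le_one)
  ultimately show ?thesis
    using queue_square_le[OF reg_queue_nonneg[OF assms, of t] _ r reg_queue_nonneg[OF assms], of "1 - \<eta>" "Suc t"]
      update_reg_queue[OF assms, of t] eta by simp
qed

text \<open>With \<open>n = Suc k\<close> and \<open>p = 2 ^ k\<close> the terms with
  \<open>Amax\<close> agree exactly; in the rest \<open>p * (6 * real k + 10)\<close> meets
  \<open>p * (20 * real k + 16)\<close>, so the constant of the theorem leaves room.\<close>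

lemma drift_const_ge:
  "2 ^ n * (1 + 2 * (2 ^ (n - 1) * Amax)\<^sup>2) + real (n - 1) * 2 ^ (n - 1) * 6 + 2 ^ (n - 1) * 6 +
     2 ^ n * 2 ^ n * (2 * Amax\<^sup>2) + 2 ^ n * (1 + (2 ^ n * Amax)\<^sup>2) \<le> 2 * drift_const n Amax"
proof -
  obtain k where k: "n = Suc k" using n_ge_2 by (cases n) auto
  define p :: real where "p = 2 ^ k"
  have p: "(2::real) ^ n = 2 * p" "(2::real) ^ (n - 1) = p" "(2::real) ^ (3 * n - 1) = 4 * p ^ 3"
    "(2::real) ^ (2 * n + 1) = 8 * p\<^sup>2" "(2::real) ^ (3 * n) = 8 * p ^ 3" "p \<ge> 0"
    by (simp_all add: k p_def power_add power_mult power3_eq_cube power2_eq_square flip: power_mult_distrib)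
  have "real k * p \<ge> 0" using p by simp
  have "2 * p * (1 + 2 * (p * Amax)\<^sup>2) + real k * p * 6 + p * 6 +
     2 * p * (2 * p) * (2 * Amax\<^sup>2) + 2 * p * (1 + (2 * p * Amax)\<^sup>2) =
     (p * (6 * real k + 10)) + Amax\<^sup>2 * (4 * p ^ 3 + 8 * p\<^sup>2 + 8 * p ^ 3)"
    by (simp add: algebra_simps power2_eq_square power3_eq_cube)
  also have "p * (6 * real k + 10) \<le> p * (20 * real k + 16)"
    using p by (intro mult_left_mono) auto
  also have "p * (20 * real k + 16) = 2 * p * (10 * real n - 2)" by (simp add: k algebra_simps)
  finally show ?thesis unfolding drift_const_def p by (simp add: k)
qed

text \<open>The part of the drift that stems from the coins. Queues and allocations are fixed before
  the coins are tossed, so its expectation vanishes.\<close>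

definition coin_noise :: "nat \<Rightarrow> 'a \<Rightarrow> real" where
  "coin_noise t \<omega> = (\<Sum>j\<in>{1..n - 1}. \<Sum>i\<in>rows n. \<Sum>c\<in>{Up, Lo}. \<Sum>l\<in>{Up, Lo}.
     nqueue c l j i t \<omega> * alloc c j i t \<omega> * turn c l j i t \<omega>)"

text \<open>The group subtracted at the end is the right-hand side of
  \<open>backpressure_optimal\<close>, ready to be replaced by the load of a competitor.\<close>

lemma lyapunov_step:
  assumes \<omega>: "\<omega> \<in> space M"
  shows "lyapunov (Suc t) \<omega> \<le> lyapunov t \<omega> + 2 * drift_const n Amax + 2 * coin_noise t \<omega> +
    2 * ((\<Sum>s\<in>servers n. \<Sum>c\<in>{Up, Lo}. squeue c s t \<omega> * (\<Sum>d\<in>division n c. real (admitted w s d t \<omega>))) +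
      (\<Sum>s\<in>servers n. \<Sum>d\<in>servers n. adm_queue w s d t \<omega> * (aux_rate w s d t \<omega> - real (admitted w s d t \<omega>))) +
      (\<Sum>d\<in>servers n. reg_queue w d t \<omega> * ((\<Sum>s\<in>servers n. real (admitted w s d t \<omega>)) - (1 - \<eta>))) -
      ((\<Sum>s\<in>servers n. \<Sum>c\<in>{Up, Lo}. srate c s t \<omega> * squeue c s t \<omega>) +
      (\<Sum>j\<in>{1..n - 1}. \<Sum>i\<in>rows n. \<Sum>c\<in>{Up, Lo}. \<Sum>l\<in>{Up, Lo}.
         nrate c l j i t \<omega> * nqueue c l j i t \<omega> - alloc c j i t \<omega> * nqueue c l j i t \<omega> / 2) +
      (\<Sum>i\<in>rows n. \<Sum>c\<in>{Up, Lo}.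
         dest_queue w c i t \<omega> * (real (dest_rate w c i t \<omega>) - alloc c n i t \<omega>))))"
proof -
  have rc: "card (rows n) = 2 ^ (n - 1)" "card (servers n) = 2 ^ n" by auto
  have S: "(\<Sum>s\<in>servers n. \<Sum>c\<in>{Up, Lo}. (squeue c s (Suc t) \<omega>)\<^sup>2) \<le>
    (\<Sum>s\<in>servers n. \<Sum>c\<in>{Up, Lo}. (squeue c s t \<omega>)\<^sup>2) +
    2 * ((\<Sum>s\<in>servers n. \<Sum>c\<in>{Up, Lo}. squeue c s t \<omega> * (\<Sum>d\<in>division n c. real (admitted w s d t \<omega>))) -
      (\<Sum>s\<in>servers n. \<Sum>c\<in>{Up, Lo}. srate c s t \<omega> * squeue c s t \<omega>)) +
    2 ^ n * (1 + 2 * (2 ^ (n - 1) * Amax)\<^sup>2)"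
    using sum_mono[OF squared_server_queues_step[OF \<omega>, of _ t], of "servers n"]
    by (simp add: sum.distrib sum_subtractf sum_distrib_left right_diff_distrib algebra_simps)
  have N: "(\<Sum>j\<in>{1..n - 1}. \<Sum>i\<in>rows n. \<Sum>c\<in>{Up, Lo}. \<Sum>l\<in>{Up, Lo}. (nqueue c l j i (Suc t) \<omega>)\<^sup>2) \<le>
    (\<Sum>j\<in>{1..n - 1}. \<Sum>i\<in>rows n. \<Sum>c\<in>{Up, Lo}. \<Sum>l\<in>{Up, Lo}. (nqueue c l j i t \<omega>)\<^sup>2) -
    2 * (\<Sum>j\<in>{1..n - 1}. \<Sum>i\<in>rows n. \<Sum>c\<in>{Up, Lo}. \<Sum>l\<in>{Up, Lo}.
         nrate c l j i t \<omega> * nqueue c l j i t \<omega> - alloc c j i t \<omega> * nqueue c l j i t \<omega> / 2) +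
    2 * coin_noise t \<omega> + real (n - 1) * 2 ^ (n - 1) * 6"
  proof -
    have "(\<Sum>j\<in>{1..n - 1}. \<Sum>i\<in>rows n. \<Sum>c\<in>{Up, Lo}. \<Sum>l\<in>{Up, Lo}. (nqueue c l j i (Suc t) \<omega>)\<^sup>2) \<le>
      (\<Sum>j\<in>{1..n - 1}. \<Sum>i\<in>rows n. (\<Sum>c\<in>{Up, Lo}. \<Sum>l\<in>{Up, Lo}. (nqueue c l j i t \<omega>)\<^sup>2 -
      2 * (nrate c l j i t \<omega> * nqueue c l j i t \<omega> - alloc c j i t \<omega> * nqueue c l j i t \<omega> / 2) +
      2 * (nqueue c l j i t \<omega> * alloc c j i t \<omega> * turn c l j i t \<omega>)) + 6)"
      by (rule sum_mono, rule sum_mono, rule squared_node_queues_step[OF \<omega>])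
    also have "\<dots> = (\<Sum>j\<in>{1..n - 1}. \<Sum>i\<in>rows n. \<Sum>c\<in>{Up, Lo}. \<Sum>l\<in>{Up, Lo}. (nqueue c l j i t \<omega>)\<^sup>2) -
    2 * (\<Sum>j\<in>{1..n - 1}. \<Sum>i\<in>rows n. \<Sum>c\<in>{Up, Lo}. \<Sum>l\<in>{Up, Lo}.
         nrate c l j i t \<omega> * nqueue c l j i t \<omega> - alloc c j i t \<omega> * nqueue c l j i t \<omega> / 2) +
    2 * coin_noise t \<omega> + (\<Sum>j\<in>{1..n - 1}. \<Sum>i\<in>rows n. 6)"
    proof -
      define X where "X c l j i = nrate c l j i t \<omega> * nqueue c l j i t \<omega> - alloc c j i t \<omega> * nqueue c l j i t \<omega> / 2"
        for c l j i
      show ?thesis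
        unfolding coin_noise_def X_def[symmetric] by (simp only: sum.distrib sum_subtractf sum_distrib_left)
    qed
    also have "(\<Sum>j\<in>{1..n - 1}. \<Sum>i\<in>rows n. 6) = real (n - 1) * 2 ^ (n - 1) * 6" by simp
    finally show ?thesis .
  qed
  have D: "(\<Sum>i\<in>rows n. \<Sum>c\<in>{Up, Lo}. (dest_queue w c i (Suc t) \<omega>)\<^sup>2) \<le>
    (\<Sum>i\<in>rows n. \<Sum>c\<in>{Up, Lo}. (dest_queue w c i t \<omega>)\<^sup>2) -
    2 * (\<Sum>i\<in>rows n. \<Sum>c\<in>{Up, Lo}.
         dest_queue w c i t \<omega> * (real (dest_rate w c i t \<omega>) - alloc c n i t \<omega>)) + 2 ^ (n - 1) * 6"
  proof -
    have "(\<Sum>i\<in>rows n. \<Sum>c\<in>{Up, Lo}. (dest_queue w c i (Suc t) \<omega>)\<^sup>2) \<le>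
      (\<Sum>i\<in>rows n. (\<Sum>c\<in>{Up, Lo}. (dest_queue w c i t \<omega>)\<^sup>2 -
      2 * (dest_queue w c i t \<omega> * (real (dest_rate w c i t \<omega>) - alloc c n i t \<omega>))) + 6)"
      by (rule sum_mono, rule squared_dest_queues_step[OF \<omega>])
    also have "\<dots> = (\<Sum>i\<in>rows n. \<Sum>c\<in>{Up, Lo}. (dest_queue w c i t \<omega>)\<^sup>2) -
    2 * (\<Sum>i\<in>rows n. \<Sum>c\<in>{Up, Lo}.
         dest_queue w c i t \<omega> * (real (dest_rate w c i t \<omega>) - alloc c n i t \<omega>)) + (\<Sum>i\<in>rows n. 6)"
      by (simp only: sum.distrib sum_subtractf sum_distrib_left)
    also have "(\<Sum>i\<in>rows n. 6) = (2 ^ (n - 1) * 6 :: real)" by simp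
    finally show ?thesis .
  qed
  have H: "(\<Sum>s\<in>servers n. \<Sum>d\<in>servers n. (adm_queue w s d (Suc t) \<omega>)\<^sup>2) \<le>
    (\<Sum>s\<in>servers n. \<Sum>d\<in>servers n. (adm_queue w s d t \<omega>)\<^sup>2) +
    2 * (\<Sum>s\<in>servers n. \<Sum>d\<in>servers n. adm_queue w s d t \<omega> * (aux_rate w s d t \<omega> - real (admitted w s d t \<omega>))) +
    2 ^ n * 2 ^ n * (2 * Amax\<^sup>2)"
  proof -
    have "(\<Sum>s\<in>servers n. \<Sum>d\<in>servers n. (adm_queue w s d (Suc t) \<omega>)\<^sup>2) \<le>
      (\<Sum>s\<in>servers n. \<Sum>d\<in>servers n. (adm_queue w s d t \<omega>)\<^sup>2 +
      2 * (adm_queue w s d t \<omega> * (aux_rate w s d t \<omega> - real (admitted w s d t \<omega>))) + 2 * Amax\<^sup>2)"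
      by (rule sum_mono, rule sum_mono, rule squared_adm_queue_step[OF \<omega>])
    also have "\<dots> = (\<Sum>s\<in>servers n. \<Sum>d\<in>servers n. (adm_queue w s d t \<omega>)\<^sup>2) +
    2 * (\<Sum>s\<in>servers n. \<Sum>d\<in>servers n. adm_queue w s d t \<omega> * (aux_rate w s d t \<omega> - real (admitted w s d t \<omega>))) +
    (\<Sum>s\<in>servers n. \<Sum>d\<in>servers n. 2 * Amax\<^sup>2)"
      by (simp only: sum.distrib sum_distrib_left)
    also have "(\<Sum>s\<in>servers n. \<Sum>d\<in>servers n. 2 * Amax\<^sup>2) = 2 ^ n * 2 ^ n * (2 * Amax\<^sup>2)" by simp
    finally show ?thesis .
  qed
  have q: "(\<Sum>d\<in>servers n. (reg_queue w d (Suc t) \<omega>)\<^sup>2) \<le> (\<Sum>d\<in>servers n. (reg_queue w d t \<omega>)\<^sup>2) +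
    2 * (\<Sum>d\<in>servers n. reg_queue w d t \<omega> * ((\<Sum>s\<in>servers n. real (admitted w s d t \<omega>)) - (1 - \<eta>))) +
    2 ^ n * (1 + (2 ^ n * Amax)\<^sup>2)"
  proof -
    have "(\<Sum>d\<in>servers n. (reg_queue w d (Suc t) \<omega>)\<^sup>2) \<le> (\<Sum>d\<in>servers n. (reg_queue w d t \<omega>)\<^sup>2 +
    2 * (reg_queue w d t \<omega> * ((\<Sum>s\<in>servers n. real (admitted w s d t \<omega>)) - (1 - \<eta>))) +
    (1 + (2 ^ n * Amax)\<^sup>2))"
      by (rule sum_mono, rule squared_reg_queue_step[OF \<omega>])
    also have "\<dots> = (\<Sum>d\<in>servers n. (reg_queue w d t \<omega>)\<^sup>2) +
    2 * (\<Sum>d\<in>servers n. reg_queue w d t \<omega> * ((\<Sum>s\<in>servers n. real (admitted w s d t \<omega>)) - (1 - \<eta>))) +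
    (\<Sum>d\<in>servers n. 1 + (2 ^ n * Amax)\<^sup>2)"
      unfolding sum_distrib_left sum.distrib[symmetric] ..
    also have "(\<Sum>d\<in>servers n. 1 + (2 ^ n * Amax)\<^sup>2) = 2 ^ n * (1 + (2 ^ n * Amax)\<^sup>2)" by simp
    finally show ?thesis .
  qed
  \<comment> \<open>With all sums abstracted to variables only linear arithmetic is left.\<close>
  have "s' + N' + D' + H' + q' \<le> s + N + D + H + q + 2 * B + 2 * z + 2 * (a + h + p - (b + x + y))"
    if "s' \<le> s + 2 * (a - b) + k1" "N' \<le> N - 2 * x + 2 * z + k2" "D' \<le> D - 2 * y + k3"
      "H' \<le> H + 2 * h + k4" "q' \<le> q + 2 * p + k5" "k1 + k2 + k3 + k4 + k5 \<le> 2 * B"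
    for s' s a b k1 N' N x z k2 D' D y k3 H' H h k4 q' q p k5 B :: real
    using that by argo
  from this[OF S N D H q drift_const_ge] show ?thesis
    unfolding lyapunov_def[of t] lyapunov_def[of "Suc t"] .
qed

end

section \<open>Utility\<close>

context empty_benes_run
begin

definition adm_diff :: "side \<Rightarrow> nat \<Rightarrow> nat \<Rightarrow> nat \<Rightarrow> 'a \<Rightarrow> real" where
  "adm_diff c s d t \<omega> = adm_queue w s d t \<omega> - reg_queue w d t \<omega> - squeue c s t \<omega>"

definition arrival_noise :: "nat \<Rightarrow> 'a \<Rightarrow> real" where
  "arrival_noise t \<omega> = (\<Sum>s\<in>servers n. \<Sum>c\<in>{Up, Lo}. \<Sum>d\<in>division n c.
     max (adm_diff c s d t \<omega>) 0 * (real (A s d t \<omega>) - mean_arrival s d))"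

text \<open>Every decision of the slot is compared with \<open>\<rho>\<close>: admission through the
  mean arrivals, the auxiliary rates through their maximality, routing through
  \<open>backpressure_optimal\<close>. The point \<open>r\<close> of the tangents stays free; later
  it is the achieved rate vector.\<close>

lemma control_drift_le:
  assumes \<omega>: "\<omega> \<in> space M"
    and \<rho>: "\<And>s d. s \<in> servers n \<Longrightarrow> d \<in> servers n \<Longrightarrow> 0 \<le> \<rho> s d \<and> \<rho> s d \<le> mean_arrival s d"
      "\<And>s. s \<in> servers n \<Longrightarrow> (\<Sum>d\<in>servers n. \<rho> s d) \<le> 1"
      "\<And>d. d \<in> servers n \<Longrightarrow> (\<Sum>s\<in>servers n. \<rho> s d) \<le> 1 - \<eta>"
    and r: "\<And>s d. s \<in> servers n \<Longrightarrow> d \<in> servers n \<Longrightarrow> 0 \<le> r s d"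
  shows "lyapunov (Suc t) \<omega> \<le> lyapunov t \<omega> + 2 * drift_const n Amax + 2 * coin_noise t \<omega> -
    2 * arrival_noise t \<omega> + 2 * (V * (\<Sum>s\<in>servers n. \<Sum>d\<in>servers n.
      U s d (r s d) + U' s d (r s d) * (aux_rate w s d t \<omega> - r s d) - U s d (\<rho> s d)))"
proof -
  let ?H = "\<lambda>s d. adm_queue w s d t \<omega>" and ?q = "\<lambda>d. reg_queue w d t \<omega>"
    and ?g = "\<lambda>s d. aux_rate w s d t \<omega>" and ?R = "\<lambda>s d. real (admitted w s d t \<omega>)"
  define x where "x c s = (\<Sum>d\<in>division n c. \<rho> s d)" for c s
  \<comment> \<open>Collects the drift by flow: the coefficient of a flow is the quantity tested by
    the admission rule.\<close>
  have weighted: "(\<Sum>s\<in>servers n. \<Sum>c\<in>{Up, Lo}. \<Sum>d\<in>division n c. f s d * adm_diff c s d t \<omega>) =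
      (\<Sum>s\<in>servers n. \<Sum>d\<in>servers n. ?H s d * f s d) - (\<Sum>d\<in>servers n. ?q d * (\<Sum>s\<in>servers n. f s d)) -
      (\<Sum>s\<in>servers n. \<Sum>c\<in>{Up, Lo}. squeue c s t \<omega> * (\<Sum>d\<in>division n c. f s d))" for f
  proof -
    have "(\<Sum>d\<in>servers n. ?q d * (\<Sum>s\<in>servers n. f s d)) = (\<Sum>s\<in>servers n. \<Sum>d\<in>servers n. ?q d * f s d)"
      unfolding sum_distrib_left by (rule sum.swap)
    also have "\<dots> = (\<Sum>s\<in>servers n. \<Sum>c\<in>{Up, Lo}. \<Sum>d\<in>division n c. ?q d * f s d)"
      by (simp only: sum_servers_division[where f = "\<lambda>d. ?q d * f _ d"])
    finally have 1: "(\<Sum>d\<in>servers n. ?q d * (\<Sum>s\<in>servers n. f s d)) =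
        (\<Sum>s\<in>servers n. \<Sum>c\<in>{Up, Lo}. \<Sum>d\<in>division n c. ?q d * f s d)" .
    have 2: "(\<Sum>s\<in>servers n. \<Sum>d\<in>servers n. ?H s d * f s d) =
        (\<Sum>s\<in>servers n. \<Sum>c\<in>{Up, Lo}. \<Sum>d\<in>division n c. ?H s d * f s d)"
      by (simp only: sum_servers_division[where f = "\<lambda>d. ?H _ d * f _ d"])
    show ?thesis
      unfolding 1 2 unfolding sum_distrib_left sum_subtractf[symmetric] adm_diff_def
      by (intro sum.cong refl) (simp add: algebra_simps)
  qed
  have RA: "arrival_noise t \<omega> + (\<Sum>s\<in>servers n. \<Sum>c\<in>{Up, Lo}. \<Sum>d\<in>division n c. \<rho> s d * adm_diff c s d t \<omega>) \<le>
      (\<Sum>s\<in>servers n. \<Sum>c\<in>{Up, Lo}. \<Sum>d\<in>division n c. ?R s d * adm_diff c s d t \<omega>)"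
    unfolding arrival_noise_def sum.distrib[symmetric]
  proof (rule sum_mono, rule sum_mono, rule sum_mono)
    fix s c d assume s: "s \<in> servers n" and d: "d \<in> division n c"
    have d': "d \<in> servers n" using d division_subset by blast
    let ?m = "max (adm_diff c s d t \<omega>) 0"
    have "?R s d * adm_diff c s d t \<omega> = ?m * real (A s d t \<omega>)"
      using choose_admitted[OF \<omega> s d, of t] by (simp add: adm_diff_def max_def)
    moreover have "\<rho> s d * adm_diff c s d t \<omega> \<le> \<rho> s d * ?m"
      using \<rho>(1)[OF s d'] by (intro mult_left_mono) auto
    moreover have "\<rho> s d * ?m \<le> mean_arrival s d * ?m"
      using \<rho>(1)[OF s d'] by (intro mult_right_mono) auto
    ultimately show "?m * (real (A s d t \<omega>) - mean_arrival s d) + \<rho> s d * adm_diff c s d t \<omega> \<le>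
        ?R s d * adm_diff c s d t \<omega>"
      by (simp add: algebra_simps)
  qed
  have UH: "(\<Sum>s\<in>servers n. \<Sum>d\<in>servers n. ?H s d * ?g s d) \<le>
      (\<Sum>s\<in>servers n. \<Sum>d\<in>servers n. ?H s d * \<rho> s d) + V * (\<Sum>s\<in>servers n. \<Sum>d\<in>servers n.
      U s d (r s d) + U' s d (r s d) * (?g s d - r s d) - U s d (\<rho> s d))"
    unfolding sum_distrib_left sum.distrib[symmetric]
  proof (rule sum_mono, rule sum_mono)
    fix s d assume sd: "s \<in> servers n" "d \<in> servers n"
    have "\<rho> s d \<le> Amax" using \<rho>(1)[OF sd] mean_arrival_le[OF sd] by simp
    then have "V * U s d (\<rho> s d) - ?H s d * \<rho> s d \<le> V * U s d (?g s d) - ?H s d * ?g s d"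
      using aux_rate_bounds(3)[OF \<omega> sd, of "\<rho> s d" t] \<rho>(1)[OF sd] by simp
    moreover have "V * U s d (?g s d) \<le> V * (U s d (r s d) + U' s d (r s d) * (?g s d - r s d))"
      using utility_le_tangent[OF sd r[OF sd] aux_rate_bounds(1)[OF \<omega> sd, of t]] V_pos
      by (intro mult_left_mono) auto
    ultimately show "?H s d * ?g s d \<le> ?H s d * \<rho> s d + V *
        (U s d (r s d) + U' s d (r s d) * (?g s d - r s d) - U s d (\<rho> s d))"
      by (simp add: right_diff_distrib)
  qed
  \<comment> \<open>Here the competitor must send at most \<open>1 - \<eta>\<close> to each
    destination: it may not load a regulation queue beyond its service rate.\<close>
  have Q: "(\<Sum>d\<in>servers n. ?q d * (\<Sum>s\<in>servers n. \<rho> s d)) \<le> (\<Sum>d\<in>servers n. ?q d * (1 - \<eta>))"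
    using \<rho>(3) reg_queue_nonneg[OF \<omega>] by (intro sum_mono mult_left_mono) auto
  have x: "x Up s + x Lo s \<le> 1" "0 \<le> x c s" if "s \<in> servers n" for s c
  proof -
    show "x Up s + x Lo s \<le> 1"
      using \<rho>(2)[OF that] sum_servers_division[of "\<lambda>d. \<rho> s d" n] by (simp add: x_def)
    show "0 \<le> x c s"
      unfolding x_def using \<rho>(1)[OF that] division_subset by (intro sum_nonneg) blast
  qed
  \<comment> \<open>A division has at most \<open>2 ^ (n - 1)\<close> destinations, each taking at
    most 1. Shared among the \<open>2 ^ (n - 1)\<close> partition nodes this is at most 1 per
    node.\<close>
  have "(\<Sum>s\<in>servers n. x c s) \<le> 2 ^ (n - 1)" for c
  proof -
    have "(\<Sum>s\<in>servers n. x c s) = (\<Sum>d\<in>division n c. \<Sum>s\<in>servers n. \<rho> s d)"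
      unfolding x_def by (rule sum.swap)
    also have "\<dots> \<le> (\<Sum>d\<in>division n c. 1)"
    proof (rule sum_mono)
      fix d assume "d \<in> division n c"
      then have "d \<in> servers n" using division_subset by blast
      then show "(\<Sum>s\<in>servers n. \<rho> s d) \<le> 1" using \<rho>(3)[of d] eta by linarith
    qed
    also have "\<dots> \<le> real (2 ^ (n - 1))" using card_division_le[of n c] n_ge_2 by (simp del: of_nat_power)
    finally show ?thesis by simp
  qed
  from backpressure_optimal[OF \<omega> x(2) x(1) this, of t]
  have BP: "(\<Sum>s\<in>servers n. \<Sum>c\<in>{Up, Lo}. squeue c s t \<omega> * (\<Sum>d\<in>division n c. \<rho> s d)) \<le>
      (\<Sum>s\<in>servers n. \<Sum>c\<in>{Up, Lo}. srate c s t \<omega> * squeue c s t \<omega>) +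
      (\<Sum>j\<in>{1..n - 1}. \<Sum>i\<in>rows n. \<Sum>c\<in>{Up, Lo}. \<Sum>l\<in>{Up, Lo}.
         nrate c l j i t \<omega> * nqueue c l j i t \<omega> - alloc c j i t \<omega> * nqueue c l j i t \<omega> / 2) +
      (\<Sum>i\<in>rows n. \<Sum>c\<in>{Up, Lo}.
         dest_queue w c i t \<omega> * (real (dest_rate w c i t \<omega>) - alloc c n i t \<omega>))"
    unfolding x_def by (simp only: mult.commute)
  have adm: "(\<Sum>s\<in>servers n. \<Sum>d\<in>servers n. ?H s d * (?g s d - ?R s d)) =
      (\<Sum>s\<in>servers n. \<Sum>d\<in>servers n. ?H s d * ?g s d) - (\<Sum>s\<in>servers n. \<Sum>d\<in>servers n. ?H s d * ?R s d)"
    by (simp only: right_diff_distrib sum_subtractf)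
  have reg: "(\<Sum>d\<in>servers n. ?q d * ((\<Sum>s\<in>servers n. ?R s d) - (1 - \<eta>))) =
      (\<Sum>d\<in>servers n. ?q d * (\<Sum>s\<in>servers n. ?R s d)) - (\<Sum>d\<in>servers n. ?q d * (1 - \<eta>))"
    by (simp only: right_diff_distrib[of _ "sum _ _"] sum_subtractf)
  have "L' \<le> L + B + C - 2 * an + 2 * v"
    if "L' \<le> L + B + C + 2 * (sR + (Hg - HR) + (qR - qe) - bp)" "an + (Hr - qr - sr) \<le> HR - qR - sR"
      "Hg \<le> Hr + v" "qr \<le> qe" "sr \<le> bp"
    for L' L B C sR Hg HR qR qe bp an Hr qr sr v :: real
    using that by argo
  from this[OF lyapunov_step[OF \<omega>, of t, unfolded adm reg] RA[unfolded weighted] UH Q BP]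
  show ?thesis .
qed

section \<open>Vanishing means of the noise terms\<close>

lemma expectation_coin_noise: "integrable M (coin_noise t)" "expectation (coin_noise t) = 0"
proof -
  have N: "noise (queue_bound * 2 * (1 / 2)) t (\<lambda>\<omega>. nqueue c l j i t \<omega> * alloc c j i t \<omega> * turn c l j i t \<omega>)"
    if j: "j \<in> {1..n - 1}" and i: "i \<in> rows n" for c l j i
  proof (rule noise_mult[OF _ _ noise_turn[OF j i]])
    have jn: "j \<in> {1..n}" using j by auto
    show "(\<lambda>\<omega>. nqueue c l j i t \<omega> * alloc c j i t \<omega>) \<in> borel_measurable (G t)"
      using measurable_F_imp_G[OF measurable_node_queue[OF j i]] measurable_alloc[OF jn i] by simp
    show "\<bar>nqueue c l j i t \<omega> * alloc c j i t \<omega>\<bar> \<le> queue_bound * 2" if "\<omega> \<in> space M" for \<omega>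
      using queues_bounded(2)[OF that j i] alloc_le[OF that jn i, of c t] alloc_nonneg[of c j i t \<omega>]
      by (intro abs_mult_le) auto
  qed
  have "\<exists>C. noise C t (coin_noise t)"
    unfolding coin_noise_def[abs_def]
    by (rule exI, (rule noise_sum, simp)+) (rule N)
  then obtain C where C: "noise C t (coin_noise t)" by blast
  show "integrable M (coin_noise t)" using noiseD(2,3)[OF C] by (rule integrable_bounded)
  show "expectation (coin_noise t) = 0" by (rule noise_expectation[OF C])
qed

lemma queues_measurable_M:
  "s \<in> servers n \<Longrightarrow> (\<lambda>\<omega>. squeue c s t \<omega>) \<in> borel_measurable M"
  "j \<in> {1..n - 1} \<Longrightarrow> i \<in> rows n \<Longrightarrow> (\<lambda>\<omega>. nqueue c l j i t \<omega>) \<in> borel_measurable M"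
  "i \<in> rows n \<Longrightarrow> dest_queue w c i t \<in> borel_measurable M"
  "s \<in> servers n \<Longrightarrow> d \<in> servers n \<Longrightarrow> adm_queue w s d t \<in> borel_measurable M"
  "d \<in> servers n \<Longrightarrow> reg_queue w d t \<in> borel_measurable M"
  by (rule measurable_F_imp_M, rule measurable_server_queue measurable_node_queue packets_adapted(3)
      virtual_queues_adapted; assumption)+

lemma expectation_arrival_noise: "integrable M (arrival_noise t)" "expectation (arrival_noise t) = 0"
proof -
  let ?f = "\<lambda>s c d \<omega>. max (adm_diff c s d t \<omega>) 0 * (real (A s d t \<omega>) - mean_arrival s d)"
  have *: "integrable M (?f s c d) \<and> expectation (?f s c d) = 0"
    if s: "s \<in> servers n" and d: "d \<in> division n c" for s c d
  proof -
    have d': "d \<in> servers n" using d division_subset by blast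
    have m: "(\<lambda>\<omega>. max (adm_diff c s d t \<omega>) 0) \<in> borel_measurable (F t)"
      unfolding adm_diff_def
      using virtual_queues_adapted(1)[OF s d'] virtual_queues_adapted(2)[OF d'] measurable_server_queue[OF s]
      by simp
    have b: "\<bar>max (adm_diff c s d t \<omega>) 0\<bar> \<le> queue_bound" if "\<omega> \<in> space M" for \<omega>
      using queues_bounded(4)[OF that s d', of t] reg_queue_nonneg[OF that d', of t] queue_bound_nonneg
      by (simp add: adm_diff_def)
    have "\<bar>real (A s d t \<omega>) - mean_arrival s d\<bar> \<le> Amax + \<bar>mean_arrival s d\<bar>" if "\<omega> \<in> space M" for \<omega>
      using arrivals_bounded[OF s d' that, of t] by linarith
    moreover have "(\<lambda>\<omega>. real (A s d t \<omega>) - mean_arrival s d) \<in> borel_measurable M"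
      using measurable_compose[OF arrivals_measurable[OF s d'], of real borel t] by simp
    ultimately show ?thesis
      using integrable_mult_bounded[OF measurable_F_imp_M[OF m] _ b] expectation_fresh_arrival[OF s d' m b]
      by blast
  qed
  then have i: "integrable M (?f s c d)" and e: "expectation (?f s c d) = 0"
    if "s \<in> servers n" "d \<in> division n c" for s c d using that by blast+
  show "integrable M (arrival_noise t)"
    unfolding arrival_noise_def[abs_def] by (intro Bochner_Integration.integrable_sum i)
  show "expectation (arrival_noise t) = 0"
    unfolding arrival_noise_def[abs_def]
    by (subst Bochner_Integration.integral_sum, intro Bochner_Integration.integrable_sum i, assumption+,
        intro sum.neutral ballI)
      (subst Bochner_Integration.integral_sum, intro Bochner_Integration.integrable_sum i, assumption+,
        intro sum.neutral ballI, subst Bochner_Integration.integral_sum, intro i, assumption+,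
        intro sum.neutral ballI e, assumption+)
qed

lemma integrable_lyapunov: "integrable M (lyapunov t)"
proof -
  have sq: "integrable M (\<lambda>\<omega>. (f \<omega>)\<^sup>2)"
    if "f \<in> borel_measurable M" "\<And>\<omega>. \<omega> \<in> space M \<Longrightarrow> 0 \<le> f \<omega> \<and> f \<omega> \<le> queue_bound" for f :: "'a \<Rightarrow> real"
    using that by (intro integrable_bounded[of _ "queue_bound\<^sup>2"]) (auto intro: power_mono)
  show ?thesis
    unfolding lyapunov_def[abs_def]
    by (intro Bochner_Integration.integrable_add Bochner_Integration.integrable_sum sq
        queues_measurable_M conjI queues_bounded of_nat_0_le_iff dest_queue_nonneg adm_queue_nonneg
        reg_queue_nonneg)
qed

section \<open>Averaging the drift over time\<close>

lemma integrable_aux_rate: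
  assumes "s \<in> servers n" "d \<in> servers n"
  shows "integrable M (aux_rate w s d t)"
  using measurable_G_imp_M[OF decisions_adapted(1)[OF assms]] aux_rate_bounds(1,2)[OF _ assms]
  by (intro integrable_bounded[of _ Amax]) auto

lemma integrable_admitted:
  assumes "s \<in> servers n" "d \<in> servers n"
  shows "integrable M (\<lambda>\<omega>. real (admitted w s d t \<omega>))"
  using measurable_G_imp_M[OF measurable_admitted[OF assms]] admitted_le(2)[OF _ assms]
  by (intro integrable_bounded[of _ Amax]) auto

text \<open>A bounded admission queue cannot receive more than it serves on average. This direction
  suffices, as the tangent slopes that weight the auxiliary rates are nonnegative.\<close>

lemma sum_aux_rate_le:
  assumes sd: "s \<in> servers n" "d \<in> servers n"
  shows "(\<Sum>t<T. expectation (aux_rate w s d t)) \<le>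
    queue_bound + (\<Sum>t<T. expectation (\<lambda>\<omega>. real (admitted w s d t \<omega>)))"
proof -
  have path: "(\<Sum>t<T. aux_rate w s d t \<omega>) \<le> adm_queue w s d T \<omega> + (\<Sum>t<T. real (admitted w s d t \<omega>))"
    if "\<omega> \<in> space M" for \<omega>
  proof (induction T)
    case 0
    then show ?case using adm_queue_nonneg[OF that sd] by simp
  next
    case (Suc T)
    then show ?case using update_adm_queue[OF that sd, of T] by simp
  qed
  have "expectation (\<lambda>\<omega>. \<Sum>t<T. aux_rate w s d t \<omega>) \<le>
      expectation (\<lambda>\<omega>. queue_bound + (\<Sum>t<T. real (admitted w s d t \<omega>)))"
  proof (rule integral_mono)
    show "(\<Sum>t<T. aux_rate w s d t \<omega>) \<le> queue_bound + (\<Sum>t<T. real (admitted w s d t \<omega>))"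
      if "\<omega> \<in> space M" for \<omega>
      using path[OF that] queues_bounded(4)[OF that sd, of T] by linarith
  qed (auto intro!: Bochner_Integration.integrable_add Bochner_Integration.integrable_sum
      integrable_aux_rate integrable_admitted sd)
  then show ?thesis
    using integrable_aux_rate[OF sd] integrable_admitted[OF sd] by (simp add: prob_space)
qed

text \<open>The expected drift is summed over time; the Lyapunov function starts at 0 and stays
  nonnegative. After division by \<open>T\<close>, the limit is taken in an affine
  expression.\<close>

lemma total_utility_ge:
  assumes rate: "\<And>s d. s \<in> servers n \<Longrightarrow> d \<in> servers n \<Longrightarrow> has_average_rate M (admitted w s d) (r s d)"
    and \<rho>: "\<And>s d. s \<in> servers n \<Longrightarrow> d \<in> servers n \<Longrightarrow> 0 \<le> \<rho> s d \<and> \<rho> s d \<le> mean_arrival s d"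
      "\<And>s. s \<in> servers n \<Longrightarrow> (\<Sum>d\<in>servers n. \<rho> s d) \<le> 1"
      "\<And>d. d \<in> servers n \<Longrightarrow> (\<Sum>s\<in>servers n. \<rho> s d) \<le> 1 - \<eta>"
  shows "total_utility n U \<rho> - drift_const n Amax / V \<le> total_utility n U r"
proof -
  let ?B = "drift_const n Amax"
  define a where "a s d T = (\<Sum>t<T. expectation (\<lambda>\<omega>. real (admitted w s d t \<omega>))) / real T" for s d T
  have a_lim: "a s d \<longlonglongrightarrow> r s d" if "s \<in> servers n" "d \<in> servers n" for s d
    using rate[OF that] unfolding has_average_rate_def a_def .
  have r: "0 \<le> r s d" if "s \<in> servers n" "d \<in> servers n" for s d
    by (intro LIMSEQ_le_const[OF a_lim[OF that]] exI[of _ 0])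
      (auto simp: a_def intro!: divide_nonneg_nonneg sum_nonneg)
  \<comment> \<open>The tangent makes \<open>u s d\<close> affine, so expectations and time averages
    pass through it.\<close>
  define u where "u s d x = U s d (r s d) + U' s d (r s d) * (x - r s d) - U s d (\<rho> s d)" for s d x
  have step: "expectation (lyapunov (Suc t)) \<le> expectation (lyapunov t) + 2 * ?B +
      2 * (V * (\<Sum>s\<in>servers n. \<Sum>d\<in>servers n. u s d (expectation (aux_rate w s d t))))" for t
  proof -
    let ?h = "\<lambda>\<omega>. \<Sum>s\<in>servers n. \<Sum>d\<in>servers n. u s d (aux_rate w s d t \<omega>)"
    have iu: "integrable M (\<lambda>\<omega>. u s d (aux_rate w s d t \<omega>))"
      "expectation (\<lambda>\<omega>. u s d (aux_rate w s d t \<omega>)) = u s d (expectation (aux_rate w s d t))"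
      if "s \<in> servers n" "d \<in> servers n" for s d
      unfolding u_def using integrable_aux_rate[OF that, of t] by (simp_all add: prob_space)
    have ih: "integrable M ?h" by (intro Bochner_Integration.integrable_sum iu)
    have eh: "expectation ?h = (\<Sum>s\<in>servers n. \<Sum>d\<in>servers n. u s d (expectation (aux_rate w s d t)))"
      using iu by (simp add: Bochner_Integration.integrable_sum del: atLeastAtMost_iff)
    have "expectation (lyapunov (Suc t)) \<le> expectation (\<lambda>\<omega>. lyapunov t \<omega> + 2 * ?B + 2 * coin_noise t \<omega> -
        2 * arrival_noise t \<omega> + 2 * (V * ?h \<omega>))"
      using control_drift_le[where r = r and \<rho> = \<rho>, OF _ \<rho> r] unfolding u_def[symmetric]
      by (intro integral_mono Bochner_Integration.integrable_add Bochner_Integration.integrable_diff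
          integrable_mult_right integrable_lyapunov expectation_coin_noise(1) expectation_arrival_noise(1) ih) auto
    also have "\<dots> = expectation (lyapunov t) + 2 * ?B + 2 * (V * expectation ?h)"
      using integrable_lyapunov[of t] expectation_coin_noise[of t] expectation_arrival_noise[of t] ih
      by (simp add: prob_space)
    finally show ?thesis unfolding eh .
  qed
  have sum: "expectation (lyapunov T) \<le> 2 * ?B * real T +
      2 * (V * (\<Sum>s\<in>servers n. \<Sum>d\<in>servers n. \<Sum>t<T. u s d (expectation (aux_rate w s d t))))" for T
  proof (induction T)
    case 0
    have "lyapunov 0 \<omega> = 0" if "\<omega> \<in> space M" for \<omega>
      unfolding lyapunov_def using initially_empty[OF that] by (simp del: atLeastAtMost_iff One_nat_def)
    then have "expectation (lyapunov 0) = expectation (\<lambda>_. 0)"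
      by (intro Bochner_Integration.integral_cong) auto
    then show ?case by simp
  next
    case (Suc T)
    then show ?case using step[of T] by (simp add: sum.distrib algebra_simps)
  qed
  \<comment> \<open>The term \<open>queue_bound / real T\<close> accounts for the admission queue
    left over at time \<open>T\<close>; it vanishes in the limit.\<close>
  have avg: "0 \<le> ?B + V * (\<Sum>s\<in>servers n. \<Sum>d\<in>servers n. u s d (queue_bound / real T + a s d T))" if "T > 0" for T
  proof -
    have "(\<Sum>t<T. u s d (expectation (aux_rate w s d t))) \<le> real T * u s d (queue_bound / real T + a s d T)"
      if sd: "s \<in> servers n" "d \<in> servers n" for s d
    proof -
      have "(\<Sum>t<T. u s d (expectation (aux_rate w s d t))) =
          real T * (U s d (r s d) - U s d (\<rho> s d) - U' s d (r s d) * r s d) +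
          U' s d (r s d) * (\<Sum>t<T. expectation (aux_rate w s d t))"
        by (simp add: u_def sum.distrib sum_subtractf sum_distrib_left algebra_simps)
      also have "U' s d (r s d) * (\<Sum>t<T. expectation (aux_rate w s d t)) \<le>
          U' s d (r s d) * (queue_bound + real T * a s d T)"
        using sum_aux_rate_le[OF sd, of T] utility_derivative_nonneg[OF sd r[OF sd]] \<open>T > 0\<close>
        by (intro mult_left_mono) (auto simp: a_def)
      also have "real T * (U s d (r s d) - U s d (\<rho> s d) - U' s d (r s d) * r s d) +
          U' s d (r s d) * (queue_bound + real T * a s d T) = real T * u s d (queue_bound / real T + a s d T)"
        using \<open>T > 0\<close> by (simp add: u_def algebra_simps)
      finally show ?thesis by simp
    qed
    then have "(\<Sum>s\<in>servers n. \<Sum>d\<in>servers n. \<Sum>t<T. u s d (expectation (aux_rate w s d t))) \<le>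
        (\<Sum>s\<in>servers n. \<Sum>d\<in>servers n. real T * u s d (queue_bound / real T + a s d T))"
      by (intro sum_mono)
    also have "\<dots> = real T * (\<Sum>s\<in>servers n. \<Sum>d\<in>servers n. u s d (queue_bound / real T + a s d T))"
      by (simp only: sum_distrib_left)
    finally have "V * (\<Sum>s\<in>servers n. \<Sum>d\<in>servers n. \<Sum>t<T. u s d (expectation (aux_rate w s d t))) \<le>
        V * (real T * (\<Sum>s\<in>servers n. \<Sum>d\<in>servers n. u s d (queue_bound / real T + a s d T)))"
      using V_pos by (intro mult_left_mono) auto
    moreover have "0 \<le> expectation (lyapunov T)"
      using lyapunov_nonneg by (intro integral_nonneg_AE) auto
    ultimately have "0 \<le> 2 * real T * (?B + V * (\<Sum>s\<in>servers n. \<Sum>d\<in>servers n. u s d (queue_bound / real T + a s d T)))"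
      using sum[of T] by (simp add: algebra_simps)
    then show ?thesis using \<open>T > 0\<close> by (simp add: zero_le_mult_iff)
  qed
  have "(\<lambda>T. queue_bound / real T) \<longlonglongrightarrow> 0" by (rule lim_const_over_n)
  then have "(\<lambda>T. u s d (queue_bound / real T + a s d T)) \<longlonglongrightarrow> u s d (0 + r s d)"
    if "s \<in> servers n" "d \<in> servers n" for s d
    unfolding u_def using a_lim[OF that] by (intro tendsto_intros)
  then have "(\<lambda>T. ?B + V * (\<Sum>s\<in>servers n. \<Sum>d\<in>servers n. u s d (queue_bound / real T + a s d T))) \<longlonglongrightarrow>
      ?B + V * (\<Sum>s\<in>servers n. \<Sum>d\<in>servers n. u s d (0 + r s d))"
    by (intro tendsto_add tendsto_const tendsto_mult tendsto_sum)
  then have "0 \<le> ?B + V * (\<Sum>s\<in>servers n. \<Sum>d\<in>servers n. u s d (0 + r s d))"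
    using avg by (intro LIMSEQ_le_const exI[of _ 1]) auto
  \<comment> \<open>At its point of contact the tangent has the value of the utility itself.\<close>
  also have "(\<Sum>s\<in>servers n. \<Sum>d\<in>servers n. u s d (0 + r s d)) = total_utility n U r - total_utility n U \<rho>"
    by (simp add: u_def total_utility_def sum_subtractf)
  finally show ?thesis using V_pos by (simp add: field_simps)
qed

text \<open>Scaling the optimum loses at most \<open>\<eta> * max_slope n U' * r_opt s d\<close> per
  flow: concavity brings in the value at 0, and the tangent at 0 bounds the distance to it. The
  rates sum to at most \<open>2 ^ n\<close>, one for each input server.\<close>

lemma utility_gap:
  assumes rate: "\<And>s d. s \<in> servers n \<Longrightarrow> d \<in> servers n \<Longrightarrow> has_average_rate M (admitted w s d) (r s d)"
    and opt: "optimal_rates M n A U r_opt"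
  shows "total_utility n U r_opt - drift_const n Amax / V - 2 ^ n * max_slope n U' * \<eta> \<le> total_utility n U r"
proof -
  have n1: "n \<ge> 1" using n_ge_2 by simp
  note cap = optimal_rates_capacity[OF n1 opt]
  define \<rho> where "\<rho> s d = (1 - \<eta>) * r_opt s d" for s d
  let ?b = "max_slope n U'"
  have slope: "U' s d 0 \<le> ?b" if "s \<in> servers n" "d \<in> servers n" for s d
    unfolding max_slope_def using that by (intro Max_ge) (auto intro!: image_eqI[of _ _ "(s, d)"])
  have b: "0 \<le> ?b"
    using slope[of 1 1] utility_derivative_nonneg[of 1 1 0] by simp
  have "total_utility n U \<rho> - drift_const n Amax / V \<le> total_utility n U r"
  proof (rule total_utility_ge[OF rate])
    show "0 \<le> \<rho> s d \<and> \<rho> s d \<le> mean_arrival s d" if "s \<in> servers n" "d \<in> servers n" for s d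
      using cap(1)[OF that] eta mult_right_mono[of "1 - \<eta>" 1 "r_opt s d"] by (simp add: \<rho>_def)
    show "(\<Sum>d\<in>servers n. \<rho> s d) \<le> 1" if "s \<in> servers n" for s
    proof -
      have "(\<Sum>d\<in>servers n. \<rho> s d) = (1 - \<eta>) * (\<Sum>d\<in>servers n. r_opt s d)"
        by (simp add: \<rho>_def sum_distrib_left)
      also have "\<dots> \<le> 1 * 1"
        using cap(1,2)[OF that] eta by (intro mult_mono sum_nonneg) auto
      finally show ?thesis by simp
    qed
    show "(\<Sum>s\<in>servers n. \<rho> s d) \<le> 1 - \<eta>" if "d \<in> servers n" for d
      using mult_left_mono[OF cap(3)[OF that], of "1 - \<eta>"] eta by (simp add: \<rho>_def sum_distrib_left)
  qed
  moreover have "total_utility n U r_opt - 2 ^ n * ?b * \<eta> \<le> total_utility n U \<rho>"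
  proof -
    have "U s d (r_opt s d) - ?b * \<eta> * r_opt s d \<le> U s d (\<rho> s d)" if sd: "s \<in> servers n" "d \<in> servers n" for s d
    proof -
      let ?x = "r_opt s d"
      have x: "0 \<le> ?x" using cap(1)[OF sd] by simp
      have "(1 - \<eta>) * U s d ?x + \<eta> * U s d 0 \<le> U s d (\<rho> s d)"
        using concave_onD[OF utility_concave[OF sd], of \<eta> ?x 0] x eta by (simp add: \<rho>_def)
      moreover have "\<eta> * U s d ?x \<le> \<eta> * (U s d 0 + ?b * ?x)"
      proof (rule mult_left_mono)
        have "U s d ?x \<le> U s d 0 + U' s d 0 * (?x - 0)"
          by (rule utility_le_tangent[OF sd order.refl x])
        also have "\<dots> \<le> U s d 0 + ?b * ?x"
          using slope[OF sd] x by (simp add: mult_right_mono)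
        finally show "U s d ?x \<le> U s d 0 + ?b * ?x" .
      qed (use eta in simp)
      ultimately show ?thesis by (simp add: algebra_simps)
    qed
    then have "(\<Sum>s\<in>servers n. \<Sum>d\<in>servers n. U s d (r_opt s d) - ?b * \<eta> * r_opt s d) \<le> total_utility n U \<rho>"
      unfolding total_utility_def by (intro sum_mono)
    moreover have "(\<Sum>s\<in>servers n. \<Sum>d\<in>servers n. U s d (r_opt s d) - ?b * \<eta> * r_opt s d) =
        total_utility n U r_opt - ?b * \<eta> * (\<Sum>s\<in>servers n. \<Sum>d\<in>servers n. r_opt s d)"
      by (simp only: total_utility_def sum_subtractf sum_distrib_left)
    moreover have "?b * \<eta> * (\<Sum>s\<in>servers n. \<Sum>d\<in>servers n. r_opt s d) \<le> ?b * \<eta> * 2 ^ n"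
    proof (rule mult_left_mono)
      have "(\<Sum>s\<in>servers n. \<Sum>d\<in>servers n. r_opt s d) \<le> (\<Sum>s\<in>servers n. 1)"
        by (rule sum_mono, rule cap(2))
      then show "(\<Sum>s\<in>servers n. \<Sum>d\<in>servers n. r_opt s d) \<le> 2 ^ n" by simp
    qed (use b eta in simp)
    ultimately show ?thesis by (simp add: algebra_simps)
  qed
  ultimately show ?thesis by linarith
qed

end

section \<open>Even splitting up to centred noise\<close>

text \<open>For negative \<open>x\<close> and \<open>y = - x\<close> the claim is multiplied by
  \<open>exp y\<close>; the quadratic Taylor bound then suffices because
  \<open>(1 - y + y\<^sup>2) * (1 + y + y\<^sup>2 / 2)\<close> is at least 1.\<close>

lemma exp_le_quadratic:
  fixes x :: real
  assumes "\<bar>x\<bar> \<le> 1"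
  shows "exp x \<le> 1 + x + x\<^sup>2"
proof (cases "0 \<le> x")
  case True
  then show ?thesis using exp_bound[of x] assms by simp
next
  case False
  define y where "y = - x"
  have y: "0 \<le> y" "y \<le> 1" using False assms by (auto simp: y_def)
  have "1 \<le> (1 - y + y\<^sup>2) * (1 + y + y\<^sup>2 / 2)"
  proof -
    have "(1 - y + y\<^sup>2) * (1 + y + y\<^sup>2 / 2) = 1 + y\<^sup>2 / 2 + y ^ 3 / 2 + y ^ 4 / 2"
      by (simp add: field_simps power2_eq_square power3_eq_cube power4_eq_xxxx)
    then show ?thesis using y by simp
  qed
  also have "\<dots> \<le> (1 - y + y\<^sup>2) * exp y"
    using exp_lower_Taylor_quadratic[OF y(1)] y by (intro mult_left_mono) (auto intro: add_nonneg_nonneg)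
  finally have "exp (- y) \<le> (1 - y + y\<^sup>2)"
    by (simp add: exp_minus field_simps)
  then show ?thesis by (simp add: y_def)
qed

text \<open>The sum is at most the number of terms times the largest one. This takes the place of
  independence between queues, at the price of the factor \<open>card X\<close> in the exponent; the
  1 covers the empty set.\<close>

lemma exp_sum_le:
  fixes a :: "'b \<Rightarrow> real"
  assumes "finite X"
  shows "exp (\<Sum>x\<in>X. a x) \<le> 1 + (\<Sum>x\<in>X. exp (real (card X) * a x))"
proof (cases "X = {}")
  case False
  have "Max (a ` X) \<in> a ` X" using assms False by (intro Max_in) auto
  then obtain y where y: "y \<in> X" "a y = Max (a ` X)" by auto
  have "(\<Sum>x\<in>X. a x) \<le> real (card X) * a y"
    using y assms by (intro sum_bounded_above) auto
  then have "exp (\<Sum>x\<in>X. a x) \<le> exp (real (card X) * a y)" by simp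
  also have "\<dots> \<le> (\<Sum>x\<in>X. exp (real (card X) * a x))"
    using y assms by (intro member_le_sum) auto
  finally show ?thesis by simp
qed simp

lemma sum_pow_le_geometric:
  fixes x :: real
  assumes "0 \<le> x" "x < 1"
  shows "(\<Sum>k\<le>T. x ^ (T - k)) \<le> 1 / (1 - x)"
proof -
  have "(\<Sum>k\<le>T. x ^ (T - k)) = (\<Sum>k\<le>T. x ^ k)"
    by (rule sum.reindex_bij_witness[of _ "\<lambda>k. T - k" "\<lambda>k. T - k"]) auto
  also have "\<dots> \<le> 1 / (1 - x)"
    using assms by (simp add: sum_gp0 divide_right_mono)
  finally show ?thesis .
qed

text \<open>One slot of noise multiplies the expectation by at most
  \<open>1 + (\<theta> * C)\<^sup>2\<close>: the linear term of the exponential is orthogonal to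
  everything accumulated before. The weight \<open>Y\<close> will be the exponential of the backlog
  at the start of the interval.\<close>

lemma (in grouped_backpressure) noise_exp_moment:
  assumes noise: "\<And>t. noise C t (\<zeta> t)" and \<theta>: "0 \<le> \<theta>" "\<theta> * C \<le> 1"
    and Y: "Y \<in> borel_measurable (F t0)" "\<And>\<omega>. \<omega> \<in> space M \<Longrightarrow> 0 \<le> Y \<omega> \<and> Y \<omega> \<le> B"
  shows "expectation (\<lambda>\<omega>. Y \<omega> * exp (\<theta> * (\<Sum>t\<in>{t0..<t0 + k}. \<zeta> t \<omega>))) \<le>
      expectation Y * (1 + (\<theta> * C)\<^sup>2) ^ k"
proof -
  define Z where "Z k \<omega> = Y \<omega> * exp (\<theta> * (\<Sum>t\<in>{t0..<t0 + k}. \<zeta> t \<omega>))" for k \<omega>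
  have Z_Suc: "Z (Suc k) \<omega> = Z k \<omega> * exp (\<theta> * \<zeta> (t0 + k) \<omega>)" for k \<omega>
    by (simp add: Z_def distrib_left exp_add)
  have C: "0 \<le> C" using noise_bound_nonneg[OF noise] .
  have small: "\<bar>\<theta> * \<zeta> t \<omega>\<bar> \<le> \<theta> * C" if "\<omega> \<in> space M" for t \<omega>
    using noiseD(3)[OF noise that] \<theta> by (intro abs_mult_le) auto
  have Zm: "Z k \<in> borel_measurable (F (t0 + k))" for k
  proof (induction k)
    case 0
    then show ?case using Y(1) by (simp add: Z_def[abs_def])
  next
    case (Suc k)
    have "Z k \<in> borel_measurable (F (Suc (t0 + k)))" using measurable_F_mono[OF _ Suc] by simp
    then show ?case using noiseD(1)[OF noise, of "t0 + k"] unfolding Z_Suc[abs_def] by simp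
  qed
  have Zb: "0 \<le> Z k \<omega> \<and> Z k \<omega> \<le> B * exp 1 ^ k" if \<omega>: "\<omega> \<in> space M" for k \<omega>
  proof (induction k)
    case 0
    then show ?case using Y(2)[OF \<omega>] by (simp add: Z_def)
  next
    case (Suc k)
    have "exp (\<theta> * \<zeta> (t0 + k) \<omega>) \<le> exp 1" using small[OF \<omega>, of "t0 + k"] \<theta> by simp
    then have "Z k \<omega> * exp (\<theta> * \<zeta> (t0 + k) \<omega>) \<le> B * exp 1 ^ k * exp 1"
      using Suc Y(2)[OF \<omega>] by (intro mult_mono) auto
    then show ?case using Suc by (simp add: Z_Suc mult_ac)
  qed
  have Zi: "integrable M (Z k)" for k
    using measurable_F_imp_M[OF Zm] Zb by (intro integrable_bounded[of _ "B * exp 1 ^ k"]) auto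
  have "expectation (Z k) \<le> expectation Y * (1 + (\<theta> * C)\<^sup>2) ^ k"
  proof (induction k)
    case 0
    then show ?case by (simp add: Z_def[abs_def])
  next
    case (Suc k)
    let ?z = "\<zeta> (t0 + k)"
    have Zz: "expectation (\<lambda>\<omega>. Z k \<omega> * ?z \<omega>) = 0"
      using Zb by (intro noiseD(4)[OF noise measurable_F_imp_G[OF Zm], of _ "B * exp 1 ^ k"]) auto
    have iZz: "integrable M (\<lambda>\<omega>. Z k \<omega> * ?z \<omega>)"
      using measurable_F_imp_M[OF Zm] noiseD(2,3)[OF noise] Zb
      by (intro integrable_mult_bounded[of _ _ "B * exp 1 ^ k" C]) auto
    have "Z (Suc k) \<omega> \<le> (1 + (\<theta> * C)\<^sup>2) * Z k \<omega> + \<theta> * (Z k \<omega> * ?z \<omega>)" if \<omega>: "\<omega> \<in> space M" for \<omega>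
    proof -
      have "exp (\<theta> * ?z \<omega>) \<le> 1 + \<theta> * ?z \<omega> + (\<theta> * ?z \<omega>)\<^sup>2"
        using small[OF \<omega>, of "t0 + k"] \<theta> by (intro exp_le_quadratic) auto
      also have "(\<theta> * ?z \<omega>)\<^sup>2 \<le> (\<theta> * C)\<^sup>2"
        using power_mono[OF small[OF \<omega>, of "t0 + k"] abs_ge_zero, where n = 2] by simp
      finally have "Z k \<omega> * exp (\<theta> * ?z \<omega>) \<le> Z k \<omega> * (1 + \<theta> * ?z \<omega> + (\<theta> * C)\<^sup>2)"
        using Zb[OF \<omega>] by (intro mult_left_mono) auto
      then show ?thesis by (simp add: Z_Suc algebra_simps)
    qed
    then have "expectation (Z (Suc k)) \<le> expectation (\<lambda>\<omega>. (1 + (\<theta> * C)\<^sup>2) * Z k \<omega> + \<theta> * (Z k \<omega> * ?z \<omega>))"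
      by (intro integral_mono Zi Bochner_Integration.integrable_add integrable_mult_right iZz)
    also have "\<dots> = (1 + (\<theta> * C)\<^sup>2) * expectation (Z k)"
      using Zi iZz Zz by simp
    also have "\<dots> \<le> (1 + (\<theta> * C)\<^sup>2) * (expectation Y * (1 + (\<theta> * C)\<^sup>2) ^ k)"
      using Suc by (intro mult_left_mono) auto
    finally show ?case by (simp add: algebra_simps)
  qed
  then show ?thesis unfolding Z_def .
qed

section \<open>Packets of one destination over an interval\<close>

context empty_benes_run
begin

lemma admitted_interval_le:
  assumes "\<omega> \<in> space M" "d \<in> servers n" "t0 \<le> T"
  shows "(\<Sum>t\<in>{t0..<T}. \<Sum>s\<in>servers n. real (admitted w s d t \<omega>)) \<le> queue_bound + (1 - \<eta>) * real (T - t0)"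
proof -
  have "reg_queue w d t0 \<omega> + (\<Sum>t\<in>{t0..<T}. \<Sum>s\<in>servers n. real (admitted w s d t \<omega>)) \<le>
      reg_queue w d T \<omega> + (1 - \<eta>) * real (T - t0)"
    using assms(3)
  proof (induction T rule: dec_induct)
    case (step T)
    then show ?case using update_reg_queue[OF assms(1,2), of T] by (simp add: Suc_diff_le algebra_simps)
  qed simp
  then show ?thesis using reg_queue_nonneg[OF assms(1,2), of t0] queues_bounded(5)[OF assms(1,2), of T] by linarith
qed

lemma server_sent_interval_le:
  assumes \<omega>: "\<omega> \<in> space M" and s: "s \<in> servers n" and d: "d \<in> servers n" and "t0 \<le> T"
  shows "(\<Sum>t\<in>{t0..<T}. real (server_sent w c s d t \<omega>)) \<le>
    queue_bound + (\<Sum>t\<in>{t0..<T}. if d \<in> division n c then real (admitted w s d t \<omega>) else 0)"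
proof -
  have "(\<Sum>t\<in>{t0..<T}. real (server_sent w c s d t \<omega>)) + real (server_pkts w c s d T \<omega>) =
      real (server_pkts w c s d t0 \<omega>) + (\<Sum>t\<in>{t0..<T}. if d \<in> division n c then real (admitted w s d t \<omega>) else 0)"
    using assms(4)
  proof (induction T rule: dec_induct)
    case (step T)
    have "server_sent w c s d T \<omega> \<le> server_pkts w c s d T \<omega>"
      using serve_server[OF \<omega> s, of c T] d unfolding serves_def by blast
    then show ?case using step update_server[OF \<omega> s d, of c T] by auto
  qed simp
  moreover have "real (server_pkts w c s d t0 \<omega>) \<le> queue_bound"
  proof -
    have "server_pkts w c s d t0 \<omega> \<le> server_queue n w c s t0 \<omega>"
      unfolding server_queue_def using d by (intro member_le_sum) auto
    then show ?thesis using queues_bounded(1)[OF \<omega> s, of c t0] by linarith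
  qed
  ultimately show ?thesis by linarith
qed

text \<open>Conservation over the interval, with the coin written as 1/2 plus \<open>turn\<close>.
  The packets present at \<open>t0\<close> are absorbed in \<open>queue_bound\<close>.\<close>

lemma node_sent_interval_le:
  assumes \<omega>: "\<omega> \<in> space M" and j: "j \<in> {1..n - 1}" and i: "i \<in> rows n" and d: "d \<in> servers n" and "t0 \<le> T"
  shows "(\<Sum>t\<in>{t0..<T}. real (node_sent w c l j i d t \<omega>)) \<le> queue_bound +
    (\<Sum>t\<in>{t0..<T}. real (pkts_in n w c j i d t \<omega>)) / 2 +
    (\<Sum>t\<in>{t0..<T}. real (pkts_in n w c j i d t \<omega>) * turn c l j i t \<omega>)"
proof -
  have "(\<Sum>t\<in>{t0..<T}. real (node_sent w c l j i d t \<omega>)) + real (node_pkts w c l j i d T \<omega>) =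
      real (node_pkts w c l j i d t0 \<omega>) + (\<Sum>t\<in>{t0..<T}. real (pkts_in n w c j i d t \<omega>)) / 2 +
    (\<Sum>t\<in>{t0..<T}. real (pkts_in n w c j i d t \<omega>) * turn c l j i t \<omega>)"
    using assms(5)
  proof (induction T rule: dec_induct)
    case (step T)
    have "node_sent w c l j i d T \<omega> \<le> node_pkts w c l j i d T \<omega>"
      using serve_node[OF \<omega> j i, of c l T] d unfolding serves_def by blast
    then have "real (node_pkts w c l j i d (Suc T) \<omega>) + real (node_sent w c l j i d T \<omega>) =
        real (node_pkts w c l j i d T \<omega>) + (if coin w c j i T \<omega> \<longleftrightarrow> l = Up then real (pkts_in n w c j i d T \<omega>) else 0)"
      using update_node[OF \<omega> j i d, of c l T] by auto
    also have "(if coin w c j i T \<omega> \<longleftrightarrow> l = Up then real (pkts_in n w c j i d T \<omega>) else 0) =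
        real (pkts_in n w c j i d T \<omega>) / 2 + real (pkts_in n w c j i d T \<omega>) * turn c l j i T \<omega>"
      by (simp add: turn_def)
    finally show ?case using step by (simp add: add_divide_distrib)
  qed simp
  moreover have "real (node_pkts w c l j i d t0 \<omega>) \<le> queue_bound"
  proof -
    have "node_pkts w c l j i d t0 \<omega> \<le> node_queue n w c l j i t0 \<omega>"
      unfolding node_queue_def using d by (intro member_le_sum) auto
    then show ?thesis using queues_bounded(2)[OF \<omega> j i, of c l t0] by linarith
  qed
  ultimately show ?thesis by linarith
qed

lemma first_column_interval_le:
  assumes \<omega>: "\<omega> \<in> space M" and d: "d \<in> servers n" and T: "t0 \<le> T"
  shows "(\<Sum>c\<in>{Up, Lo}. \<Sum>i\<in>rows n. \<Sum>t\<in>{t0..<T}. real (pkts_in n w c 1 i d t \<omega>)) \<le>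
    (2 * 2 ^ n + 1) * queue_bound + (1 - \<eta>) * real (T - t0)"
proof -
  have "(\<Sum>i\<in>rows n. \<Sum>t\<in>{t0..<T}. real (pkts_in n w c 1 i d t \<omega>)) =
      (\<Sum>s\<in>servers n. \<Sum>t\<in>{t0..<T}. real (server_sent w c s d t \<omega>))" for c
  proof -
    have "(\<Sum>i\<in>rows n. \<Sum>t\<in>{t0..<T}. real (pkts_in n w c 1 i d t \<omega>)) =
        (\<Sum>i\<in>rows n. \<Sum>s\<in>{s \<in> servers n. row_of s = i}. \<Sum>t\<in>{t0..<T}. real (server_sent w c s d t \<omega>))"
    proof (rule sum.cong[OF refl])
      fix i
      show "(\<Sum>t\<in>{t0..<T}. real (pkts_in n w c 1 i d t \<omega>)) =
        (\<Sum>s\<in>{s \<in> servers n. row_of s = i}. \<Sum>t\<in>{t0..<T}. real (server_sent w c s d t \<omega>))"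
        by (subst sum.swap) (simp add: pkts_in_def)
    qed
    then show ?thesis by (simp only: sum_servers_by_row)
  qed
  then have "(\<Sum>c\<in>{Up, Lo}. \<Sum>i\<in>rows n. \<Sum>t\<in>{t0..<T}. real (pkts_in n w c 1 i d t \<omega>)) =
      (\<Sum>c\<in>{Up, Lo}. \<Sum>s\<in>servers n. \<Sum>t\<in>{t0..<T}. real (server_sent w c s d t \<omega>))"
    by (simp only:)
  also have "\<dots> \<le> (\<Sum>c\<in>{Up, Lo}. \<Sum>s\<in>servers n. queue_bound +
      (\<Sum>t\<in>{t0..<T}. if d \<in> division n c then real (admitted w s d t \<omega>) else 0))"
    by (rule sum_mono, rule sum_mono, rule server_sent_interval_le[OF \<omega> _ d T])
  also have "\<dots> = 2 * 2 ^ n * queue_bound + (\<Sum>s\<in>servers n. \<Sum>t\<in>{t0..<T}.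
      \<Sum>c\<in>{Up, Lo}. if d \<in> division n c then real (admitted w s d t \<omega>) else 0)"
    by (simp add: sum.distrib)
  also have "(\<Sum>s\<in>servers n. \<Sum>t\<in>{t0..<T}. \<Sum>c\<in>{Up, Lo}. if d \<in> division n c then real (admitted w s d t \<omega>) else 0)
      \<le> (\<Sum>s\<in>servers n. \<Sum>t\<in>{t0..<T}. real (admitted w s d t \<omega>))"
  proof (rule sum_mono, rule sum_mono)
    fix s t
    \<comment> \<open>A destination belongs to one division only, so its packets are not counted
      twice.\<close>
    have "\<not> (d \<in> division n Up \<and> d \<in> division n Lo)" using division_Int[of n] by blast
    then show "(\<Sum>c\<in>{Up, Lo}. if d \<in> division n c then real (admitted w s d t \<omega>) else 0) \<le> real (admitted w s d t \<omega>)"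
      by simp
  qed
  also have "\<dots> = (\<Sum>t\<in>{t0..<T}. \<Sum>s\<in>servers n. real (admitted w s d t \<omega>))" by (rule sum.swap)
  also have "\<dots> \<le> queue_bound + (1 - \<eta>) * real (T - t0)" by (rule admitted_interval_le[OF \<omega> d T])
  finally show ?thesis by (simp add: algebra_simps)
qed

text \<open>Deviation, at row \<open>i\<close> of column \<open>k + 1\<close>, of the random splitting from an even one.\<close>

primrec split_noise :: "side \<Rightarrow> nat \<Rightarrow> nat \<Rightarrow> nat \<Rightarrow> nat \<Rightarrow> 'a \<Rightarrow> real" where
  "split_noise c d 0 i t \<omega> = 0"
| "split_noise c d (Suc k) i t \<omega> = (\<Sum>l\<in>{Up, Lo}. \<Sum>i'\<in>upstream n l (Suc (Suc k)) i.
     real (pkts_in n w c (Suc k) i' d t \<omega>) * turn c l (Suc k) i' t \<omega> + split_noise c d k i' t \<omega> / 2)"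

lemma pkts_in_le:
  assumes "\<omega> \<in> space M" "j \<in> {1..n}" "i \<in> rows n" "d \<in> servers n"
  shows "real (pkts_in n w c j i d t \<omega>) \<le> 2"
proof -
  have "pkts_in n w c j i d t \<omega> \<le> (\<Sum>d\<in>servers n. pkts_in n w c j i d t \<omega>)"
    using assms(4) by (intro member_le_sum) auto
  then show ?thesis
    using pkts_in_le_alloc[OF assms(1-3), of c t] alloc_le[OF assms(1-3), of c t] by linarith
qed

text \<open>The count \<open>2 ^ (n - 1)\<close> of predecessors is crude, but only the existence of
  some constant matters.\<close>

lemma noise_sum_upstream:
  assumes "\<And>l i'. i' \<in> rows n \<Longrightarrow> noise C t (D l i')"
  shows "noise (2 * (2 ^ (n - 1) * C)) t (\<lambda>\<omega>. \<Sum>l\<in>{Up, Lo}. \<Sum>i'\<in>upstream n l j i. D l i' \<omega>)"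
proof -
  have C: "0 \<le> C" using noise_bound_nonneg[OF assms[of 1]] by simp
  have "noise (2 ^ (n - 1) * C) t (\<lambda>\<omega>. \<Sum>i'\<in>upstream n l j i. D l i' \<omega>)" for l
  proof (rule noise_mono)
    show "noise (real (card (upstream n l j i)) * C) t (\<lambda>\<omega>. \<Sum>i'\<in>upstream n l j i. D l i' \<omega>)"
      by (rule noise_sum[OF finite_upstream], rule assms, erule subsetD[OF upstream_subset])
    have "card (upstream n l j i) \<le> card (rows n)" using upstream_subset by (intro card_mono) auto
    then have "real (card (upstream n l j i)) \<le> real (2 ^ (n - 1))" by (intro of_nat_mono) simp
    then show "real (card (upstream n l j i)) * C \<le> 2 ^ (n - 1) * C"
      using C by (intro mult_right_mono) auto
  qed
  from noise_sum[of "{Up, Lo}", OF _ this] show ?thesis by simp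
qed

lemma noise_split_noise:
  assumes "k < n"
  shows "\<exists>C. \<forall>c d i t. d \<in> servers n \<longrightarrow> i \<in> rows n \<longrightarrow> noise C t (split_noise c d k i t)"
  using assms
proof (induction k)
  case 0
  then show ?case using noise_zero by (intro exI[of _ 0]) (simp add: split_noise.simps(1)[abs_def])
next
  case (Suc k)
  obtain C where "\<forall>c d i t. d \<in> servers n \<longrightarrow> i \<in> rows n \<longrightarrow> noise C t (split_noise c d k i t)"
    using Suc.IH[OF Suc_lessD[OF Suc.prems]] by (elim exE)
  note C = this[rule_format]
  have k: "Suc k \<in> {1..n - 1}" "Suc k \<in> {1..n}" using Suc.prems by auto
  have "noise (2 * (2 ^ (n - 1) * (2 * (1 / 2) + \<bar>1 / 2\<bar> * C))) t (split_noise c d (Suc k) i t)"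
    if d: "d \<in> servers n" for c d i t
    unfolding split_noise.simps(2)[abs_def]
  proof (rule noise_sum_upstream)
    fix l i' assume i': "i' \<in> rows n"
    have "noise (2 * (1 / 2)) t (\<lambda>\<omega>. real (pkts_in n w c (Suc k) i' d t \<omega>) * turn c l (Suc k) i' t \<omega>)"
      using pkts_in_le[OF _ k(2) i' d]
      by (intro noise_mult[OF measurable_pkts_in[OF k(2) i' d] _ noise_turn[OF k(1) i']]) auto
    from noise_add[OF this noise_cmult[OF C[OF d i'], of "1 / 2"]]
    show "noise (2 * (1 / 2) + \<bar>1 / 2\<bar> * C) t (\<lambda>\<omega>. real (pkts_in n w c (Suc k) i' d t \<omega>) *
        turn c l (Suc k) i' t \<omega> + split_noise c d k i' t \<omega> / 2)" by simp
  qed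
  then show ?case by blast
qed

text \<open>Induction along the columns: the halving turns \<open>2 * real k * queue_bound\<close>
  into \<open>real k * queue_bound\<close>, the queue itself adds one \<open>queue_bound\<close>,
  and the two incoming links double the result.\<close>

lemma pkts_in_interval_le:
  assumes \<omega>: "\<omega> \<in> space M" and d: "d \<in> servers n" and T: "t0 \<le> T" and "k < n" "i \<in> rows n"
  shows "(\<Sum>t\<in>{t0..<T}. real (pkts_in n w c (Suc k) i d t \<omega>)) \<le>
    path_sum n (\<lambda>i. \<Sum>t\<in>{t0..<T}. real (pkts_in n w c 1 i d t \<omega>)) k i / 2 ^ k +
    2 * real k * queue_bound + (\<Sum>t\<in>{t0..<T}. split_noise c d k i t \<omega>)"
  using assms(4,5)
proof (induction k arbitrary: i)
  case (Suc k)
  let ?f = "\<lambda>i. \<Sum>t\<in>{t0..<T}. real (pkts_in n w c 1 i d t \<omega>)"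
  let ?m = "\<lambda>l i'. \<Sum>t\<in>{t0..<T}. real (pkts_in n w c (Suc k) i' d t \<omega>) * turn c l (Suc k) i' t \<omega> +
      split_noise c d k i' t \<omega> / 2"
  have j: "Suc k \<in> {1..n - 1}" using Suc.prems by auto
  have "(\<Sum>t\<in>{t0..<T}. real (pkts_in n w c (Suc (Suc k)) i d t \<omega>)) =
      (\<Sum>l\<in>{Up, Lo}. \<Sum>i'\<in>upstream n l (Suc (Suc k)) i. \<Sum>t\<in>{t0..<T}. real (node_sent w c l (Suc k) i' d t \<omega>))"
    by (simp add: pkts_in_def sum.distrib) (intro arg_cong2[where f = "(+)"] sum.swap)
  also have "\<dots> \<le> (\<Sum>l\<in>{Up, Lo}. \<Sum>i'\<in>upstream n l (Suc (Suc k)) i.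
      path_sum n ?f k i' / 2 ^ Suc k + real (Suc k) * queue_bound + ?m l i')"
  proof (rule sum_mono, rule sum_mono)
    fix l i' assume "i' \<in> upstream n l (Suc (Suc k)) i"
    then have i': "i' \<in> rows n" by (simp add: upstream_def)
    have e: "path_sum n ?f k i' / 2 ^ Suc k = path_sum n ?f k i' / 2 ^ k / 2"
      "real (Suc k) * queue_bound = real k * queue_bound + queue_bound"
      by (simp_all add: algebra_simps)
    have "?m l i' = (\<Sum>t\<in>{t0..<T}. real (pkts_in n w c (Suc k) i' d t \<omega>) * turn c l (Suc k) i' t \<omega>) +
        (\<Sum>t\<in>{t0..<T}. split_noise c d k i' t \<omega>) / 2"
      by (simp add: sum.distrib sum_divide_distrib)
    then show "(\<Sum>t\<in>{t0..<T}. real (node_sent w c l (Suc k) i' d t \<omega>)) \<le>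
        path_sum n ?f k i' / 2 ^ Suc k + real (Suc k) * queue_bound + ?m l i'"
      using node_sent_interval_le[OF \<omega> j i' d T, of c l] Suc.IH[OF Suc_lessD[OF Suc.prems(1)] i'] e
      by argo
  qed
  also have "\<dots> = (\<Sum>l\<in>{Up, Lo}. \<Sum>i'\<in>upstream n l (Suc (Suc k)) i. path_sum n ?f k i' / 2 ^ Suc k) +
      (\<Sum>l\<in>{Up, Lo}. \<Sum>i'\<in>upstream n l (Suc (Suc k)) i. real (Suc k) * queue_bound) +
      (\<Sum>l\<in>{Up, Lo}. \<Sum>i'\<in>upstream n l (Suc (Suc k)) i. ?m l i')"
    by (simp only: sum.distrib)
  also have "(\<Sum>l\<in>{Up, Lo}. \<Sum>i'\<in>upstream n l (Suc (Suc k)) i. path_sum n ?f k i' / 2 ^ Suc k) =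
      path_sum n ?f (Suc k) i / 2 ^ Suc k"
    by (simp only: path_sum.simps(2) sum_divide_distrib)
  also have "(\<Sum>l\<in>{Up, Lo}. \<Sum>i'\<in>upstream n l (Suc (Suc k)) i. ?m l i') =
      (\<Sum>t\<in>{t0..<T}. split_noise c d (Suc k) i t \<omega>)"
    unfolding split_noise.simps(2)
    by (subst sum.swap, rule sum.cong[OF refl], rule sum.swap)
  also have "(\<Sum>l\<in>{Up, Lo}. \<Sum>i'\<in>upstream n l (Suc (Suc k)) i. real (Suc k) * queue_bound) \<le>
      2 * (real (Suc k) * queue_bound)"
    using Suc.prems queue_bound_nonneg by (intro sum_upstream_le) auto
  finally show ?case by (simp only: mult.assoc)
qed simp

end

section \<open>The FIFO queues\<close>

context empty_benes_run
begin

abbreviation "fifo_length l j i t \<omega> \<equiv> real (length (fifo_queue w l j i t \<omega>))"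

text \<open>Only columns strictly before \<open>j\<close> count, so it vanishes for
  \<open>j = n\<close>, the base of the inductions over columns.\<close>

definition fifo_backlog :: "nat \<Rightarrow> nat \<Rightarrow> 'a \<Rightarrow> real" where
  "fifo_backlog j t \<omega> = (\<Sum>j'\<in>{n..<j}. \<Sum>i\<in>rows n. \<Sum>l\<in>{Up, Lo}. fifo_length l j' i t \<omega>)"

lemma fifo_backlog_nonneg: "0 \<le> fifo_backlog j t \<omega>"
  unfolding fifo_backlog_def by (intro sum_nonneg) auto

lemma reachable_outputs_facts:
  assumes "j \<in> {n..2 * n - 1}" "i \<in> rows n"
  shows "reachable_outputs n l j i \<subseteq> servers n" "finite (reachable_outputs n l j i)"
    "card (reachable_outputs n l j i) \<le> 2 ^ (2 * n - 1 - j)"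
proof -
  show 1: "reachable_outputs n l j i \<subseteq> servers n" "card (reachable_outputs n l j i) \<le> 2 ^ (2 * n - 1 - j)"
    using reachable_outputs_bounds[of n j i l] assms n_ge_2 by auto
  show "finite (reachable_outputs n l j i)" using 1(1) by (rule finite_subset) simp
qed

text \<open>The second part is an inequality because packets whose destination is not behind this
  link do not join its queue.\<close>

lemma fifo_step:
  assumes "\<omega> \<in> space M" "j \<in> {n..2 * n - 1}" "i \<in> rows n"
  shows "length (fifo_queue w l j i (Suc t) \<omega>) = length (fifo_queue w l j i t \<omega>) - 1 +
      (\<Sum>d\<in>reachable_outputs n l j i. fifo_in n w j i d t \<omega>)"
    and "count_list (fifo_queue w l j i (Suc t) \<omega>) d +
      (if fifo_queue w l j i t \<omega> \<noteq> [] \<and> hd (fifo_queue w l j i t \<omega>) = d then 1 else 0) \<le>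
      count_list (fifo_queue w l j i t \<omega>) d + fifo_in n w j i d t \<omega>"
proof -
  obtain new where new: "fifo_queue w l j i (Suc t) \<omega> = tl (fifo_queue w l j i t \<omega>) @ new"
    "\<And>d. count_list new d = (if d \<in> reachable_outputs n l j i then fifo_in n w j i d t \<omega> else 0)"
    using update_fifo_queue[OF assms, of l t] by (elim exE conjE) blast
  have "set new \<subseteq> reachable_outputs n l j i"
  proof
    fix d assume "d \<in> set new"
    then have "count_list new d \<noteq> 0" by (simp add: count_list_0_iff)
    then show "d \<in> reachable_outputs n l j i" using new(2)[of d] by (auto split: if_splits)
  qed
  then have "length new = (\<Sum>d\<in>reachable_outputs n l j i. count_list new d)"
    using reachable_outputs_facts(2)[OF assms(2,3)] by (simp add: sum_count_set)
  also have "\<dots> = (\<Sum>d\<in>reachable_outputs n l j i. fifo_in n w j i d t \<omega>)"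
    using new(2) by (intro sum.cong) auto
  finally show "length (fifo_queue w l j i (Suc t) \<omega>) = length (fifo_queue w l j i t \<omega>) - 1 +
      (\<Sum>d\<in>reachable_outputs n l j i. fifo_in n w j i d t \<omega>)"
    using new(1) by simp
  have tl: "count_list (tl xs) d + (if xs \<noteq> [] \<and> hd xs = d then 1 else 0) = count_list xs d" for xs :: "nat list"
    by (cases xs) auto
  have "count_list new d \<le> fifo_in n w j i d t \<omega>" using new(2)[of d] by simp
  then show "count_list (fifo_queue w l j i (Suc t) \<omega>) d +
      (if fifo_queue w l j i t \<omega> \<noteq> [] \<and> hd (fifo_queue w l j i t \<omega>) = d then 1 else 0) \<le>
      count_list (fifo_queue w l j i t \<omega>) d + fifo_in n w j i d t \<omega>"
    unfolding new(1) count_list_append using tl[of "fifo_queue w l j i t \<omega>"] by linarith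
qed

definition departs :: "side \<Rightarrow> nat \<Rightarrow> nat \<Rightarrow> nat \<Rightarrow> nat \<Rightarrow> 'a \<Rightarrow> real" where
  "departs l j i d t \<omega> =
     (if fifo_queue w l j i t \<omega> \<noteq> [] \<and> hd (fifo_queue w l j i t \<omega>) = d then 1 else 0)"

text \<open>Nothing is known about the destinations waiting at \<open>t0\<close>; the full length of
  the queue stands in for the packets for \<open>d\<close> among them.\<close>

lemma departs_interval_le:
  assumes \<omega>: "\<omega> \<in> space M" "j \<in> {n..2 * n - 1}" "i \<in> rows n" and "t0 \<le> T"
  shows "(\<Sum>t\<in>{t0..<T}. departs l j i d t \<omega>) \<le>
    fifo_length l j i t0 \<omega> + (\<Sum>t\<in>{t0..<T}. real (fifo_in n w j i d t \<omega>))"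
proof -
  have one: "real (count_list (fifo_queue w l j i (Suc t) \<omega>) d) + departs l j i d t \<omega> \<le>
      real (count_list (fifo_queue w l j i t \<omega>) d) + real (fifo_in n w j i d t \<omega>)" for t
    using of_nat_mono[OF fifo_step(2)[OF \<omega>, of l t d], where 'a = real]
    by (auto simp: departs_def split: if_splits)
  have "(\<Sum>t\<in>{t0..<T}. departs l j i d t \<omega>) + real (count_list (fifo_queue w l j i T \<omega>) d) \<le>
      real (count_list (fifo_queue w l j i t0 \<omega>) d) + (\<Sum>t\<in>{t0..<T}. real (fifo_in n w j i d t \<omega>))"
    using assms(4)
  proof (induction T rule: dec_induct)
    case (step T)
    then show ?case using one[of T] by simp
  qed simp
  moreover have "real (count_list (fifo_queue w l j i t0 \<omega>) d) \<le> fifo_length l j i t0 \<omega>"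
    using count_le_length[of "fifo_queue w l j i t0 \<omega>" d] by simp
  moreover have "0 \<le> real (count_list (fifo_queue w l j i T \<omega>) d)" by simp
  ultimately show ?thesis by argo
qed

lemma fifo_in_Suc:
  "n \<le> j \<Longrightarrow> real (fifo_in n w (Suc j) i d t \<omega>) =
    (\<Sum>l\<in>{Up, Lo}. \<Sum>i'\<in>upstream n l (Suc j) i. departs l j i' d t \<omega>)"
  by (simp add: fifo_in_def departs_def if_distrib[of real] cong: if_cong)

lemma fifo_in_le:
  assumes \<omega>: "\<omega> \<in> space M" and j: "j \<in> {n..2 * n - 1}" and i: "i \<in> rows n" and d: "d \<in> servers n"
  shows "real (fifo_in n w j i d t \<omega>) \<le> 4"
proof (cases "j = n")
  case True
  have "n \<in> {1..n}" using n_ge_2 by simp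
  from pkts_in_le[OF \<omega> this i d, of Up t] pkts_in_le[OF \<omega> this i d, of Lo t]
  show ?thesis using True by (simp add: fifo_in_def)
next
  case False
  then obtain k where k: "j = Suc k" "n \<le> k" using j by (cases j) auto
  have "real (fifo_in n w j i d t \<omega>) = (\<Sum>l\<in>{Up, Lo}. \<Sum>i'\<in>upstream n l j i. departs l k i' d t \<omega>)"
    using fifo_in_Suc[OF k(2)] k by simp
  also have "\<dots> \<le> 2 * 1"
    using j k i n_ge_2 by (intro sum_upstream_le) (auto simp: departs_def)
  finally show ?thesis by simp
qed

text \<open>
  The mean rate \<open>(1 - \<eta>) * 2 ^ (j - n) / 2 ^ (n - 1)\<close> of the packets with a given destination in
  column \<open>j\<close> doubles from column to column, while the number of destinations of a link is halved.
\<close>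

lemma fifo_in_interval_le:
  assumes "n \<le> j" "j \<le> 2 * n - 1"
  shows "\<exists>K C \<zeta>. 0 \<le> K \<and> (\<forall>i d t. i \<in> rows n \<longrightarrow> d \<in> servers n \<longrightarrow> noise C t (\<zeta> i d t)) \<and>
    (\<forall>i d t0 T \<omega>. i \<in> rows n \<longrightarrow> d \<in> servers n \<longrightarrow> \<omega> \<in> space M \<longrightarrow> t0 \<le> T \<longrightarrow>
      (\<Sum>t\<in>{t0..<T}. real (fifo_in n w j i d t \<omega>)) \<le>
        K * (1 + fifo_backlog j t0 \<omega>) + (1 - \<eta>) * 2 ^ (j - n) / 2 ^ (n - 1) * real (T - t0) +
        (\<Sum>t\<in>{t0..<T}. \<zeta> i d t \<omega>))"
  using assms
proof (induction j rule: dec_induct)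
  case base
  have n1: "n - 1 < n" "Suc (n - 1) = n" using n_ge_2 by auto
  obtain C where "\<forall>c d i t. d \<in> servers n \<longrightarrow> i \<in> rows n \<longrightarrow> noise C t (split_noise c d (n - 1) i t)"
    using noise_split_noise[OF n1(1)] by (elim exE)
  note C = this[rule_format]
  define \<zeta> where "\<zeta> i d t \<omega> = (\<Sum>c\<in>{Up, Lo}. split_noise c d (n - 1) i t \<omega>)" for i d t \<omega>
  \<comment> \<open>The first term is the error from the server and regulation queues, shared evenly
    by the partition nodes; the second collects the queues of columns 1 to \<open>n - 1\<close> for
    both divisions.\<close>
  define K where "K = (2 * 2 ^ n + 1) * queue_bound / 2 ^ (n - 1) + 2 * (2 * real (n - 1) * queue_bound)"
  have "noise (2 * C) t (\<zeta> i d t)" if "i \<in> rows n" "d \<in> servers n" for i d t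
    using noise_sum[of "{Up, Lo}" C t "\<lambda>c. split_noise c d (n - 1) i t"] C[OF that(2,1)]
    unfolding \<zeta>_def[abs_def] by simp
  moreover have "0 \<le> K" unfolding K_def using queue_bound_nonneg by (intro add_nonneg_nonneg) auto
  moreover have "(\<Sum>t\<in>{t0..<T}. real (fifo_in n w n i d t \<omega>)) \<le>
        K * (1 + fifo_backlog n t0 \<omega>) + (1 - \<eta>) * 2 ^ (n - n) / 2 ^ (n - 1) * real (T - t0) +
        (\<Sum>t\<in>{t0..<T}. \<zeta> i d t \<omega>)"
    if i: "i \<in> rows n" and d: "d \<in> servers n" and \<omega>: "\<omega> \<in> space M" and T: "t0 \<le> T" for i d t0 T \<omega>
  proof -
    let ?f = "\<lambda>c i. \<Sum>t\<in>{t0..<T}. real (pkts_in n w c 1 i d t \<omega>)"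
    have ps: "path_sum n (?f c) (n - 1) i = (\<Sum>i\<in>rows n. ?f c i)" for c
      using path_sum_partition[of i "n - 1" "?f c"] i n1 by simp
    have "(\<Sum>t\<in>{t0..<T}. real (fifo_in n w n i d t \<omega>)) =
        (\<Sum>c\<in>{Up, Lo}. \<Sum>t\<in>{t0..<T}. real (pkts_in n w c n i d t \<omega>))"
      by (simp add: fifo_in_def sum.distrib)
    also have "\<dots> \<le> (\<Sum>c\<in>{Up, Lo}. (\<Sum>i\<in>rows n. ?f c i) / 2 ^ (n - 1) +
        2 * real (n - 1) * queue_bound + (\<Sum>t\<in>{t0..<T}. split_noise c d (n - 1) i t \<omega>))"
      using pkts_in_interval_le[OF \<omega> d T n1(1) i] unfolding n1(2) ps by (intro sum_mono)
    also have "\<dots> = (\<Sum>c\<in>{Up, Lo}. \<Sum>i\<in>rows n. ?f c i) / 2 ^ (n - 1) +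
        2 * (2 * real (n - 1) * queue_bound) + (\<Sum>t\<in>{t0..<T}. \<zeta> i d t \<omega>)"
      unfolding \<zeta>_def by (simp add: sum.distrib add_divide_distrib)
    also have "(\<Sum>c\<in>{Up, Lo}. \<Sum>i\<in>rows n. ?f c i) / 2 ^ (n - 1) \<le>
        ((2 * 2 ^ n + 1) * queue_bound + (1 - \<eta>) * real (T - t0)) / 2 ^ (n - 1)"
      using first_column_interval_le[OF \<omega> d T] by (intro divide_right_mono) auto
    finally show ?thesis by (simp add: K_def fifo_backlog_def add_divide_distrib)
  qed
  ultimately show ?case by (intro exI[of _ K] exI[of _ "2 * C"] exI[of _ \<zeta>]) blast
next
  case (step j)
  have jm: "j \<in> {n..2 * n - 1}" "j \<le> 2 * n - 1" using step by auto
  from step.IH[OF jm(2)] obtain K C \<zeta> where K: "0 \<le> K"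
    and N: "\<forall>i d t. i \<in> rows n \<longrightarrow> d \<in> servers n \<longrightarrow> noise C t (\<zeta> i d t)"
    and L: "\<forall>i d t0 T \<omega>. i \<in> rows n \<longrightarrow> d \<in> servers n \<longrightarrow> \<omega> \<in> space M \<longrightarrow> t0 \<le> T \<longrightarrow>
      (\<Sum>t\<in>{t0..<T}. real (fifo_in n w j i d t \<omega>)) \<le>
        K * (1 + fifo_backlog j t0 \<omega>) + (1 - \<eta>) * 2 ^ (j - n) / 2 ^ (n - 1) * real (T - t0) +
        (\<Sum>t\<in>{t0..<T}. \<zeta> i d t \<omega>)"
    by (elim exE conjE)
  note N = N[rule_format] and L = L[rule_format]
  define \<zeta>' where "\<zeta>' i d t \<omega> = (\<Sum>l\<in>{Up, Lo}. \<Sum>i'\<in>upstream n l (Suc j) i. \<zeta> i' d t \<omega>)" for i d t \<omega>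
  have "noise (2 * (2 ^ (n - 1) * C)) t (\<zeta>' i d t)" if "d \<in> servers n" for i d t
    unfolding \<zeta>'_def[abs_def] by (intro noise_sum_upstream N that)
  \<comment> \<open>Two incoming links double \<open>K\<close>; the extra 1 pays for the queues of
    column \<open>j\<close>, which are part of \<open>fifo_backlog (Suc j)\<close>.\<close>
  moreover have "(\<Sum>t\<in>{t0..<T}. real (fifo_in n w (Suc j) i d t \<omega>)) \<le>
        (2 * K + 1) * (1 + fifo_backlog (Suc j) t0 \<omega>) +
        (1 - \<eta>) * 2 ^ (Suc j - n) / 2 ^ (n - 1) * real (T - t0) + (\<Sum>t\<in>{t0..<T}. \<zeta>' i d t \<omega>)"
    if i: "i \<in> rows n" and d: "d \<in> servers n" and \<omega>: "\<omega> \<in> space M" and T: "t0 \<le> T" for i d t0 T \<omega>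
  proof -
    let ?k = "K * (1 + fifo_backlog j t0 \<omega>) + (1 - \<eta>) * 2 ^ (j - n) / 2 ^ (n - 1) * real (T - t0)"
    have k: "0 \<le> ?k" using K fifo_backlog_nonneg[of j t0 \<omega>] eta by (intro add_nonneg_nonneg) auto
    have "(\<Sum>t\<in>{t0..<T}. real (fifo_in n w (Suc j) i d t \<omega>)) =
        (\<Sum>l\<in>{Up, Lo}. \<Sum>i'\<in>upstream n l (Suc j) i. \<Sum>t\<in>{t0..<T}. departs l j i' d t \<omega>)"
      unfolding fifo_in_Suc[OF step.hyps(1)]
      by (subst sum.swap, rule sum.cong[OF refl], rule sum.swap)
    also have "\<dots> \<le> (\<Sum>l\<in>{Up, Lo}. \<Sum>i'\<in>upstream n l (Suc j) i.
        fifo_length l j i' t0 \<omega> + ?k + (\<Sum>t\<in>{t0..<T}. \<zeta> i' d t \<omega>))"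
    proof (rule sum_mono, rule sum_mono)
      fix l i' assume "i' \<in> upstream n l (Suc j) i"
      then have i': "i' \<in> rows n" by (simp add: upstream_def)
      show "(\<Sum>t\<in>{t0..<T}. departs l j i' d t \<omega>) \<le> fifo_length l j i' t0 \<omega> + ?k + (\<Sum>t\<in>{t0..<T}. \<zeta> i' d t \<omega>)"
        using departs_interval_le[OF \<omega> jm(1) i' T, of l d] L[OF i' d \<omega> T] by argo
    qed
    also have "\<dots> = (\<Sum>l\<in>{Up, Lo}. \<Sum>i'\<in>upstream n l (Suc j) i. fifo_length l j i' t0 \<omega>) +
        (\<Sum>l\<in>{Up, Lo}. \<Sum>i'\<in>upstream n l (Suc j) i. ?k) +
        (\<Sum>l\<in>{Up, Lo}. \<Sum>i'\<in>upstream n l (Suc j) i. \<Sum>t\<in>{t0..<T}. \<zeta> i' d t \<omega>)"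
      by (simp only: sum.distrib)
    finally have A: "(\<Sum>t\<in>{t0..<T}. real (fifo_in n w (Suc j) i d t \<omega>)) \<le>
        (\<Sum>l\<in>{Up, Lo}. \<Sum>i'\<in>upstream n l (Suc j) i. fifo_length l j i' t0 \<omega>) +
        (\<Sum>l\<in>{Up, Lo}. \<Sum>i'\<in>upstream n l (Suc j) i. ?k) +
        (\<Sum>l\<in>{Up, Lo}. \<Sum>i'\<in>upstream n l (Suc j) i. \<Sum>t\<in>{t0..<T}. \<zeta> i' d t \<omega>)" .
    have B: "(\<Sum>l\<in>{Up, Lo}. \<Sum>i'\<in>upstream n l (Suc j) i. \<Sum>t\<in>{t0..<T}. \<zeta> i' d t \<omega>) =
        (\<Sum>t\<in>{t0..<T}. \<zeta>' i d t \<omega>)"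
      unfolding \<zeta>'_def by (subst sum.swap, rule sum.cong[OF refl], rule sum.swap)
    have C: "(\<Sum>l\<in>{Up, Lo}. \<Sum>i'\<in>upstream n l (Suc j) i. ?k) \<le> 2 * ?k"
      using jm step.prems i k by (intro sum_upstream_le) (auto simp: n_ge_2)
    have "(\<Sum>l\<in>{Up, Lo}. \<Sum>i'\<in>upstream n l (Suc j) i. fifo_length l j i' t0 \<omega>) \<le>
        (\<Sum>l\<in>{Up, Lo}. \<Sum>i'\<in>rows n. fifo_length l j i' t0 \<omega>)"
      using upstream_subset by (intro sum_mono sum_mono2) auto
    also have "\<dots> = fifo_backlog (Suc j) t0 \<omega> - fifo_backlog j t0 \<omega>"
      unfolding fifo_backlog_def using step.hyps by (simp add: sum.distrib)
    finally have "(\<Sum>l\<in>{Up, Lo}. \<Sum>i'\<in>upstream n l (Suc j) i. fifo_length l j i' t0 \<omega>) \<le>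
        fifo_backlog (Suc j) t0 \<omega> - fifo_backlog j t0 \<omega>" .
    with A B C have "(\<Sum>t\<in>{t0..<T}. real (fifo_in n w (Suc j) i d t \<omega>)) \<le>
        fifo_backlog (Suc j) t0 \<omega> - fifo_backlog j t0 \<omega> + 2 * ?k + (\<Sum>t\<in>{t0..<T}. \<zeta>' i d t \<omega>)" by argo
    moreover have "2 * ?k = 2 * K * (1 + fifo_backlog j t0 \<omega>) +
        (1 - \<eta>) * 2 ^ (Suc j - n) / 2 ^ (n - 1) * real (T - t0)"
      using step.hyps by (simp add: Suc_diff_le algebra_simps)
    moreover have "fifo_backlog j t0 \<omega> \<le> fifo_backlog (Suc j) t0 \<omega>"
      unfolding fifo_backlog_def using step.hyps by (simp add: sum_nonneg)
    then have "2 * K * (1 + fifo_backlog j t0 \<omega>) \<le> 2 * K * (1 + fifo_backlog (Suc j) t0 \<omega>)"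
      using K by (intro mult_left_mono) auto
    moreover have "(2 * K + 1) * (1 + fifo_backlog (Suc j) t0 \<omega>) =
        2 * K * (1 + fifo_backlog (Suc j) t0 \<omega>) + 1 + fifo_backlog (Suc j) t0 \<omega>"
      by (simp add: algebra_simps)
    ultimately show ?thesis using fifo_backlog_nonneg[of j t0 \<omega>] by argo
  qed
  ultimately show ?case
    using K by (intro exI[of _ "2 * K + 1"] exI[of _ "2 * (2 ^ (n - 1) * C)"] exI[of _ \<zeta>']) auto
qed

text \<open>The classical busy-period bound: for positive \<open>T\<close>, \<open>t0\<close> is the
  last slot before \<open>T\<close> in which the queue was empty. The 1 makes up for the service
  wasted in that slot.\<close>

lemma fifo_length_le_supremum:
  assumes \<omega>: "\<omega> \<in> space M" "j \<in> {n..2 * n - 1}" "i \<in> rows n"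
  shows "\<exists>t0\<le>T. fifo_length l j i T \<omega> \<le>
    1 + (\<Sum>t\<in>{t0..<T}. \<Sum>d\<in>reachable_outputs n l j i. real (fifo_in n w j i d t \<omega>)) - real (T - t0)"
proof (induction T)
  case 0
  then show ?case using initially_empty(6)[OF \<omega>] by simp
next
  case (Suc T)
  let ?a = "\<lambda>t. \<Sum>d\<in>reachable_outputs n l j i. real (fifo_in n w j i d t \<omega>)"
  have step: "fifo_length l j i (Suc T) \<omega> = real (length (fifo_queue w l j i T \<omega>) - 1) + ?a T"
    using fifo_step(1)[OF \<omega>, of l T] by simp
  show ?case
  proof (cases "fifo_queue w l j i T \<omega> = []")
    case True
    then show ?thesis using step by (intro exI[of _ T]) simp
  next
    case False
    from Suc obtain t0 where t0: "t0 \<le> T"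
      "fifo_length l j i T \<omega> \<le> 1 + (\<Sum>t\<in>{t0..<T}. ?a t) - real (T - t0)" by blast
    have "real (length (fifo_queue w l j i T \<omega>) - 1) = fifo_length l j i T \<omega> - 1"
      using False by (cases "fifo_queue w l j i T \<omega>") auto
    then have "fifo_length l j i (Suc T) \<omega> \<le> 1 + (\<Sum>t\<in>{t0..<Suc T}. ?a t) - real (Suc T - t0)"
      using step t0 by (simp add: Suc_diff_le)
    then show ?thesis using t0(1) by (intro exI[of _ t0]) simp
  qed
qed

lemma fifo_length_le_linear:
  assumes \<omega>: "\<omega> \<in> space M" "j \<in> {n..2 * n - 1}" "i \<in> rows n"
  shows "fifo_length l j i t \<omega> \<le> real t * (4 * 2 ^ n)"
proof (induction t)
  case 0
  then show ?case using initially_empty(6)[OF \<omega>] by simp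
next
  case (Suc t)
  let ?O = "reachable_outputs n l j i"
  note O = reachable_outputs_facts[OF \<omega>(2,3), of l]
  have "(\<Sum>d\<in>?O. real (fifo_in n w j i d t \<omega>)) \<le> real (card ?O) * 4"
    using fifo_in_le[OF \<omega>] O(1) by (intro sum_bounded_above) blast
  also have "card ?O \<le> 2 ^ n"
    using card_mono[OF _ O(1)] by simp
  then have "real (card ?O) * 4 \<le> real (2 ^ n) * 4" by (intro mult_right_mono of_nat_mono) auto
  finally have "(\<Sum>d\<in>?O. real (fifo_in n w j i d t \<omega>)) \<le> 4 * 2 ^ n" by simp
  moreover have "fifo_length l j i (Suc t) \<omega> \<le> fifo_length l j i t \<omega> + (\<Sum>d\<in>?O. real (fifo_in n w j i d t \<omega>))"
    using fifo_step(1)[OF \<omega>, of l t] by simp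
  ultimately show ?case using Suc by (simp add: algebra_simps)
qed

lemma measurable_fifo_length: "j \<in> {n..2 * n - 1} \<Longrightarrow> i \<in> rows n \<Longrightarrow>
    (\<lambda>\<omega>. fifo_length l j i t \<omega>) \<in> borel_measurable (F t)"
  by (rule measurable_compose[OF packets_adapted(4)]) auto

lemma integrable_exp_fifo_length:
  assumes "j \<in> {n..2 * n - 1}" "i \<in> rows n" "0 \<le> \<theta>"
  shows "integrable M (\<lambda>\<omega>. exp (\<theta> * fifo_length l j i t \<omega>))"
  using measurable_F_imp_M[OF measurable_fifo_length[OF assms(1,2), of l t]]
    fifo_length_le_linear[OF _ assms(1,2), of _ l t] assms(3)
  by (intro integrable_bounded[of _ "exp (\<theta> * (real t * (4 * 2 ^ n)))"]) (auto intro!: mult_left_mono)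

end

section \<open>Exponential moments, column by column\<close>

context empty_benes_run
begin

text \<open>The queues of different links are dependent, so their joint moment is reduced to single
  ones by \<open>exp_sum_le\<close>; the exponent grows by the number of queues.\<close>

lemma expectation_exp_backlog_le:
  assumes j: "n \<le> j" "j \<le> 2 * n" and a: "0 \<le> a"
    and B: "\<And>j' i l. j' \<in> {n..<j} \<Longrightarrow> i \<in> rows n \<Longrightarrow>
      expectation (\<lambda>\<omega>. exp (a * real (card ({n..<j} \<times> rows n \<times> {Up, Lo})) * fifo_length l j' i t \<omega>)) \<le> B"
  shows "expectation (\<lambda>\<omega>. exp (a * fifo_backlog j t \<omega>)) \<le> 1 + real (card ({n..<j} \<times> rows n \<times> {Up, Lo})) * B"
    and "\<And>\<omega>. \<omega> \<in> space M \<Longrightarrow> exp (a * fifo_backlog j t \<omega>) \<le>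
      exp (a * (real (card ({n..<j} \<times> rows n \<times> {Up, Lo})) * (real t * (4 * 2 ^ n))))"
    and "(\<lambda>\<omega>. exp (a * fifo_backlog j t \<omega>)) \<in> borel_measurable (F t)"
proof -
  define X where "X = {n..<j} \<times> rows n \<times> {Up, Lo}"
  define q where "q x \<omega> = (case x of (j', i, l) \<Rightarrow> fifo_length l j' i t \<omega>)" for x \<omega>
  let ?m = "real (card X)"
  have fin: "finite X" by (simp add: X_def)
  have X: "fst x \<in> {n..<j}" "fst x \<in> {n..2 * n - 1}" "fst (snd x) \<in> rows n" if "x \<in> X" for x
    using that j by (auto simp: X_def)
  have q: "q x \<omega> = fifo_length (snd (snd x)) (fst x) (fst (snd x)) t \<omega>" for x \<omega>
    by (simp add: q_def case_prod_beta)
  have S: "fifo_backlog j t \<omega> = (\<Sum>x\<in>X. q x \<omega>)" for \<omega>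
    unfolding fifo_backlog_def X_def q_def by (simp only: sum.cartesian_product)
  have qm: "q x \<in> borel_measurable (F t)" if "x \<in> X" for x
    unfolding q[abs_def] by (rule measurable_fifo_length[OF X(2,3)[OF that]])
  show meas: "(\<lambda>\<omega>. exp (a * fifo_backlog j t \<omega>)) \<in> borel_measurable (F t)"
    unfolding S
    using measurable_compose[OF borel_measurable_sum[of X q "F t", OF qm], of "\<lambda>x. exp (a * x)" borel] by simp
  have bound: "exp (a * fifo_backlog j t \<omega>) \<le> exp (a * (?m * (real t * (4 * 2 ^ n))))" if \<omega>: "\<omega> \<in> space M" for \<omega>
  proof -
    have "(\<Sum>x\<in>X. q x \<omega>) \<le> ?m * (real t * (4 * 2 ^ n))"
      unfolding q using fifo_length_le_linear[OF \<omega> X(2,3)] by (intro sum_bounded_above)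
    then show ?thesis unfolding S using a by (simp add: mult_left_mono)
  qed
  then show "\<And>\<omega>. \<omega> \<in> space M \<Longrightarrow> exp (a * fifo_backlog j t \<omega>) \<le>
      exp (a * (real (card ({n..<j} \<times> rows n \<times> {Up, Lo})) * (real t * (4 * 2 ^ n))))"
    unfolding X_def .
  have i1: "integrable M (\<lambda>\<omega>. exp (a * fifo_backlog j t \<omega>))"
    using measurable_F_imp_M[OF meas] bound by (intro integrable_bounded) auto
  have i2: "integrable M (\<lambda>\<omega>. exp (a * ?m * q x \<omega>))" if "x \<in> X" for x
    unfolding q using a by (intro integrable_exp_fifo_length X[OF that]) simp
  have "expectation (\<lambda>\<omega>. exp (a * fifo_backlog j t \<omega>)) \<le> expectation (\<lambda>\<omega>. 1 + (\<Sum>x\<in>X. exp (a * ?m * q x \<omega>)))"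
  proof (rule integral_mono[OF i1])
    show "integrable M (\<lambda>\<omega>. 1 + (\<Sum>x\<in>X. exp (a * ?m * q x \<omega>)))"
      by (intro Bochner_Integration.integrable_add Bochner_Integration.integrable_sum i2) auto
    show "exp (a * fifo_backlog j t \<omega>) \<le> 1 + (\<Sum>x\<in>X. exp (a * ?m * q x \<omega>))" for \<omega>
      using exp_sum_le[OF fin, of "\<lambda>x. a * q x \<omega>"] unfolding S sum_distrib_left by (simp add: mult_ac)
  qed
  also have "\<dots> = 1 + (\<Sum>x\<in>X. expectation (\<lambda>\<omega>. exp (a * ?m * q x \<omega>)))"
    using i2 by (simp add: prob_space)
  also have "(\<Sum>x\<in>X. expectation (\<lambda>\<omega>. exp (a * ?m * q x \<omega>))) \<le> ?m * B"
    unfolding q using B[OF X(1,3)] unfolding X_def[symmetric] by (intro sum_bounded_above)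
  finally show "expectation (\<lambda>\<omega>. exp (a * fifo_backlog j t \<omega>)) \<le>
      1 + real (card ({n..<j} \<times> rows n \<times> {Up, Lo})) * B" by (simp add: X_def)
qed

text \<open>The rate per destination times the number of destinations behind a link is at most
  \<open>1 - \<eta>\<close>, against a service rate of 1; this leaves the drift
  \<open>- \<eta>\<close>. \<open>K\<close> and \<open>C\<close> are chosen before the link and the
  row so that one exponent will do for a whole column.\<close>

lemma fifo_length_le_backlog:
  assumes "n \<le> j" "j \<le> 2 * n - 1"
  shows "\<exists>K C. 0 \<le> K \<and> (\<forall>l i. i \<in> rows n \<longrightarrow> (\<exists>\<zeta>. (\<forall>t. noise C t (\<zeta> t)) \<and>
    (\<forall>T \<omega>. \<omega> \<in> space M \<longrightarrow> (\<exists>t0\<le>T. fifo_length l j i T \<omega> \<le>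
       1 + K * (1 + fifo_backlog j t0 \<omega>) - \<eta> * real (T - t0) + (\<Sum>t\<in>{t0..<T}. \<zeta> t \<omega>)))))"
proof -
  obtain K C \<zeta> where K: "0 \<le> K"
    and N: "\<forall>i d t. i \<in> rows n \<longrightarrow> d \<in> servers n \<longrightarrow> noise C t (\<zeta> i d t)"
    and L: "\<forall>i d t0 T \<omega>. i \<in> rows n \<longrightarrow> d \<in> servers n \<longrightarrow> \<omega> \<in> space M \<longrightarrow> t0 \<le> T \<longrightarrow>
      (\<Sum>t\<in>{t0..<T}. real (fifo_in n w j i d t \<omega>)) \<le>
        K * (1 + fifo_backlog j t0 \<omega>) + (1 - \<eta>) * 2 ^ (j - n) / 2 ^ (n - 1) * real (T - t0) +
        (\<Sum>t\<in>{t0..<T}. \<zeta> i d t \<omega>)"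
    using fifo_in_interval_le[OF assms] by (elim exE conjE)
  note N = N[rule_format] and L = L[rule_format]
  have j: "j \<in> {n..2 * n - 1}" using assms by simp
  define N' where "N' = (2 :: real) ^ (2 * n - 1 - j)"
  have N': "N' \<ge> 0" "N' * ((1 - \<eta>) * 2 ^ (j - n) / 2 ^ (n - 1)) = 1 - \<eta>"
  proof -
    have "2 * n - 1 - j + (j - n) = n - 1" using assms by simp
    then have "N' * 2 ^ (j - n) = 2 ^ (n - 1)" by (simp add: N'_def flip: power_add)
    then show "N' * ((1 - \<eta>) * 2 ^ (j - n) / 2 ^ (n - 1)) = 1 - \<eta>" by (simp add: field_simps)
  qed (simp add: N'_def)
  have C: "0 \<le> C" using noise_bound_nonneg[OF N[of 1 1]] by simp
  have "\<exists>\<zeta>'. (\<forall>t. noise (N' * C) t (\<zeta>' t)) \<and> (\<forall>T \<omega>. \<omega> \<in> space M \<longrightarrow> (\<exists>t0\<le>T. fifo_length l j i T \<omega> \<le>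
       1 + N' * K * (1 + fifo_backlog j t0 \<omega>) - \<eta> * real (T - t0) + (\<Sum>t\<in>{t0..<T}. \<zeta>' t \<omega>)))"
    if i: "i \<in> rows n" for l i
  proof -
    let ?O = "reachable_outputs n l j i"
    note O = reachable_outputs_facts[OF j i, of l]
    have card: "real (card ?O) \<le> N'"
      unfolding N'_def using of_nat_mono[OF O(3), where 'a = real] by simp
    have "noise (N' * C) t (\<lambda>\<omega>. \<Sum>d\<in>?O. \<zeta> i d t \<omega>)" for t
    proof (rule noise_mono)
      show "noise (real (card ?O) * C) t (\<lambda>\<omega>. \<Sum>d\<in>?O. \<zeta> i d t \<omega>)"
        by (rule noise_sum[OF O(2)], rule N[OF i], erule subsetD[OF O(1)])
    qed (use card C in \<open>simp add: mult_right_mono\<close>)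
    moreover have "\<exists>t0\<le>T. fifo_length l j i T \<omega> \<le>
       1 + N' * K * (1 + fifo_backlog j t0 \<omega>) - \<eta> * real (T - t0) + (\<Sum>t\<in>{t0..<T}. \<Sum>d\<in>?O. \<zeta> i d t \<omega>)"
      if \<omega>: "\<omega> \<in> space M" for T \<omega>
    proof -
      obtain t0 where t0: "t0 \<le> T" "fifo_length l j i T \<omega> \<le>
          1 + (\<Sum>t\<in>{t0..<T}. \<Sum>d\<in>?O. real (fifo_in n w j i d t \<omega>)) - real (T - t0)"
        using fifo_length_le_supremum[OF \<omega> j i, of T l] by (elim exE conjE)
      let ?k = "K * (1 + fifo_backlog j t0 \<omega>) + (1 - \<eta>) * 2 ^ (j - n) / 2 ^ (n - 1) * real (T - t0)"
      have k: "0 \<le> ?k" using K fifo_backlog_nonneg[of j t0 \<omega>] eta by (intro add_nonneg_nonneg) auto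
      have "(\<Sum>t\<in>{t0..<T}. \<Sum>d\<in>?O. real (fifo_in n w j i d t \<omega>)) =
          (\<Sum>d\<in>?O. \<Sum>t\<in>{t0..<T}. real (fifo_in n w j i d t \<omega>))" by (rule sum.swap)
      also have "\<dots> \<le> (\<Sum>d\<in>?O. ?k + (\<Sum>t\<in>{t0..<T}. \<zeta> i d t \<omega>))"
        by (rule sum_mono, rule L[OF i _ \<omega> t0(1)], erule subsetD[OF O(1)])
      also have "\<dots> = real (card ?O) * ?k + (\<Sum>d\<in>?O. \<Sum>t\<in>{t0..<T}. \<zeta> i d t \<omega>)"
        by (subst sum.distrib) (simp only: sum_constant)
      also have "(\<Sum>d\<in>?O. \<Sum>t\<in>{t0..<T}. \<zeta> i d t \<omega>) = (\<Sum>t\<in>{t0..<T}. \<Sum>d\<in>?O. \<zeta> i d t \<omega>)" by (rule sum.swap)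
      finally have A: "(\<Sum>t\<in>{t0..<T}. \<Sum>d\<in>?O. real (fifo_in n w j i d t \<omega>)) \<le>
          real (card ?O) * ?k + (\<Sum>t\<in>{t0..<T}. \<Sum>d\<in>?O. \<zeta> i d t \<omega>)" .
      have "real (card ?O) * ?k \<le> N' * ?k" using card k by (rule mult_right_mono)
      also have "N' * ?k = N' * K * (1 + fifo_backlog j t0 \<omega>) +
          N' * ((1 - \<eta>) * 2 ^ (j - n) / 2 ^ (n - 1)) * real (T - t0)"
        by (simp only: distrib_left mult.assoc)
      finally have B: "real (card ?O) * ?k \<le> N' * K * (1 + fifo_backlog j t0 \<omega>) + (1 - \<eta>) * real (T - t0)"
        unfolding N'(2) .
      have "(1 - \<eta>) * real (T - t0) = real (T - t0) - \<eta> * real (T - t0)" by (simp add: algebra_simps)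
      then show ?thesis using t0 A B by (intro exI[of _ t0] conjI) argo+
    qed
    ultimately show ?thesis by (intro exI[of _ "\<lambda>t \<omega>. \<Sum>d\<in>?O. \<zeta> i d t \<omega>"]) blast
  qed
  moreover have "0 \<le> N' * K" using N' K by simp
  ultimately show ?thesis by (intro exI[of _ "N' * K"] exI[of _ "N' * C"]) blast
qed

text \<open>The start \<open>t0\<close> depends on the sample point, so the maximum over all
  \<open>t0 \<le> T\<close> is bounded by the sum. Its terms decay like powers of
  \<open>(1 + (\<theta> * C)\<^sup>2) * exp (- (\<theta> * \<eta>))\<close>: for small
  \<open>\<theta>\<close> the quadratic growth of the noise loses against the linear drift, so the
  bound is uniform in \<open>T\<close>.\<close>

lemma exp_fifo_length_le_geometric:
  assumes j: "n \<le> j" "j \<le> 2 * n - 1" and i: "i \<in> rows n"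
    and K: "0 \<le> K" and noise: "\<And>t. noise C t (\<zeta> t)"
    and Q: "\<And>T \<omega>. \<omega> \<in> space M \<Longrightarrow> \<exists>t0\<le>T. fifo_length l j i T \<omega> \<le>
       1 + K * (1 + fifo_backlog j t0 \<omega>) - \<eta> * real (T - t0) + (\<Sum>t\<in>{t0..<T}. \<zeta> t \<omega>)"
    and \<theta>: "0 < \<theta>" "\<theta> * C \<le> 1" "\<theta> * C\<^sup>2 \<le> \<eta> / 2"
    and B: "\<And>j' i l t. j' \<in> {n..<j} \<Longrightarrow> i \<in> rows n \<Longrightarrow> expectation
      (\<lambda>\<omega>. exp (\<theta> * K * real (card ({n..<j} \<times> rows n \<times> {Up, Lo})) * fifo_length l j' i t \<omega>)) \<le> B"
  shows "expectation (\<lambda>\<omega>. exp (\<theta> * fifo_length l j i T \<omega>)) \<le>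
    exp (\<theta> * (1 + K)) * (1 + real (card ({n..<j} \<times> rows n \<times> {Up, Lo})) * B) /
    (1 - (1 + (\<theta> * C)\<^sup>2) * exp (- (\<theta> * \<eta>)))"
proof -
  define m where "m = real (card ({n..<j} \<times> rows n \<times> {Up, Lo}))"
  define \<rho> where "\<rho> = (1 + (\<theta> * C)\<^sup>2) * exp (- (\<theta> * \<eta>))"
  have jm: "j \<in> {n..2 * n - 1}" "j \<le> 2 * n" using j by auto
  have \<rho>: "0 \<le> \<rho>" "\<rho> < 1"
  proof -
    have "(\<theta> * C)\<^sup>2 = \<theta> * (\<theta> * C\<^sup>2)" by (simp add: power2_eq_square)
    also have "\<dots> \<le> \<theta> * (\<eta> / 2)" using \<theta> by (intro mult_left_mono) auto
    finally have "1 + (\<theta> * C)\<^sup>2 \<le> exp (\<theta> * (\<eta> / 2))"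
      using exp_ge_add_one_self[of "(\<theta> * C)\<^sup>2"] by (meson exp_le_cancel_iff order_trans)
    then have "\<rho> \<le> exp (\<theta> * (\<eta> / 2)) * exp (- (\<theta> * \<eta>))"
      unfolding \<rho>_def by (intro mult_right_mono) auto
    also have "\<dots> = exp (- (\<theta> * \<eta> / 2))" by (simp flip: exp_add)
    also have "\<dots> < 1" using \<theta> eta by simp
    finally show "\<rho> < 1" .
  qed (simp add: \<rho>_def add_nonneg_nonneg)
  \<comment> \<open>The backlog at \<open>t0\<close> belongs to the history before the noise of the
    interval, so it can be the weight in \<open>noise_exp_moment\<close>.\<close>
  define Y where "Y t0 \<omega> = exp (\<theta> * K * fifo_backlog j t0 \<omega>)" for t0 \<omega>
  have a: "0 \<le> \<theta> * K" using \<theta> K by simp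
  have Ye: "expectation (Y t0) \<le> 1 + m * B"
    and Yb: "\<omega> \<in> space M \<Longrightarrow> Y t0 \<omega> \<le> exp (\<theta> * K * (m * (real t0 * (4 * 2 ^ n))))"
    and Ym: "Y t0 \<in> borel_measurable (F t0)" for t0 \<omega>
    using expectation_exp_backlog_le[where t = t0, OF j(1) jm(2) a B] unfolding Y_def[abs_def] m_def by auto
  define Z where "Z t0 \<omega> = Y t0 \<omega> * exp (\<theta> * (\<Sum>t\<in>{t0..<T}. \<zeta> t \<omega>))" for t0 \<omega>
  have Zi: "integrable M (Z t0)" for t0
  proof -
    have sb: "\<bar>\<theta> * (\<Sum>t\<in>{t0..<T}. \<zeta> t \<omega>)\<bar> \<le> \<theta> * (\<Sum>t\<in>{t0..<T}. C)" if "\<omega> \<in> space M" for \<omega>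
    proof (rule abs_mult_le)
      show "\<bar>\<Sum>t\<in>{t0..<T}. \<zeta> t \<omega>\<bar> \<le> (\<Sum>t\<in>{t0..<T}. C)"
        by (rule order_trans[OF sum_abs]) (intro sum_mono noiseD(3)[OF noise that])
    qed (use \<theta> in simp)
    show ?thesis
      unfolding Z_def[abs_def]
    proof (rule integrable_mult_bounded)
      show "Y t0 \<in> borel_measurable M" by (rule measurable_F_imp_M[OF Ym])
      show "(\<lambda>\<omega>. exp (\<theta> * (\<Sum>t\<in>{t0..<T}. \<zeta> t \<omega>))) \<in> borel_measurable M"
        using measurable_compose[OF borel_measurable_sum[of "{t0..<T}" \<zeta> M, OF noiseD(2)[OF noise]],
            of "\<lambda>x. exp (\<theta> * x)" borel] by simp
      show "\<bar>Y t0 \<omega>\<bar> \<le> exp (\<theta> * K * (m * (real t0 * (4 * 2 ^ n))))" if "\<omega> \<in> space M" for \<omega>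
        using Yb[OF that, of t0] by (simp add: Y_def)
      show "\<bar>exp (\<theta> * (\<Sum>t\<in>{t0..<T}. \<zeta> t \<omega>))\<bar> \<le> exp (\<theta> * (\<Sum>t\<in>{t0..<T}. C))" if "\<omega> \<in> space M" for \<omega>
        using sb[OF that] by simp
    qed
  qed
  have Ze: "expectation (Z t0) \<le> (1 + m * B) * (1 + (\<theta> * C)\<^sup>2) ^ (T - t0)" if "t0 \<le> T" for t0
  proof -
    have "expectation (Z t0) \<le> expectation (Y t0) * (1 + (\<theta> * C)\<^sup>2) ^ (T - t0)"
      using noise_exp_moment[where ?t0.0 = t0 and k = "T - t0" and
          B = "exp (\<theta> * K * (m * (real t0 * (4 * 2 ^ n))))", OF noise _ \<theta>(2) Ym]
        Yb \<theta>(1) that by (simp add: Z_def[abs_def] Y_def)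
    also have "\<dots> \<le> (1 + m * B) * (1 + (\<theta> * C)\<^sup>2) ^ (T - t0)"
      using Ye by (intro mult_right_mono) (auto intro!: zero_le_power add_nonneg_nonneg)
    finally show ?thesis .
  qed
  let ?c = "exp (\<theta> * (1 + K))"
  have path: "exp (\<theta> * fifo_length l j i T \<omega>) \<le> (\<Sum>t0\<le>T. ?c * Z t0 \<omega> * exp (- (\<theta> * \<eta>)) ^ (T - t0))"
    if \<omega>: "\<omega> \<in> space M" for \<omega>
  proof -
    obtain t0 where t0: "t0 \<le> T" "fifo_length l j i T \<omega> \<le>
       1 + K * (1 + fifo_backlog j t0 \<omega>) - \<eta> * real (T - t0) + (\<Sum>t\<in>{t0..<T}. \<zeta> t \<omega>)"
      using Q[OF \<omega>, of T] by (elim exE conjE)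
    have "\<theta> * fifo_length l j i T \<omega> \<le>
        \<theta> * (1 + K * (1 + fifo_backlog j t0 \<omega>) - \<eta> * real (T - t0) + (\<Sum>t\<in>{t0..<T}. \<zeta> t \<omega>))"
      using t0(2) \<theta>(1) by (intro mult_left_mono) auto
    also have "\<dots> = \<theta> * (1 + K) + \<theta> * K * fifo_backlog j t0 \<omega> + \<theta> * (\<Sum>t\<in>{t0..<T}. \<zeta> t \<omega>) +
        real (T - t0) * - (\<theta> * \<eta>)" by (simp add: algebra_simps)
    finally have "exp (\<theta> * fifo_length l j i T \<omega>) \<le> exp (\<theta> * (1 + K) + \<theta> * K * fifo_backlog j t0 \<omega> +
        \<theta> * (\<Sum>t\<in>{t0..<T}. \<zeta> t \<omega>) + real (T - t0) * - (\<theta> * \<eta>))" by simp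
    also have "\<dots> = ?c * Z t0 \<omega> * exp (- (\<theta> * \<eta>)) ^ (T - t0)"
      unfolding exp_add exp_of_nat_mult Z_def Y_def by simp
    also have "\<dots> \<le> (\<Sum>t0\<le>T. ?c * Z t0 \<omega> * exp (- (\<theta> * \<eta>)) ^ (T - t0))"
      using t0(1) by (intro member_le_sum) (auto simp: Z_def Y_def)
    finally show ?thesis .
  qed
  have "expectation (\<lambda>\<omega>. exp (\<theta> * fifo_length l j i T \<omega>)) \<le>
      expectation (\<lambda>\<omega>. \<Sum>t0\<le>T. ?c * Z t0 \<omega> * exp (- (\<theta> * \<eta>)) ^ (T - t0))"
    using \<theta>(1) by (intro integral_mono integrable_exp_fifo_length[OF jm(1) i] path
        Bochner_Integration.integrable_sum integrable_mult_left integrable_mult_right Zi) auto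
  also have "\<dots> = (\<Sum>t0\<le>T. ?c * expectation (Z t0) * exp (- (\<theta> * \<eta>)) ^ (T - t0))"
    using Zi by simp
  also have "\<dots> \<le> (\<Sum>t0\<le>T. ?c * ((1 + m * B) * (1 + (\<theta> * C)\<^sup>2) ^ (T - t0)) * exp (- (\<theta> * \<eta>)) ^ (T - t0))"
    using Ze by (intro sum_mono mult_right_mono mult_left_mono) auto
  also have "\<dots> = ?c * (1 + m * B) * (\<Sum>t0\<le>T. \<rho> ^ (T - t0))"
    unfolding \<rho>_def power_mult_distrib sum_distrib_left by (intro sum.cong refl) (simp only: mult_ac)
  also have "\<dots> \<le> ?c * (1 + m * B) * (1 / (1 - \<rho>))"
  proof (rule mult_left_mono[OF sum_pow_le_geometric[OF \<rho>]])
    have "0 \<le> expectation (Y 0)" by (intro integral_nonneg_AE) (simp add: Y_def)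
    then show "0 \<le> ?c * (1 + m * B)" using Ye[of 0] by simp
  qed
  finally show ?thesis unfolding m_def \<rho>_def by simp
qed

text \<open>Stated for all sufficiently small exponents because the next column needs the exponent
  \<open>\<theta> * K * m\<close> on the earlier ones.\<close>

lemma fifo_exp_moments:
  assumes "n \<le> j" "j \<le> 2 * n"
  shows "\<exists>\<theta>0>0. \<forall>\<theta>. 0 < \<theta> \<longrightarrow> \<theta> \<le> \<theta>0 \<longrightarrow> (\<exists>B. \<forall>j' i l t. j' \<in> {n..<j} \<longrightarrow> i \<in> rows n \<longrightarrow>
    expectation (\<lambda>\<omega>. exp (\<theta> * fifo_length l j' i t \<omega>)) \<le> B)"
  using assms
proof (induction j rule: dec_induct)
  case base
  show ?case by (intro exI[of _ 1]) simp
next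
  case (step j)
  have j: "n \<le> j" "j \<le> 2 * n - 1" "j \<le> 2 * n" using step by auto
  obtain \<theta>0 where \<theta>0: "\<theta>0 > 0" and IH: "\<forall>\<theta>. 0 < \<theta> \<longrightarrow> \<theta> \<le> \<theta>0 \<longrightarrow>
      (\<exists>B. \<forall>j' i l t. j' \<in> {n..<j} \<longrightarrow> i \<in> rows n \<longrightarrow> expectation (\<lambda>\<omega>. exp (\<theta> * fifo_length l j' i t \<omega>)) \<le> B)"
    using step.IH[OF j(3)] by (elim exE conjE)
  note IH = IH[rule_format]
  obtain K C where K: "0 \<le> K" and KC: "\<forall>l i. i \<in> rows n \<longrightarrow> (\<exists>\<zeta>. (\<forall>t. noise C t (\<zeta> t)) \<and>
    (\<forall>T \<omega>. \<omega> \<in> space M \<longrightarrow> (\<exists>t0\<le>T. fifo_length l j i T \<omega> \<le>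
       1 + K * (1 + fifo_backlog j t0 \<omega>) - \<eta> * real (T - t0) + (\<Sum>t\<in>{t0..<T}. \<zeta> t \<omega>))))"
    using fifo_length_le_backlog[OF j(1,2)] by (elim exE conjE)
  note KC = KC[rule_format]
  have C: "0 \<le> C"
  proof -
    have "1 \<in> rows n" by simp
    from KC[OF this, of Up] show ?thesis by (elim exE conjE) (rule noise_bound_nonneg, erule spec)
  qed
  define m where "m = real (card ({n..<j} \<times> rows n \<times> {Up, Lo}))"
  have m: "0 \<le> m" by (simp add: m_def)
  \<comment> \<open>The first two terms keep \<open>\<theta>\<close> and the inflated
    \<open>\<theta> * K * m\<close> within the range of the earlier columns; the others are the two
    conditions of \<open>exp_fifo_length_le_geometric\<close>. Each added 1 avoids a division by
    zero.\<close>
  define \<theta>1 where "\<theta>1 = Min {\<theta>0, \<theta>0 / (K * m + 1), 1 / (C + 1), \<eta> / (2 * (C + 1)\<^sup>2)}"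
  have Km: "0 \<le> K * m" using K m by simp
  have \<theta>1: "\<theta>1 > 0" unfolding \<theta>1_def using \<theta>0 Km C eta by auto
  have "\<exists>B. \<forall>j' i l t. j' \<in> {n..<Suc j} \<longrightarrow> i \<in> rows n \<longrightarrow> expectation (\<lambda>\<omega>. exp (\<theta> * fifo_length l j' i t \<omega>)) \<le> B"
    if \<theta>: "0 < \<theta>" "\<theta> \<le> \<theta>1" for \<theta>
  proof -
    have le: "\<theta> \<le> \<theta>0" "\<theta> \<le> \<theta>0 / (K * m + 1)" "\<theta> \<le> 1 / (C + 1)" "\<theta> \<le> \<eta> / (2 * (C + 1)\<^sup>2)"
      using \<theta>(2) by (auto simp: \<theta>1_def)
    obtain B1 where "\<forall>j' i l t. j' \<in> {n..<j} \<longrightarrow> i \<in> rows n \<longrightarrow>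
        expectation (\<lambda>\<omega>. exp (\<theta> * fifo_length l j' i t \<omega>)) \<le> B1"
      using IH[OF \<theta>(1) le(1)] by (elim exE)
    note B1 = this[rule_format]
    have "\<exists>B2. \<forall>j' i l t. j' \<in> {n..<j} \<longrightarrow> i \<in> rows n \<longrightarrow>
        expectation (\<lambda>\<omega>. exp (\<theta> * K * m * fifo_length l j' i t \<omega>)) \<le> B2"
    proof (cases "K * m = 0")
      \<comment> \<open>With no earlier columns, or with \<open>K = 0\<close>, the exponent is 0,
        which the induction hypothesis for positive exponents does not cover; the expectation is
        then 1.\<close>
      case True
      then have z: "\<theta> * K * m = 0" by auto
      show ?thesis unfolding z by (intro exI[of _ 1]) (simp add: prob_space)
    next
      case False
      then have "0 < K * m" using Km by (metis order_le_less)
      then have "0 < \<theta> * K * m" using \<theta>(1) by (simp add: mult.assoc)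
      moreover have "\<theta> * K * m \<le> \<theta>0"
      proof -
        have "\<theta> * K * m \<le> \<theta> * (K * m + 1)" using \<theta>(1) by (simp add: algebra_simps)
        also have "\<dots> \<le> \<theta>0" using le(2) Km by (simp add: field_simps)
        finally show ?thesis .
      qed
      ultimately show ?thesis by (rule IH)
    qed
    then obtain B2 where "\<forall>j' i l t. j' \<in> {n..<j} \<longrightarrow> i \<in> rows n \<longrightarrow>
        expectation (\<lambda>\<omega>. exp (\<theta> * K * m * fifo_length l j' i t \<omega>)) \<le> B2"
      by (elim exE)
    note B2 = this[rule_format]
    have c1: "\<theta> * C \<le> 1"
    proof -
      have "\<theta> * C \<le> \<theta> * (C + 1)" using \<theta>(1) by simp
      also have "\<dots> \<le> 1" using le(3) C by (simp add: field_simps)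
      finally show ?thesis .
    qed
    have c2: "\<theta> * C\<^sup>2 \<le> \<eta> / 2"
    proof -
      have "\<theta> * C\<^sup>2 \<le> \<theta> * (C + 1)\<^sup>2" using \<theta>(1) C by (intro mult_left_mono power_mono) auto
      also have "\<dots> \<le> \<eta> / 2"
        using le(4) C zero_less_power[of "C + 1" 2] by (simp add: pos_le_divide_eq)
      finally show ?thesis .
    qed
    let ?B = "exp (\<theta> * (1 + K)) * (1 + m * B2) / (1 - (1 + (\<theta> * C)\<^sup>2) * exp (- (\<theta> * \<eta>)))"
    have new: "expectation (\<lambda>\<omega>. exp (\<theta> * fifo_length l j i t \<omega>)) \<le> ?B" if i: "i \<in> rows n" for l i t
    proof -
      obtain \<zeta> where \<zeta>: "\<forall>t. noise C t (\<zeta> t)"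
        "\<forall>T \<omega>. \<omega> \<in> space M \<longrightarrow> (\<exists>t0\<le>T. fifo_length l j i T \<omega> \<le>
       1 + K * (1 + fifo_backlog j t0 \<omega>) - \<eta> * real (T - t0) + (\<Sum>t\<in>{t0..<T}. \<zeta> t \<omega>))"
        using KC[OF i, of l] by (elim exE conjE)
      show ?thesis
        unfolding m_def
        by (rule exp_fifo_length_le_geometric[OF j(1,2) i K \<zeta>(1)[rule_format] \<zeta>(2)[rule_format]
              \<theta>(1) c1 c2 B2[unfolded m_def]])
    qed
    have "expectation (\<lambda>\<omega>. exp (\<theta> * fifo_length l j' i t \<omega>)) \<le> max B1 ?B"
      if "j' \<in> {n..<Suc j}" "i \<in> rows n" for j' i l t
    proof (cases "j' = j")
      case True
      then show ?thesis using new[OF that(2), of l t] by simp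
    next
      case False
      then have "j' \<in> {n..<j}" using that(1) by auto
      then show ?thesis using B1[OF _ that(2), of j' l t] by simp
    qed
    then show ?thesis by blast
  qed
  then show ?case using \<theta>1 by blast
qed

text \<open>An exponential moment controls the mean through
  \<open>x \<le> exp (\<theta> * x) / \<theta>\<close>.\<close>

lemma fifo_stable:
  assumes "j \<in> {n..2 * n - 1}" "i \<in> rows n"
  shows "stable M (\<lambda>t \<omega>. fifo_length l j i t \<omega>)"
proof -
  obtain \<theta> where \<theta>: "\<theta> > 0" and ex: "\<forall>\<theta>'. 0 < \<theta>' \<longrightarrow> \<theta>' \<le> \<theta> \<longrightarrow>
      (\<exists>B. \<forall>j' i l t. j' \<in> {n..<2 * n} \<longrightarrow> i \<in> rows n \<longrightarrow> expectation (\<lambda>\<omega>. exp (\<theta>' * fifo_length l j' i t \<omega>)) \<le> B)"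
    using fifo_exp_moments[of "2 * n"] by auto
  obtain B where B: "\<forall>j' i l t. j' \<in> {n..<2 * n} \<longrightarrow> i \<in> rows n \<longrightarrow>
      expectation (\<lambda>\<omega>. exp (\<theta> * fifo_length l j' i t \<omega>)) \<le> B"
    using ex \<theta> by blast
  have j: "j \<in> {n..<2 * n}" using assms(1) n_ge_2 by auto
  show ?thesis
  proof (rule stable_boundedI)
    fix t
    have i1: "integrable M (\<lambda>\<omega>. exp (\<theta> * fifo_length l j i t \<omega>))"
      using \<theta> by (intro integrable_exp_fifo_length assms) simp
    have i2: "integrable M (\<lambda>\<omega>. fifo_length l j i t \<omega>)"
      using measurable_F_imp_M[OF measurable_fifo_length[OF assms, of l t]] fifo_length_le_linear[OF _ assms, of _ l t]
      by (intro integrable_bounded[of _ "real t * (4 * 2 ^ n)"]) auto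
    have "fifo_length l j i t \<omega> \<le> exp (\<theta> * fifo_length l j i t \<omega>) / \<theta>" for \<omega>
    proof -
      have "\<theta> * fifo_length l j i t \<omega> \<le> exp (\<theta> * fifo_length l j i t \<omega>)"
        using exp_ge_add_one_self[of "\<theta> * fifo_length l j i t \<omega>"] by linarith
      then show ?thesis by (simp only: pos_le_divide_eq[OF \<theta>] mult.commute)
    qed
    then have "expectation (\<lambda>\<omega>. fifo_length l j i t \<omega>) \<le> expectation (\<lambda>\<omega>. exp (\<theta> * fifo_length l j i t \<omega>) / \<theta>)"
      using i1 i2 by (intro integral_mono) auto
    also have "\<dots> \<le> B / \<theta>"
      using B[rule_format, OF j assms(2), of l t] \<theta> by (simp add: divide_right_mono)
    finally have "expectation (\<lambda>\<omega>. fifo_length l j i t \<omega>) \<le> B / \<theta>" .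
    then show "(\<integral>\<^sup>+\<omega>. ennreal (fifo_length l j i t \<omega>) \<partial>M) \<le> ennreal (B / \<theta>)"
      using i2 by (subst nn_integral_eq_integral) (auto intro: ennreal_leI)
  qed
qed

lemma physical_stable: "physical_stable M n w"
  using fictitious_stable fifo_stable
  unfolding physical_stable_def fictitious_stable_def by (simp del: atLeastAtMost_iff One_nat_def)

end

theorem theorem2:
  fixes M :: "'w measure" and n :: nat and Amax V \<eta> :: real
    and A :: "nat \<Rightarrow> nat \<Rightarrow> nat \<Rightarrow> 'w \<Rightarrow> nat"
    and U U' :: "nat \<Rightarrow> nat \<Rightarrow> real \<Rightarrow> real"
    and F G :: "nat \<Rightarrow> 'w measure"
    and w :: "'w run"
  assumes "n \<ge> 2" and "V \<ge> 1" and "0 < \<eta>" and "\<eta> < 1"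
    and "grouped_backpressure M n Amax A U U' V \<eta> F G w"
    and "fictitious_empty M n w" and "physical_empty M n w"
  shows "(fictitious_stable M n w \<and> physical_stable M n w) \<and>
         (\<forall>r r_opt.
            (\<forall>s\<in>servers n. \<forall>d\<in>servers n. has_average_rate M (admitted w s d) (r s d)) \<longrightarrow>
            optimal_rates M n A U r_opt \<longrightarrow>
            total_utility n U r \<ge>
              total_utility n U r_opt - drift_const n Amax / V - 2 ^ n * max_slope n U' * \<eta>)"
proof -
  interpret empty_benes_run M n Amax A U U' V \<eta> F G w
    using assms by (simp add: empty_benes_run_def empty_benes_run_axioms_def)
  show ?thesis
    using fictitious_stable physical_stable utility_gap by (intro conjI allI impI) blast+
qed

end
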